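(* Let $J$ be a periodic Jacobi operator on $\ell^2(\mathbb{N})$ with minimal period $q\ge 1$, and let $P_{\rm c}$ be the $\ell^2(\mathbb{N})$-projection onto the continuous spectrum of $J$. Then there exists a constant $C>0$ (depending only on $J$) such that for all $t>0$ and all $u\in \ell^1_1(\mathbb{N})$, $$\|e^{-itJ}P_{\rm c}u\|_{\ell^{\infty}_{-1}} \leq C\, t^{-1/2}\,\|u\|_{\ell^1_1}.$$
   Context: $\mathbb{N}=\{1,2,3,\dots\}$. A periodic Jacobi operator $J$ of minimal period $q\ge 1$ on $\ell^2(\mathbb{N})$ is the bounded self-adjoint operator given by $(Jv)_1=b_1v_1+a_1v_2$ and $(Jv)_n=a_{n-1}v_{n-1}+b_nv_n+a_nv_{n+1}$ for $n\ge 2$, where $a_n>0$ and $b_n\in\mathbb{R}$ satisfy $a_{n+q}=a_n$ and $b_{n+q}=b_n$ for all $n\in\mathbb{N}$, and $q$ is the smallest positive integer with this property. $P_{\rm c}$ is the orthogonal projection of $\ell^2(\mathbb{N})$ onto the subspace associated with the continuous part of the spectrum of $J$ (i.e. the orthogonal complement of the closed span of the $\ell^2$-eigenvectors of $J$). Weighted norms: for $u:\mathbb{N}\to\mathbb{C}$, $\sigma\in\mathbb{R}$ and $1\le p<\infty$, $\|u\|_{\ell^p_\sigma}=\left[\sum_{n\ge1}|n^\sigma u_n|^p\right]^{1/p}$ and $\|u\|_{\ell^\infty_\sigma}=\sup_{n\ge1}|n^\sigma u_n|$. *)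

theory Defs
  imports "HOL-Analysis.Analysis"
begin

section \<open>The Hilbert space of square-summable sequences\<close>

text \<open>
  Sequences indexed by 1, 2, 3, ... are functions on \<^typ>\<open>nat\<close> whose entry at the unused index 0 is 0.
  All sums and suprema run over \<^term>\<open>{1::nat..}\<close>.
\<close>

typedef ell2 = "{u :: nat \<Rightarrow> complex. u 0 = 0 \<and> (\<lambda>n. (cmod (u n))\<^sup>2) summable_on {1..}}"
  morphisms ent Ell2
  by (rule exI[of _ "\<lambda>_. 0"]) auto

setup_lifting type_definition_ell2

lemma ent_0 [simp]: "ent u 0 = 0"
  using ent[of u] by auto

lemma ent_sq_summable: "(\<lambda>n. (cmod (ent u n))\<^sup>2) summable_on {1..}"
  using ent[of u] by auto

lemma ell2_eqI: "(\<And>n. n \<ge> 1 \<Longrightarrow> ent u n = ent v n) \<Longrightarrow> u = v"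
  by (metis One_nat_def Suc_leI ent_0 ent_inject ext neq0_conv)

lemma sq_norm_add_le: "(cmod (x + y))\<^sup>2 \<le> 2 * ((cmod x)\<^sup>2 + (cmod y)\<^sup>2)"
proof -
  have "(cmod (x + y))\<^sup>2 \<le> (cmod x + cmod y)\<^sup>2"
    by (intro power_mono norm_triangle_ineq) auto
  also have "\<dots> \<le> 2 * ((cmod x)\<^sup>2 + (cmod y)\<^sup>2)"
    using sum_squares_bound[of "cmod x" "cmod y"] by (simp add: power2_sum)
  finally show ?thesis .
qed

lemma sq_summable_add:
  assumes "(\<lambda>n. (cmod (u n))\<^sup>2) summable_on A" "(\<lambda>n. (cmod (v n))\<^sup>2) summable_on A"
  shows "(\<lambda>n. (cmod (u n + v n))\<^sup>2) summable_on A"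
proof (rule summable_on_comparison_test)
  show "(\<lambda>n. 2 * ((cmod (u n))\<^sup>2 + (cmod (v n))\<^sup>2)) summable_on A"
    by (intro summable_on_cmult_right summable_on_add assms)
qed (rule sq_norm_add_le, simp)

lemma sq_summable_cmult:
  assumes "(\<lambda>n. (cmod (u n))\<^sup>2) summable_on A"
  shows "(\<lambda>n. (cmod (c * u n))\<^sup>2) summable_on A"
  using summable_on_cmult_right[OF assms, of "(cmod c)\<^sup>2"]
  by (simp add: norm_mult power_mult_distrib)

lift_definition scaleC :: "complex \<Rightarrow> ell2 \<Rightarrow> ell2" (infixr "*\<^sub>C" 75) is "\<lambda>c u n. c * u n"
  using sq_summable_cmult by auto

definition cinner :: "ell2 \<Rightarrow> ell2 \<Rightarrow> complex" where
  "cinner u v = (\<Sum>\<^sub>\<infinity>n\<in>{1..}. cnj (ent u n) * ent v n)"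

lemma cinner_summable: "(\<lambda>n. cnj (ent u n) * ent v n) summable_on {1..}"
proof -
  have "(\<lambda>n. cmod (cnj (ent u n) * ent v n)) summable_on {1..}"
    by (rule abs_summable_product)
       (use ent_sq_summable[of u] ent_sq_summable[of v] in \<open>simp_all add: norm_mult power2_eq_square\<close>)
  thus ?thesis by (rule abs_summable_summable)
qed

lemma Re_cinner_self: "Re (cinner u u) = (\<Sum>\<^sub>\<infinity>n\<in>{1..}. (cmod (ent u n))\<^sup>2)"
proof -
  have "Re (cinner u u) = (\<Sum>\<^sub>\<infinity>n\<in>{1..}. Re (cnj (ent u n) * ent u n))"
    unfolding cinner_def using cinner_summable by (subst infsum_Re) auto
  also have "(\<lambda>n. Re (cnj (ent u n) * ent u n)) = (\<lambda>n. (cmod (ent u n))\<^sup>2)"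
    by (simp add: cmod_power2 fun_eq_iff) (simp add: power2_eq_square)
  finally show ?thesis .
qed

instantiation ell2 :: real_inner
begin

lift_definition zero_ell2 :: ell2 is "\<lambda>_. 0" by auto
lift_definition plus_ell2 :: "ell2 \<Rightarrow> ell2 \<Rightarrow> ell2" is "\<lambda>u v n. u n + v n"
  using sq_summable_add by auto
lift_definition uminus_ell2 :: "ell2 \<Rightarrow> ell2" is "\<lambda>u n. - u n" by auto
lift_definition minus_ell2 :: "ell2 \<Rightarrow> ell2 \<Rightarrow> ell2" is "\<lambda>u v n. u n - v n"
proof -
  fix u v :: "nat \<Rightarrow> complex"
  assume "u 0 = 0 \<and> (\<lambda>n. (cmod (u n))\<^sup>2) summable_on {1..}"
    "v 0 = 0 \<and> (\<lambda>n. (cmod (v n))\<^sup>2) summable_on {1..}"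
  thus "u 0 - v 0 = 0 \<and> (\<lambda>n. (cmod (u n - v n))\<^sup>2) summable_on {1..}"
    using sq_summable_add[of u "{1..}" "\<lambda>n. - v n"] by simp
qed
lift_definition scaleR_ell2 :: "real \<Rightarrow> ell2 \<Rightarrow> ell2" is "\<lambda>r u n. r *\<^sub>R u n"
  using sq_summable_cmult[of _ _ "complex_of_real _"] by (auto simp: scaleR_conv_of_real)

definition inner_ell2 :: "ell2 \<Rightarrow> ell2 \<Rightarrow> real" where "inner_ell2 u v = Re (cinner u v)"
definition norm_ell2 :: "ell2 \<Rightarrow> real" where "norm_ell2 u = sqrt (inner u u)"
definition dist_ell2 :: "ell2 \<Rightarrow> ell2 \<Rightarrow> real" where "dist_ell2 u v = norm (u - v)"
definition sgn_ell2 :: "ell2 \<Rightarrow> ell2" where "sgn_ell2 u = inverse (norm u) *\<^sub>R u"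
definition uniformity_ell2 :: "(ell2 \<times> ell2) filter" where
  "uniformity_ell2 = (INF e\<in>{0<..}. principal {(x, y). dist x y < e})"
definition open_ell2 :: "ell2 set \<Rightarrow> bool" where
  "open_ell2 U \<longleftrightarrow> (\<forall>x\<in>U. eventually (\<lambda>(x', y). x' = x \<longrightarrow> y \<in> U) uniformity)"

instance
proof
  fix u v w :: ell2 and r s :: real
  show "u + v + w = u + (v + w)" "u + v = v + u" "0 + u = u" "- u + u = 0" "u - v = u + - v"
    "r *\<^sub>R (u + v) = r *\<^sub>R u + r *\<^sub>R v" "(r + s) *\<^sub>R u = r *\<^sub>R u + s *\<^sub>R u"
    "r *\<^sub>R s *\<^sub>R u = (r * s) *\<^sub>R u" "1 *\<^sub>R u = u"
    by (transfer; simp add: algebra_simps)+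
  show "dist u v = norm (u - v)" "sgn u = inverse (norm u) *\<^sub>R u"
    "uniformity = (INF e\<in>{0<..}. principal {(x :: ell2, y). dist x y < e})"
    "norm u = sqrt (inner u u)"
    by (simp_all add: dist_ell2_def sgn_ell2_def uniformity_ell2_def norm_ell2_def)
  show "open U = (\<forall>x\<in>U. eventually (\<lambda>(x', y). x' = x \<longrightarrow> y \<in> U) uniformity)" for U :: "ell2 set"
    by (simp add: open_ell2_def)
  have "cinner u v = cnj (cinner v u)"
    unfolding cinner_def by (simp add: mult.commute flip: infsum_cnj)
  thus "inner u v = inner v u" by (simp add: inner_ell2_def)
  have "cinner (u + v) w = cinner u w + cinner v w"
    unfolding cinner_def
    using infsum_add[OF cinner_summable[of u w] cinner_summable[of v w]]
    by (simp add: plus_ell2.rep_eq algebra_simps)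
  thus "inner (u + v) w = inner u w + inner v w" by (simp add: inner_ell2_def)
  have "cinner (r *\<^sub>R u) v = of_real r * cinner u v"
    unfolding cinner_def
    by (simp add: scaleR_ell2.rep_eq scaleR_conv_of_real mult.assoc infsum_cmult_right')
  thus "inner (r *\<^sub>R u) v = r * inner u v" by (simp add: inner_ell2_def)
  show "0 \<le> inner u u"
    unfolding inner_ell2_def Re_cinner_self by (rule infsum_nonneg) auto
  show "inner u u = 0 \<longleftrightarrow> u = 0"
  proof
    assume "inner u u = 0"
    hence *: "(\<Sum>\<^sub>\<infinity>n\<in>{1..}. (cmod (ent u n))\<^sup>2) = 0" by (simp add: inner_ell2_def Re_cinner_self)
    have "ent u n = 0" if "n \<ge> 1" for n
      using nonneg_infsum_le_0D[of "\<lambda>n. (cmod (ent u n))\<^sup>2" "{1..}" n] * ent_sq_summable[of u] that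
      by auto
    thus "u = 0" by (intro ell2_eqI) (auto simp: zero_ell2.rep_eq)
  next
    assume "u = 0"
    thus "inner u u = 0" by (simp add: inner_ell2_def Re_cinner_self zero_ell2.rep_eq)
  qed
qed

end

lemmas ent_simps [simp] = zero_ell2.rep_eq plus_ell2.rep_eq uminus_ell2.rep_eq
  minus_ell2.rep_eq scaleR_ell2.rep_eq scaleC.rep_eq

lemma norm_ell2_sq: "(norm u)\<^sup>2 = (\<Sum>\<^sub>\<infinity>n\<in>{1..}. (cmod (ent u n))\<^sup>2)"
  using power2_norm_eq_inner[of u] by (simp only: inner_ell2_def Re_cinner_self)

lemma finite_sum_le_norm: "finite F \<Longrightarrow> F \<subseteq> {1..} \<Longrightarrow> (\<Sum>n\<in>F. (cmod (ent u n))\<^sup>2) \<le> (norm u)\<^sup>2"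
  unfolding norm_ell2_sq by (rule finite_sum_le_infsum[OF ent_sq_summable]) auto

lemma cmod_ent_le_norm: "cmod (ent u n) \<le> norm u"
proof (cases "n \<ge> 1")
  case True
  have "(cmod (ent u n))\<^sup>2 \<le> (norm u)\<^sup>2" using finite_sum_le_norm[of "{n}" u] True by simp
  thus ?thesis by (rule power2_le_imp_le) simp
qed (simp add: not_le)

lemma Ell2_bounded:
  assumes "f 0 = 0" "K \<ge> 0"
    and "\<And>F. finite F \<Longrightarrow> F \<subseteq> {1..} \<Longrightarrow> (\<Sum>n\<in>F. (cmod (f n))\<^sup>2) \<le> K\<^sup>2"
  shows "ent (Ell2 f) = f" "norm (Ell2 f) \<le> K"
proof -
  have "bdd_above (sum (\<lambda>n. (cmod (f n))\<^sup>2) ` {F. F \<subseteq> {1..} \<and> finite F})"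
    by (rule bdd_aboveI2[where M = "K\<^sup>2"]) (use assms(3) in blast)
  hence "(\<lambda>n. (cmod (f n))\<^sup>2) summable_on {1..}"
    by (intro nonneg_bdd_above_summable_on) simp
  thus eq: "ent (Ell2 f) = f" using assms(1) by (intro Ell2_inverse) simp
  have "(norm (Ell2 f))\<^sup>2 \<le> K\<^sup>2"
    unfolding norm_ell2_sq
    by (rule infsum_le_finite_sums[OF ent_sq_summable]) (simp add: eq assms(3))
  thus "norm (Ell2 f) \<le> K" using assms(2) by (rule power2_le_imp_le)
qed

instance ell2 :: complete_space
proof
  fix X :: "nat \<Rightarrow> ell2"
  assume C: "Cauchy X"
  have "Cauchy (\<lambda>k. ent (X k) n)" for n
    unfolding Cauchy_def
  proof (intro allI impI)
    fix e :: real assume "e > 0"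
    then obtain M where M: "\<And>i j. i \<ge> M \<Longrightarrow> j \<ge> M \<Longrightarrow> dist (X i) (X j) < e"
      using C unfolding Cauchy_def by blast
    have "dist (ent (X i) n) (ent (X j) n) < e" if "i \<ge> M" "j \<ge> M" for i j
      using cmod_ent_le_norm[of "X i - X j" n] M[OF that] by (simp add: dist_norm)
    thus "\<exists>M. \<forall>i\<ge>M. \<forall>j\<ge>M. dist (ent (X i) n) (ent (X j) n) < e" by blast
  qed
  hence "\<exists>l. (\<lambda>k. ent (X k) n) \<longlonglongrightarrow> l" for n
    using Cauchy_convergent convergent_def by blast
  then obtain l where l: "\<And>n. (\<lambda>k. ent (X k) n) \<longlonglongrightarrow> l n" by metis
  have l0: "l 0 = 0" using l[of 0] by (simp add: LIMSEQ_const_iff)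
  have bound: "(\<Sum>n\<in>F. (cmod (ent (X i) n - l n))\<^sup>2) \<le> e\<^sup>2"
    if "\<And>i j. i \<ge> M \<Longrightarrow> j \<ge> M \<Longrightarrow> dist (X i) (X j) < e" "i \<ge> M" "finite F" "F \<subseteq> {1..}" for F M i e
  proof (rule Lim_bounded[of _ _ M])
    show "(\<lambda>j. \<Sum>n\<in>F. (cmod (ent (X i) n - ent (X j) n))\<^sup>2) \<longlonglongrightarrow> (\<Sum>n\<in>F. (cmod (ent (X i) n - l n))\<^sup>2)"
      by (intro tendsto_intros l)
    show "\<forall>j\<ge>M. (\<Sum>n\<in>F. (cmod (ent (X i) n - ent (X j) n))\<^sup>2) \<le> e\<^sup>2"
    proof (intro allI impI)
      fix j assume "j \<ge> M"
      hence "(norm (X i - X j))\<^sup>2 \<le> e\<^sup>2"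
        using that(1)[of i j] that(2) by (intro power_mono) (auto simp: dist_norm)
      thus "(\<Sum>n\<in>F. (cmod (ent (X i) n - ent (X j) n))\<^sup>2) \<le> e\<^sup>2"
        using finite_sum_le_norm[of F "X i - X j"] that by simp
    qed
  qed
  obtain M0 where M0: "\<And>i j. i \<ge> M0 \<Longrightarrow> j \<ge> M0 \<Longrightarrow> dist (X i) (X j) < 1"
    using C[unfolded Cauchy_def, rule_format, of 1] by auto
  have D: "ent (Ell2 (\<lambda>n. ent (X M0) n - l n)) = (\<lambda>n. ent (X M0) n - l n)"
  proof (rule Ell2_bounded(1)[of _ 1])
    fix F :: "nat set" assume "finite F" "F \<subseteq> {1..}"
    from bound[OF M0 order_refl this] show "(\<Sum>n\<in>F. (cmod (ent (X M0) n - l n))\<^sup>2) \<le> 1\<^sup>2" .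
  qed (use l0 in simp_all)
  define L where "L = X M0 - Ell2 (\<lambda>n. ent (X M0) n - l n)"
  have L: "ent L = l" by (rule ext) (simp add: L_def D)
  have "X \<longlonglongrightarrow> L"
    unfolding LIMSEQ_def
  proof (intro allI impI)
    fix e :: real assume e: "e > 0"
    then obtain M where M: "\<And>i j. i \<ge> M \<Longrightarrow> j \<ge> M \<Longrightarrow> dist (X i) (X j) < e / 2"
      using C[unfolded Cauchy_def, rule_format, of "e / 2"] by auto
    have "dist (X i) L < e" if i: "i \<ge> M" for i
    proof -
      have "norm (Ell2 (ent (X i - L))) \<le> e / 2"
      proof (rule Ell2_bounded(2))
        fix F :: "nat set" assume "finite F" "F \<subseteq> {1..}"
        from bound[OF M i this] show "(\<Sum>n\<in>F. (cmod (ent (X i - L) n))\<^sup>2) \<le> (e / 2)\<^sup>2"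
          by (simp only: minus_ell2.rep_eq L)
      qed (use e in simp_all)
      thus ?thesis using e by (simp only: ent_inverse dist_norm)
    qed
    thus "\<exists>M. \<forall>i\<ge>M. dist (X i) L < e" by blast
  qed
  thus "convergent X" by (auto simp: convergent_def)
qed

instance ell2 :: banach ..

interpretation ell2: vector_space scaleC
  by unfold_locales (auto intro!: ell2_eqI simp: algebra_simps)

section \<open>Orthogonal projections\<close>

definition orth_compl :: "ell2 set \<Rightarrow> ell2 set" where
  "orth_compl S = {v. \<forall>w\<in>S. cinner w v = 0}"

definition orth_proj :: "ell2 set \<Rightarrow> ell2 \<Rightarrow> ell2" where
  "orth_proj M u = (THE w. w \<in> M \<and> u - w \<in> orth_compl M)"

lemma cinner_add_right: "cinner u (v + w) = cinner u v + cinner u w"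
  unfolding cinner_def
  using infsum_add[OF cinner_summable[of u v] cinner_summable[of u w]] by (simp add: algebra_simps)

lemma cinner_scaleC_right: "cinner u (c *\<^sub>C v) = c * cinner u v"
  unfolding cinner_def by (simp add: mult.left_commute infsum_cmult_right')

lemma cinner_commute: "cinner u v = cnj (cinner v u)"
  unfolding cinner_def by (simp add: mult.commute flip: infsum_cnj)

lemma cinner_scaleC_left: "cinner (c *\<^sub>C u) v = cnj c * cinner u v"
  by (metis cinner_commute cinner_scaleC_right complex_cnj_mult)

lemma scaleR_scaleC: "r *\<^sub>R u = complex_of_real r *\<^sub>C u"
  by (rule ell2_eqI) (simp add: scaleR_conv_of_real)

lemma cinner_inner: "cinner u v = Complex (inner u v) (inner (\<i> *\<^sub>C u) v)"
  by (simp add: inner_ell2_def cinner_scaleC_left complex_eq_iff)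

lemma cinner_diff_right: "cinner u (v - w) = cinner u v - cinner u w"
  using cinner_add_right[of u "v - w" w] by simp

lemma subspace_orth_compl: "ell2.subspace (orth_compl S)"
proof -
  have "cinner w 0 = 0" for w by (simp add: cinner_def)
  thus ?thesis
    by (auto simp: ell2.subspace_def orth_compl_def cinner_add_right cinner_scaleC_right)
qed

lemma closed_orth_compl: "closed (orth_compl S)"
proof -
  have "orth_compl S = (\<Inter>w\<in>S. {v. inner w v = 0} \<inter> {v. inner (\<i> *\<^sub>C w) v = 0})"
    by (auto simp: orth_compl_def cinner_inner complex_eq_iff)
  thus ?thesis by (auto intro!: closed_INT closed_Int closed_Collect_eq continuous_intros)
qed

lemma orth_proj_exists:
  assumes M: "ell2.subspace M" "closed M"
  shows "\<exists>w\<in>M. u - w \<in> orth_compl M"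
proof -
  have M_add: "x + y \<in> M" and M_scale: "c *\<^sub>C x \<in> M" if "x \<in> M" "y \<in> M" for x y c
    using that M(1) by (auto simp: ell2.subspace_def)
  have conv: "convex M"
    by (rule convexI) (use M_add M_scale in \<open>auto simp: scaleR_scaleC\<close>)
  have ne: "M \<noteq> {}" using M(1) by (auto simp: ell2.subspace_def)
  define d where "d = infdist u M"
  have d_le: "d \<le> norm (u - x)" if "x \<in> M" for x
    using infdist_le[OF that, of u] by (simp add: d_def dist_norm)
  have d0: "d \<ge> 0" by (simp add: d_def infdist_nonneg)
  have "\<exists>x\<in>M. (norm (u - x))\<^sup>2 < d\<^sup>2 + e" if "e > 0" for e
  proof -
    have "d < sqrt (d\<^sup>2 + e)" using that d0 by (intro real_less_rsqrt) auto
    hence "\<exists>x\<in>M. dist u x < sqrt (d\<^sup>2 + e)"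
      using ne unfolding d_def infdist_def by (simp add: cINF_less_iff)
    then obtain x where "x \<in> M" "norm (u - x) < sqrt (d\<^sup>2 + e)" by (auto simp: dist_norm)
    moreover from this have "(norm (u - x))\<^sup>2 < (sqrt (d\<^sup>2 + e))\<^sup>2"
      by (intro power_strict_mono) auto
    ultimately show ?thesis using that by auto
  qed
  hence "\<forall>k. \<exists>x\<in>M. (norm (u - x))\<^sup>2 < d\<^sup>2 + inverse (real (Suc k))" by simp
  then obtain X where X: "\<And>k. X k \<in> M" "\<And>k. (norm (u - X k))\<^sup>2 < d\<^sup>2 + inverse (real (Suc k))"
    by metis
  have par: "(norm (x - y))\<^sup>2 \<le> 2 * (norm (u - x))\<^sup>2 + 2 * (norm (u - y))\<^sup>2 - 4 * d\<^sup>2"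
    if "x \<in> M" "y \<in> M" for x y
  proof -
    have "(1/2) *\<^sub>R (x + y) \<in> M" using M_add M_scale that by (simp add: scaleR_scaleC)
    hence "d\<^sup>2 \<le> (norm (u - (1/2) *\<^sub>R (x + y)))\<^sup>2" using d_le d0 by (intro power_mono) auto
    thus ?thesis
      unfolding power2_norm_eq_inner by (simp add: inner_commute algebra_simps)
  qed
  have "Cauchy X"
    unfolding Cauchy_altdef2
  proof (intro allI impI)
    fix e :: real assume e: "e > 0"
    obtain N where N: "inverse (real (Suc N)) < e\<^sup>2 / 4" using reals_Archimedean[of "e\<^sup>2 / 4"] e by auto
    have "dist (X n) (X N) < e" if "n \<ge> N" for n
    proof -
      have "inverse (real (Suc n)) \<le> inverse (real (Suc N))" using that by simp
      hence "(norm (X n - X N))\<^sup>2 < e\<^sup>2" using par[OF X(1) X(1), of n N] X(2)[of n] X(2)[of N] N by linarith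
      thus ?thesis using e by (simp add: dist_norm power2_less_imp_less)
    qed
    thus "\<exists>N. \<forall>n\<ge>N. dist (X n) (X N) < e" by blast
  qed
  then obtain w where w: "X \<longlonglongrightarrow> w" using Cauchy_convergent convergent_def by blast
  have wM: "w \<in> M" using closed_sequentially[OF M(2)] X(1) w by blast
  have "(\<lambda>k. d\<^sup>2 + inverse (real (Suc k))) \<longlonglongrightarrow> d\<^sup>2 + 0"
    by (intro tendsto_intros LIMSEQ_inverse_real_of_nat)
  moreover have "(\<lambda>k. (norm (u - X k))\<^sup>2) \<longlonglongrightarrow> (norm (u - w))\<^sup>2" by (intro tendsto_intros w)
  ultimately have "(norm (u - w))\<^sup>2 \<le> d\<^sup>2"
    using LIMSEQ_le[of "\<lambda>k. (norm (u - X k))\<^sup>2" _ "\<lambda>k. d\<^sup>2 + inverse (real (Suc k))" "d\<^sup>2"] X(2)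
    by (auto intro: less_imp_le)
  hence "norm (u - w) \<le> d" using d0 by (rule power2_le_imp_le)
  hence min: "\<forall>z\<in>M. dist u w \<le> dist u z" using d_le by (force simp: dist_norm)
  have orth: "inner (u - w) z = 0" if z: "z \<in> M" for z
  proof -
    have "- z \<in> M" using M_scale[OF z z, of "-1"] by simp
    hence "w + z \<in> M" "w + - z \<in> M" using wM z M_add by blast+
    from this[THEN any_closest_point_dot[OF conv M(2) wM _ min]] show ?thesis by simp
  qed
  have "cinner z (u - w) = 0" if z: "z \<in> M" for z
    using orth[OF z] orth[OF M_scale[OF z z, of \<i>]] by (simp add: cinner_inner inner_commute complex_eq_iff)
  thus ?thesis using wM by (auto simp: orth_compl_def)
qed

lemma orth_proj_unique:
  assumes M: "ell2.subspace M" and w: "w \<in> M" "u - w \<in> orth_compl M"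
    and w': "w' \<in> M" "u - w' \<in> orth_compl M"
  shows "w' = w"
proof -
  have "w' - w \<in> M" using M w'(1) w(1) by (rule ell2.subspace_diff)
  moreover have "(u - w) - (u - w') \<in> orth_compl M"
    using subspace_orth_compl w(2) w'(2) by (rule ell2.subspace_diff)
  ultimately have "cinner (w' - w) (w' - w) = 0" by (simp add: orth_compl_def)
  hence "inner (w' - w) (w' - w) = 0" by (simp add: inner_ell2_def)
  thus ?thesis by simp
qed

lemma orth_proj:
  assumes "ell2.subspace M" "closed M"
  shows "orth_proj M u \<in> M" "u - orth_proj M u \<in> orth_compl M"
proof -
  have "\<exists>!w. w \<in> M \<and> u - w \<in> orth_compl M"
    using orth_proj_exists[OF assms, of u] orth_proj_unique[OF assms(1)] by blast
  hence "orth_proj M u \<in> M \<and> u - orth_proj M u \<in> orth_compl M"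
    unfolding orth_proj_def by (rule theI')
  thus "orth_proj M u \<in> M" "u - orth_proj M u \<in> orth_compl M" by auto
qed

section \<open>Bounded operators\<close>

text \<open>
  Elements of \<^typ>\<open>ell2 \<Rightarrow>\<^sub>L ell2\<close> are only required to be real-linear; complex linearity of
  a Jacobi operator follows from its action on entries.
\<close>

lemma norm_scaleC: "norm (c *\<^sub>C u) = cmod c * norm u"
proof -
  have "(norm (c *\<^sub>C u))\<^sup>2 = (cmod c * norm u)\<^sup>2"
    unfolding power_mult_distrib norm_ell2_sq by (simp add: norm_mult power_mult_distrib infsum_cmult_right')
  thus ?thesis by (simp add: power2_eq_iff_nonneg)
qed

lift_definition scaleC_op :: "complex \<Rightarrow> ell2 \<Rightarrow>\<^sub>L ell2" is scaleC
  by (rule bounded_linear_intro[of _ "cmod _"])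
     (auto simp: norm_scaleC mult.commute ell2.scale_right_distrib scaleR_scaleC ell2.scale_left_commute)

definition op_power :: "('a::real_normed_vector \<Rightarrow>\<^sub>L 'a) \<Rightarrow> nat \<Rightarrow> 'a \<Rightarrow>\<^sub>L 'a" where
  "op_power A k = (blinfun_compose A ^^ k) id_blinfun"

definition op_exp :: "('a::banach \<Rightarrow>\<^sub>L 'a) \<Rightarrow> 'a \<Rightarrow>\<^sub>L 'a" where
  "op_exp A = (\<Sum>k. op_power A k /\<^sub>R fact k)"

lemma op_exp_summable:
  fixes A :: "'a::banach \<Rightarrow>\<^sub>L 'a"
  shows "summable (\<lambda>k. op_power A k /\<^sub>R fact k)"
proof (rule summable_comparison_test[OF _ summable_exp[of "norm A"]])
  have "norm (op_power A k) \<le> norm A ^ k" for k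
  proof (induction k)
    case 0
    show ?case by (simp add: op_power_def norm_blinfun_id_le)
  next
    case (Suc k)
    have "norm (op_power A (Suc k)) \<le> norm A * norm (op_power A k)"
      by (simp add: op_power_def norm_blinfun_compose)
    also have "\<dots> \<le> norm A * norm A ^ k" by (intro mult_left_mono Suc) auto
    finally show ?case by simp
  qed
  thus "\<exists>N. \<forall>k\<ge>N. norm (op_power A k /\<^sub>R fact k) \<le> inverse (fact k) * norm A ^ k"
    by (auto intro!: mult_left_mono)
qed

section \<open>Periodic Jacobi operators\<close>

definition jacobi_op :: "(nat \<Rightarrow> real) \<Rightarrow> (nat \<Rightarrow> real) \<Rightarrow> (ell2 \<Rightarrow>\<^sub>L ell2) \<Rightarrow> bool" where
  "jacobi_op a b J \<longleftrightarrow>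
     (\<forall>v. ent (J v) 1 = of_real (b 1) * ent v 1 + of_real (a 1) * ent v 2 \<and>
          (\<forall>n\<ge>2. ent (J v) n =
             of_real (a (n - 1)) * ent v (n - 1) + of_real (b n) * ent v n + of_real (a n) * ent v (n + 1)))"

definition periodic_coeffs :: "nat \<Rightarrow> (nat \<Rightarrow> real) \<Rightarrow> (nat \<Rightarrow> real) \<Rightarrow> bool" where
  "periodic_coeffs q a b \<longleftrightarrow> (\<forall>n\<ge>1. a (n + q) = a n \<and> b (n + q) = b n)"

definition periodic_jacobi_op :: "nat \<Rightarrow> (ell2 \<Rightarrow>\<^sub>L ell2) \<Rightarrow> bool" where
  "periodic_jacobi_op q J \<longleftrightarrow>
     (\<exists>a b. (\<forall>n\<ge>1. a n > 0) \<and> jacobi_op a b J \<and>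
            q \<ge> 1 \<and> periodic_coeffs q a b \<and> (\<forall>p\<ge>1. periodic_coeffs p a b \<longrightarrow> q \<le> p))"

lemma bounded_op_exists:
  assumes "\<And>v. f v 0 = 0" "K \<ge> 0"
    and "\<And>u v n. f (u + v) n = f u n + f v n" "\<And>r v n. f (r *\<^sub>R v) n = r *\<^sub>R f v n"
    and "\<And>v F. finite F \<Longrightarrow> F \<subseteq> {1..} \<Longrightarrow> (\<Sum>n\<in>F. (cmod (f v n))\<^sup>2) \<le> (norm v * K)\<^sup>2"
  shows "\<exists>T :: ell2 \<Rightarrow>\<^sub>L ell2. \<forall>v. ent (T v) = f v"
proof -
  have E: "ent (Ell2 (f v)) = f v" "norm (Ell2 (f v)) \<le> norm v * K" for v
    by (rule Ell2_bounded[of "f v" "norm v * K"]; use assms in simp)+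
  have "bounded_linear (\<lambda>v. Ell2 (f v))"
    by (rule bounded_linear_intro[of _ K]) (auto intro!: ell2_eqI simp: E assms)
  thus ?thesis using E by (intro exI[of _ "Blinfun (\<lambda>v. Ell2 (f v))"]) (simp add: bounded_linear_Blinfun_apply)
qed

lemma jacobi_op_exists:
  assumes a: "\<And>n. n \<ge> 1 \<Longrightarrow> \<bar>a n\<bar> \<le> K" and b: "\<And>n. n \<ge> 1 \<Longrightarrow> \<bar>b n\<bar> \<le> K"
  shows "\<exists>J. jacobi_op a b J"
proof -
  have K: "K \<ge> 0" using a[of 1] by auto
  have mult: "\<exists>T :: ell2 \<Rightarrow>\<^sub>L ell2. \<forall>v. ent (T v) = (\<lambda>n. of_real (c n) * ent v n)"
    if c: "\<And>n. n \<ge> 1 \<Longrightarrow> \<bar>c n\<bar> \<le> K" for c :: "nat \<Rightarrow> real"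
  proof (rule bounded_op_exists[of _ K])
    fix v :: ell2 and F :: "nat set"
    assume F: "finite F" "F \<subseteq> {1..}"
    have "(\<Sum>n\<in>F. (cmod (of_real (c n) * ent v n))\<^sup>2) \<le> (\<Sum>n\<in>F. K\<^sup>2 * (cmod (ent v n))\<^sup>2)"
    proof (intro sum_mono)
      fix n assume "n \<in> F"
      hence "\<bar>c n\<bar>\<^sup>2 \<le> K\<^sup>2" using c[of n] F by (intro power_mono) auto
      thus "(cmod (of_real (c n) * ent v n))\<^sup>2 \<le> K\<^sup>2 * (cmod (ent v n))\<^sup>2"
        by (simp add: norm_mult power_mult_distrib mult_right_mono)
    qed
    also have "\<dots> \<le> K\<^sup>2 * (norm v)\<^sup>2"
      using finite_sum_le_norm[OF F, of v] by (simp add: mult_left_mono flip: sum_distrib_left)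
    finally show "(\<Sum>n\<in>F. (cmod (of_real (c n) * ent v n))\<^sup>2) \<le> (norm v * K)\<^sup>2"
      by (simp add: power_mult_distrib mult.commute)
  qed (use K in \<open>simp_all add: distrib_left\<close>)
  have "\<exists>T :: ell2 \<Rightarrow>\<^sub>L ell2. \<forall>v. ent (T v) = (\<lambda>n. ent v (n - 1))"
  proof (rule bounded_op_exists[of _ 1])
    fix v :: ell2 and F :: "nat set"
    assume F: "finite F" "F \<subseteq> {1..}"
    have "inj_on (\<lambda>n. n - 1) F"
    proof (rule inj_onI)
      fix x y assume "x \<in> F" "y \<in> F" "x - 1 = y - 1"
      moreover from this have "x \<ge> 1" "y \<ge> 1" using F(2) by auto
      ultimately show "x = y" by linarith
    qed
    hence "(\<Sum>n\<in>F. (cmod (ent v (n - 1)))\<^sup>2) = (\<Sum>n\<in>(\<lambda>n. n - 1) ` F. (cmod (ent v n))\<^sup>2)"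
      by (simp add: sum.reindex)
    also have "\<dots> = (\<Sum>n\<in>(\<lambda>n. n - 1) ` F - {0}. (cmod (ent v n))\<^sup>2)"
      using F by (intro sum.mono_neutral_right) auto
    also have "\<dots> \<le> (norm v)\<^sup>2" using F by (intro finite_sum_le_norm) auto
    finally show "(\<Sum>n\<in>F. (cmod (ent v (n - 1)))\<^sup>2) \<le> (norm v * 1)\<^sup>2" by simp
  qed auto
  then obtain S :: "ell2 \<Rightarrow>\<^sub>L ell2" where S: "\<And>v. ent (S v) = (\<lambda>n. ent v (n - 1))" by auto
  have "\<exists>T :: ell2 \<Rightarrow>\<^sub>L ell2. \<forall>v. ent (T v) = (\<lambda>n. if n = 0 then 0 else ent v (n + 1))"
  proof (rule bounded_op_exists[of _ 1])
    fix v :: ell2 and F :: "nat set"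
    assume F: "finite F" "F \<subseteq> {1..}"
    have "(\<Sum>n\<in>F. (cmod (if n = 0 then 0 else ent v (n + 1)))\<^sup>2) = (\<Sum>n\<in>F. (cmod (ent v (n + 1)))\<^sup>2)"
      using F(2) by (intro sum.cong) auto
    also have "\<dots> = (\<Sum>n\<in>(\<lambda>n. n + 1) ` F. (cmod (ent v n))\<^sup>2)"
      by (simp add: sum.reindex)
    also have "\<dots> \<le> (norm v)\<^sup>2" using F by (intro finite_sum_le_norm) auto
    finally show "(\<Sum>n\<in>F. (cmod (if n = 0 then 0 else ent v (n + 1)))\<^sup>2) \<le> (norm v * 1)\<^sup>2" by simp
  qed auto
  then obtain R :: "ell2 \<Rightarrow>\<^sub>L ell2" where R: "\<And>v. ent (R v) = (\<lambda>n. if n = 0 then 0 else ent v (n + 1))"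
    by auto
  obtain A :: "ell2 \<Rightarrow>\<^sub>L ell2" where A: "\<And>v. ent (A v) = (\<lambda>n. of_real (a n) * ent v n)"
    using mult[of a] a by blast
  obtain B :: "ell2 \<Rightarrow>\<^sub>L ell2" where B: "\<And>v. ent (B v) = (\<lambda>n. of_real (b n) * ent v n)"
    using mult[of b] b by blast
  have "jacobi_op a b ((S o\<^sub>L A) + B + (A o\<^sub>L R))"
    by (auto simp: jacobi_op_def blinfun.add_left A B S R numeral_2_eq_2)
  thus ?thesis by blast
qed

text \<open>Periodic coefficients are bounded, so every choice of them is realised by an operator.\<close>

lemma periodic_jacobi_op_exists:
  assumes q: "q \<ge> 1" and per: "periodic_coeffs q a b"
  shows "\<exists>J. jacobi_op a b J"
proof -
  define K where "K = (\<Sum>n\<in>{1..q}. \<bar>a n\<bar> + \<bar>b n\<bar>)"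
  have "\<bar>a n\<bar> + \<bar>b n\<bar> \<le> K" if "n \<ge> 1" for n
    using that
  proof (induction n rule: less_induct)
    case (less n)
    show ?case
    proof (cases "n \<le> q")
      case True
      thus ?thesis
        unfolding K_def using less.prems by (intro member_le_sum[of n _ "\<lambda>n. \<bar>a n\<bar> + \<bar>b n\<bar>"]) auto
    next
      case False
      have "\<bar>a (n - q)\<bar> + \<bar>b (n - q)\<bar> \<le> K" using False q by (intro less.IH) auto
      moreover have "a (n - q + q) = a (n - q)" "b (n - q + q) = b (n - q)"
        using per False unfolding periodic_coeffs_def by (metis One_nat_def Suc_leI not_le zero_less_diff)+
      ultimately show ?thesis using False by simp
    qed
  qed
  thus ?thesis by (intro jacobi_op_exists[of a K b]) fastforce+
qed

text \<open>
  Since J is self-adjoint, the spectral subspace of its continuous part is the orthogonal complement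
  of the closed complex span of its eigenvectors.
\<close>

definition eigenvectors :: "(ell2 \<Rightarrow>\<^sub>L ell2) \<Rightarrow> ell2 set" where
  "eigenvectors J = {v. v \<noteq> 0 \<and> (\<exists>z::complex. J v = z *\<^sub>C v)}"

definition P_c :: "(ell2 \<Rightarrow>\<^sub>L ell2) \<Rightarrow> ell2 \<Rightarrow> ell2" where
  "P_c J = orth_proj (orth_compl (closure (ell2.span (eigenvectors J))))"

lemma P_c_orth_proj:
  fixes J :: "ell2 \<Rightarrow>\<^sub>L ell2"
  defines "M \<equiv> orth_compl (closure (ell2.span (eigenvectors J)))"
  shows "P_c J u \<in> M" "u - P_c J u \<in> orth_compl M"
  unfolding P_c_def M_def by (intro orth_proj subspace_orth_compl closed_orth_compl)+

text \<open>The unitary group at time t, as the norm-convergent exponential series of the bounded operator -itJ.\<close>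

definition propagator :: "(ell2 \<Rightarrow>\<^sub>L ell2) \<Rightarrow> real \<Rightarrow> ell2 \<Rightarrow>\<^sub>L ell2" where
  "propagator J t = op_exp (scaleC_op (- \<i> * of_real t) o\<^sub>L J)"

section \<open>Weighted sequence spaces\<close>

text \<open>
  The norms are real-valued and only meaningful on the corresponding spaces. Membership in a space
  says that the sum, respectively the supremum, is finite.
\<close>

definition ellp_norm :: "real \<Rightarrow> real \<Rightarrow> (nat \<Rightarrow> complex) \<Rightarrow> real" where
  "ellp_norm p \<sigma> u = (\<Sum>\<^sub>\<infinity>n\<in>{1..}. cmod (of_real (real n powr \<sigma>) * u n) powr p) powr (1 / p)"

definition ellp_space :: "real \<Rightarrow> real \<Rightarrow> (nat \<Rightarrow> complex) set" where
  "ellp_space p \<sigma> =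
     {u. u 0 = 0 \<and> (\<lambda>n. cmod (of_real (real n powr \<sigma>) * u n) powr p) summable_on {1..}}"

definition ellinf_norm :: "real \<Rightarrow> (nat \<Rightarrow> complex) \<Rightarrow> real" where
  "ellinf_norm \<sigma> u = (SUP n\<in>{1..}. cmod (of_real (real n powr \<sigma>) * u n))"

definition ellinf_space :: "real \<Rightarrow> (nat \<Rightarrow> complex) set" where
  "ellinf_space \<sigma> =
     {u. u 0 = 0 \<and> bdd_above ((\<lambda>n. cmod (of_real (real n powr \<sigma>) * u n)) ` {1..})}"

text \<open>Hence \<^const>\<open>Ell2\<close> is only ever applied to square-summable sequences below.\<close>

lemma ell1_1_subset_ell2:
  assumes "u \<in> ellp_space 1 1"
  shows "ent (Ell2 u) = u"
proof -
  have S: "(\<lambda>n. cmod (of_real (real n) * u n)) summable_on {1..}" and u0: "u 0 = 0"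
    using assms by (auto simp: ellp_space_def)
  have A: "(\<lambda>n. cmod (u n)) summable_on {1..}"
  proof (rule Infinite_Sum.abs_summable_on_comparison_test[of "\<lambda>n. of_real (real n) * u n"])
    show "(\<lambda>n. cmod (of_real (real n) * u n)) summable_on {1..}" using S .
    fix n :: nat assume "n \<in> {1..}"
    thus "cmod (u n) \<le> cmod (of_real (real n) * u n)"
      using mult_right_mono[of 1 "real n" "cmod (u n)"] by (simp add: norm_mult)
  qed
  define B where "B = infsum (\<lambda>n. cmod (u n)) {1..}"
  show ?thesis
  proof (rule Ell2_bounded(1)[of _ B])
    show "B \<ge> 0" unfolding B_def by (rule infsum_nonneg) auto
    fix F :: "nat set" assume F: "finite F" "F \<subseteq> {1..}"
    have s: "(\<Sum>n\<in>F. cmod (u n)) \<le> B"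
      unfolding B_def by (rule finite_sum_le_infsum) (use A F in auto)
    have "(\<Sum>n\<in>F. (cmod (u n))\<^sup>2) \<le> (\<Sum>n\<in>F. cmod (u n))\<^sup>2"
      unfolding power2_eq_square sum_distrib_left[of _ _ F]
      by (intro sum_mono mult_right_mono member_le_sum) (use F in auto)
    also have "\<dots> \<le> B\<^sup>2" using s by (intro power_mono sum_nonneg) auto
    finally show "(\<Sum>n\<in>F. (cmod (u n))\<^sup>2) \<le> B\<^sup>2" .
  qed (use u0 in auto)
qed

end

theory Submission
  imports Defs "HOL-Computational_Algebra.Fundamental_Theorem_Algebra"
begin

text \<open>
  Let \<open>p\<^sub>n\<close> be the solution of the three-term recurrence with \<open>p\<^sub>0 = 0\<close>, \<open>p\<^sub>1 = 1\<close>, and let \<open>\<Delta>\<close> be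
  the discriminant (the trace of the monodromy matrix). On the set where \<open>\<Delta> = 2 cos \<theta>\<close> with
  \<open>0 < \<theta> < \<pi>\<close>, the vector \<open>(sin \<theta> p\<^sub>n, B\<^sub>n)\<close>, where \<open>B\<^sub>n = p\<^sub>n\<^sub>+\<^sub>q - cos \<theta> p\<^sub>n\<close>, is rotated by the
  angle \<open>\<theta>\<close> when \<open>n\<close> grows by \<open>q\<close>, and \<open>a\<^sub>q p\<^sub>q \<Delta>'\<close> is the sum of its squared lengths over one
  period. Hence, with respect to \<open>d\<theta>\<close>, the spectral density \<open>sin\<^sup>2 \<theta> p\<^sub>n p\<^sub>m / (a\<^sub>q p\<^sub>q \<Delta>')\<close> is bounded
  uniformly in \<open>n\<close>, \<open>m\<close> and up to the band edges, whether or not a gap is closed or an edge is resonant.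

  The spectral representation is obtained without a spectral theorem. Lagrange interpolation at the
  \<open>q\<close> real roots of \<open>\<Delta> - 2 cos \<theta>\<close> shows that the density represents \<open>f(J)\<close> for all polynomials \<open>f\<close>
  divisible by \<open>p\<^sub>q\<close>. Therefore the absolutely continuous part of \<open>\<delta>\<^sub>m\<close> differs from \<open>\<delta>\<^sub>m\<close> by a vector
  annihilated by \<open>p\<^sub>q(J)\<close>, that is, by a combination of eigenvectors, and it is orthogonal to every
  eigenvector \<open>v\<close> with eigenvalue \<open>z\<close> because \<open>(1 - c (J - z)\<^sup>2)\<^sup>k\<close> fixes \<open>v\<close> and maps it weakly to 0
  as \<open>k \<rightarrow> \<infinity>\<close>.

  For the decay, write the kernel of the propagator on each band as an integral over \<open>\<theta>\<close> and cut out
  the \<open>\<epsilon>\<close>-neighbourhoods of the band edges with \<open>\<epsilon> = t\<^sup>-\<^sup>1\<^sup>/\<^sup>2\<close>. In the middle one integrates by parts;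
  the amplitude divided by the group velocity is \<open>O(1/\<epsilon>)\<close> and has a bounded number of monotonicity
  intervals, and the derivative of the remaining trigonometric factor costs \<open>O(n + m) = O(n m)\<close>.
\<close>

section \<open>Real-rooted polynomials and Lagrange interpolation\<close>

lemma poly_map_poly_of_real:
  "poly (map_poly of_real f) (of_real x :: 'a::real_field) = of_real (poly f x)"
  by (induction f) (auto simp: map_poly_pCons)

text \<open>Induction on the degree: the fundamental theorem of algebra gives a complex root,
  realness makes it a real linear factor, and simplicity keeps it from being a root of the quotient
  again. This counts the roots of \<open>P q\<close> and of \<open>Disc\<close>.\<close>

lemma real_rooted_card_roots:
  fixes f :: "real poly"
  assumes "f \<noteq> 0"
    and "\<And>z::complex. poly (map_poly of_real f) z = 0 \<Longrightarrow> z \<in> \<real>"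
    and "\<And>x. poly f x = 0 \<Longrightarrow> poly (pderiv f) x \<noteq> 0"
  shows "card {x. poly f x = 0} = degree f"
  using assms
proof (induction "degree f" arbitrary: f)
  case 0
  then obtain c where "f = [:c:]" "c \<noteq> 0" by (metis degree_eq_zeroE pCons_eq_0_iff)
  thus ?case by simp
next
  case (Suc n)
  have mult: "map_poly complex_of_real (g * h) = map_poly of_real g * map_poly of_real h" for g h
    by (rule poly_eqI) (simp add: coeff_map_poly coeff_mult)
  have "degree (map_poly complex_of_real f) = Suc n"
    using Suc.hyps(2) by (subst degree_map_poly) auto
  then obtain z where z: "poly (map_poly complex_of_real f) z = 0"
    using alg_closed_imp_poly_has_root[of "map_poly complex_of_real f"] by auto
  with Suc.prems(2) obtain x where x: "z = of_real x" by (auto elim: Reals_cases)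
  have "poly f x = 0" using z unfolding x by (simp add: poly_map_poly_of_real)
  then obtain g where g: "f = [:-x, 1:] * g" by (auto simp: poly_eq_0_iff_dvd elim: dvdE)
  have g0: "g \<noteq> 0" using Suc.prems(1) g by auto
  have dg: "degree f = Suc (degree g)" unfolding g using g0 by (subst degree_mult_eq) auto
  have pd: "pderiv f = g + [:-x, 1:] * pderiv g"
    unfolding g pderiv_mult by (simp add: pderiv_pCons)
  have "card {y. poly g y = 0} = degree g"
  proof (rule Suc.hyps(1))
    show "n = degree g" using dg Suc.hyps(2) by simp
    show "w \<in> \<real>" if "poly (map_poly complex_of_real g) w = 0" for w
      by (rule Suc.prems(2)) (simp only: g mult poly_mult that mult_zero_right)
    show "poly (pderiv g) y \<noteq> 0" if "poly g y = 0" for y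
      using Suc.prems(3)[of y] that unfolding pd by (auto simp: g)
  qed (use g0 in auto)
  moreover have "poly g x \<noteq> 0" using Suc.prems(3)[of x] \<open>poly f x = 0\<close> unfolding pd by auto
  moreover have "{y. poly f y = 0} = insert x {y. poly g y = 0}" by (auto simp: g)
  moreover have "finite {y. poly g y = 0}" using g0 by (rule poly_roots_finite)
  ultimately show ?case using dg by simp
qed

text \<open>With equal leading coefficients, agreement at \<open>degree f\<close> points is already
  enough for equality.\<close>

lemma poly_eq_prod_roots:
  fixes f :: "real poly"
  assumes "finite R" "card R = degree f" "\<And>x. x \<in> R \<Longrightarrow> poly f x = 0"
  shows "f = smult (lead_coeff f) (\<Prod>x\<in>R. [:-x, 1:])"
proof (cases "f = 0")
  case False
  have d: "degree (\<Prod>x\<in>R. [:-x, 1:]) = card R"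
    by (subst degree_prod_eq_sum_degree) auto
  have m: "lead_coeff (\<Prod>x\<in>R. [:-x, 1:]) = 1"
    by (subst lead_coeff_prod) simp
  show ?thesis
  proof (rule poly_eqI_degree_lead_coeff[where A = R and n = "degree f"])
    show "coeff f (degree f) = coeff (smult (lead_coeff f) (\<Prod>x\<in>R. [:-x, 1:])) (degree f)"
      using d m assms(2) by simp
    show "degree (smult (lead_coeff f) (\<Prod>x\<in>R. [:-x, 1:])) \<le> degree f"
      using d assms(2) by simp
    show "poly f z = poly (smult (lead_coeff f) (\<Prod>x\<in>R. [:-x, 1:])) z" if "z \<in> R" for z
      using assms(1,3) that by (auto simp: poly_prod prod_zero_iff)
  qed (use assms in auto)
qed auto

text \<open>The cofactor of \<open>[:-x, 1:]\<close> in \<open>f\<close> vanishes at the other roots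
  and takes the value \<open>poly (pderiv f) x\<close> at \<open>x\<close>, since the product rule
  leaves only one summand there. Both sides have degree below \<open>card R\<close> and agree on
  \<open>R\<close>.\<close>

lemma lagrange_interpolation:
  fixes f g :: "real poly"
  assumes R: "finite R" "card R = degree f" "\<And>x. x \<in> R \<Longrightarrow> poly f x = 0"
    and g: "degree g < degree f"
  shows "g = (\<Sum>x\<in>R. smult (poly g x / poly (pderiv f) x)
                 (smult (lead_coeff f) (\<Prod>y\<in>R - {x}. [:-y, 1:])))"
proof -
  define q where "q x = smult (lead_coeff f) (\<Prod>y\<in>R - {x}. [:-y, 1:])" for x
  have f: "f = smult (lead_coeff f) (\<Prod>x\<in>R. [:-x, 1:])"
    using R by (rule poly_eq_prod_roots)
  have l0: "lead_coeff f \<noteq> 0" using g by auto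
  have "pderiv f = smult (lead_coeff f) (\<Sum>x\<in>R. (\<Prod>y\<in>R - {x}. [:-y, 1:]))"
    by (subst f) (simp add: pderiv_smult pderiv_prod pderiv_pCons)
  also have "\<dots> = (\<Sum>x\<in>R. q x)"
    by (rule poly_eqI) (simp add: q_def coeff_sum sum_distrib_left)
  finally have pd: "pderiv f = (\<Sum>x\<in>R. q x)" .
  have q0: "poly (q x) y = 0" if "y \<in> R" "x \<in> R" "x \<noteq> y" for x y
    using R(1) that by (auto simp: q_def poly_prod prod_zero_iff)
  have qx: "poly (q x) x \<noteq> 0" if "x \<in> R" for x
    using R(1) that l0 by (auto simp: q_def poly_prod prod_zero_iff)
  have pdx: "poly (pderiv f) x = poly (q x) x" if "x \<in> R" for x
  proof -
    have "poly (pderiv f) x = (\<Sum>y\<in>R. poly (q y) x)" by (simp add: pd poly_sum)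
    also have "\<dots> = (\<Sum>y\<in>R. if y = x then poly (q x) x else 0)"
      using q0 that by (intro sum.cong) auto
    finally show ?thesis using R(1) that by simp
  qed
  have dq: "degree (q x) < card R" if "x \<in> R" for x
  proof -
    have "degree (q x) \<le> degree (\<Prod>y\<in>R - {x}. [:-y, 1:])" by (simp add: q_def)
    also have "\<dots> = card (R - {x})" by (subst degree_prod_eq_sum_degree) auto
    also have "\<dots> < card R" using R(1) that by (intro psubset_card_mono) auto
    finally show ?thesis .
  qed
  have "g = (\<Sum>x\<in>R. smult (poly g x / poly (pderiv f) x) (q x))"
  proof (rule poly_eqI_degree[where A = R])
    show "degree g < card R" using g R by simp
    have "degree (\<Sum>x\<in>R. smult (poly g x / poly (pderiv f) x) (q x)) \<le> card R - 1"
      using dq by (intro degree_sum_le R order.trans[OF degree_smult_le]) fastforce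
    thus "degree (\<Sum>x\<in>R. smult (poly g x / poly (pderiv f) x) (q x)) < card R"
      using g R by simp
    fix y assume y: "y \<in> R"
    have "poly (\<Sum>x\<in>R. smult (poly g x / poly (pderiv f) x) (q x)) y =
          (\<Sum>x\<in>R. if x = y then poly g y else 0)"
      unfolding poly_sum using q0 y qx pdx by (intro sum.cong) auto
    thus "poly g y = poly (\<Sum>x\<in>R. smult (poly g x / poly (pderiv f) x) (q x)) y"
      using R(1) y by simp
  qed
  thus ?thesis by (simp only: q_def)
qed

text \<open>Compare the coefficients of degree \<open>degree f - 1\<close> in the interpolation
  formula. In \<open>sum_L\<close> this makes sums over all bands independent of the
  quasimomentum.\<close>

lemma lagrange_coeff:
  fixes f g :: "real poly"
  assumes R: "finite R" "card R = degree f" "\<And>x. x \<in> R \<Longrightarrow> poly f x = 0"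
    and g: "degree g < degree f"
  shows "(\<Sum>x\<in>R. poly g x / poly (pderiv f) x) = coeff g (degree f - 1) / lead_coeff f"
proof -
  have c: "coeff (\<Prod>y\<in>R - {x}. [:-y, 1:]) (degree f - 1) = 1" if "x \<in> R" for x
  proof -
    have "degree (\<Prod>y\<in>R - {x}. [:-y, 1:]) = degree f - 1"
      using R that by (subst degree_prod_eq_sum_degree) auto
    moreover have "lead_coeff (\<Prod>y\<in>R - {x}. [:-y, 1:]) = 1"
      by (subst lead_coeff_prod) simp
    ultimately show ?thesis by simp
  qed
  have "coeff g (degree f - 1) = (\<Sum>x\<in>R. poly g x / poly (pderiv f) x * lead_coeff f)"
    using arg_cong[OF lagrange_interpolation[OF R g], of "\<lambda>h. coeff h (degree f - 1)"]
    by (simp only: coeff_sum coeff_smult c mult_1_right cong: sum.cong)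
  also have "\<dots> = (\<Sum>x\<in>R. poly g x / poly (pderiv f) x) * lead_coeff f"
    by (simp add: sum_distrib_right)
  finally show ?thesis using g by auto
qed

section \<open>Floquet theory\<close>

lemma poly_real_eqI: "(\<And>x. poly f x = poly g x) \<Longrightarrow> f = g" for f g :: "real poly"
  by (simp add: poly_eq_poly_eq_iff[symmetric] fun_eq_iff)

lemma smult_left_cancel: "smult c f = smult c g \<Longrightarrow> c \<noteq> 0 \<Longrightarrow> f = g" for c :: real
  by (metis smult_eq_iff)

text \<open>Discrete Green identity: the increments telescope, and the source \<open>h\<close> in
  the equation for \<open>u\<close> accumulates. The ring is general because the identity serves
  real polynomials, real numbers and complex numbers.\<close>

lemma wronskian:
  fixes A c h u v :: "nat \<Rightarrow> 'a::comm_ring_1"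
  assumes u: "\<And>n. A (Suc n) * u (Suc (Suc n)) = c (Suc n) * u (Suc n) - A n * u n + h (Suc n)"
    and v: "\<And>n. A (Suc n) * v (Suc (Suc n)) = c (Suc n) * v (Suc n) - A n * v n"
  shows "A n * (u (Suc n) * v n - u n * v (Suc n)) =
         A 0 * (u (Suc 0) * v 0 - u 0 * v (Suc 0)) + (\<Sum>k=1..n. h k * v k)"
proof (induction n)
  case (Suc n)
  have "A (Suc n) * (u (Suc (Suc n)) * v (Suc n) - u (Suc n) * v (Suc (Suc n))) =
        (A (Suc n) * u (Suc (Suc n))) * v (Suc n) - u (Suc n) * (A (Suc n) * v (Suc (Suc n)))"
    by (simp add: algebra_simps)
  also have "\<dots> = A n * (u (Suc n) * v n - u n * v (Suc n)) + h (Suc n) * v (Suc n)"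
    unfolding u v by (simp add: algebra_simps)
  finally show ?case by (simp add: Suc.IH)
qed simp

fun jacobi_poly :: "(nat \<Rightarrow> real) \<Rightarrow> (nat \<Rightarrow> real) \<Rightarrow> real \<Rightarrow> real \<Rightarrow> nat \<Rightarrow> real poly" where
  "jacobi_poly a b c d 0 = [:c:]"
| "jacobi_poly a b c d (Suc 0) = [:d:]"
| "jacobi_poly a b c d (Suc (Suc n)) = smult (1 / a (Suc n))
     ([:- b (Suc n), 1:] * jacobi_poly a b c d (Suc n) - smult (a n) (jacobi_poly a b c d n))"

lemma degree_recurrence_le:
  fixes u :: "nat \<Rightarrow> real poly"
  assumes "\<And>n. u (Suc (Suc n)) = smult (s n) ([:- t n, 1:] * u (Suc n) - smult (r n) (u n))"
    and "degree (u 0) = 0" "degree (u (Suc 0)) = 0"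
  shows "degree (u (Suc n)) \<le> n"
proof -
  have "degree (u (Suc n)) \<le> n \<and> degree (u n) \<le> n"
  proof (induction n)
    case (Suc n)
    have "degree ([:- t n, 1:] * u (Suc n)) \<le> degree [:- t n, 1:] + degree (u (Suc n))"
      by (rule degree_mult_le)
    also have "\<dots> \<le> Suc n" using Suc by simp
    finally have "degree ([:- t n, 1:] * u (Suc n) - smult (r n) (u n)) \<le> Suc n"
      using Suc by (intro degree_diff_le order.trans[OF degree_smult_le]) auto
    hence "degree (u (Suc (Suc n))) \<le> Suc n"
      unfolding assms(1) by (rule order.trans[OF degree_smult_le])
    thus ?case using Suc by simp
  qed (use assms in simp)
  thus ?thesis ..
qed

text \<open>
  Only the values \<^term>\<open>a n\<close> and \<^term>\<open>b n\<close> with positive \<^term>\<open>n\<close> enter the operator; the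
  value at 0 is chosen such that periodicity holds from 0 on.
\<close>

locale jacobi_coeffs =
  fixes a b :: "nat \<Rightarrow> real" and q :: nat
  assumes a_pos: "a n > 0" and a_per: "a (n + q) = a n" and b_per: "b (n + q) = b n"
    and q_pos: "q \<ge> 1"
begin

text \<open>Fundamental solutions with data (0, 1) and (1, 0) at the indices 0 and 1. Their values
  at \<open>q\<close> and \<open>Suc q\<close> are the entries of the monodromy matrix;
  \<open>Disc\<close> is its trace and \<open>Hq\<close> half the difference of its diagonal
  entries.\<close>

definition P :: "nat \<Rightarrow> real poly" where "P = jacobi_poly a b 0 1"
definition S :: "nat \<Rightarrow> real poly" where "S = jacobi_poly a b 1 0"
definition Disc :: "real poly" where "Disc = P (Suc q) + S q"
definition Hq :: "real poly" where "Hq = smult (1/2) (P (Suc q) - S q)"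
definition B :: "nat \<Rightarrow> real poly" where "B n = P q * S n + Hq * P n"

lemma a_nonzero [simp]: "a n \<noteq> 0" using a_pos[of n] by simp
lemma a_q: "a q = a 0" using a_per[of 0] by simp

lemma P_0 [simp]: "P 0 = 0" and P_1 [simp]: "P (Suc 0) = 1"
  and S_0 [simp]: "S 0 = 1" and S_1 [simp]: "S (Suc 0) = 0"
  by (simp_all add: P_def S_def)

definition solution :: "(nat \<Rightarrow> real poly) \<Rightarrow> bool" where
  "solution u \<longleftrightarrow> (\<forall>n. smult (a (Suc n)) (u (Suc (Suc n))) =
     [:- b (Suc n), 1:] * u (Suc n) - smult (a n) (u n))"

lemma solution_P: "solution P" and solution_S: "solution S"
  by (simp_all add: solution_def P_def S_def)

lemma solution_add: "solution u \<Longrightarrow> solution v \<Longrightarrow> solution (\<lambda>n. u n + v n)"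
  unfolding solution_def smult_add_right distrib_left
  by (simp add: add_diff_add del: mult_pCons_left)

lemma solution_mult: "solution u \<Longrightarrow> solution (\<lambda>n. c * u n)"
proof -
  assume u: "solution u"
  have "smult (a (Suc n)) (c * u (Suc (Suc n))) = c * smult (a (Suc n)) (u (Suc (Suc n)))" for n
    by simp
  also have "\<dots> n = c * ([:- b (Suc n), 1:] * u (Suc n) - smult (a n) (u n))" for n
    using u unfolding solution_def by metis
  finally show ?thesis unfolding solution_def by (simp add: algebra_simps)
qed

lemma solution_shift: "solution u \<Longrightarrow> solution (\<lambda>n. u (n + q))"
  unfolding solution_def
proof
  fix n assume u: "\<forall>n. smult (a (Suc n)) (u (Suc (Suc n))) =
     [:- b (Suc n), 1:] * u (Suc n) - smult (a n) (u n)"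
  show "smult (a (Suc n)) (u (Suc (Suc n) + q)) =
         [:- b (Suc n), 1:] * u (Suc n + q) - smult (a n) (u (n + q))"
    using u[rule_format, of "n + q"] a_per[of "Suc n"] a_per[of n] b_per[of "Suc n"] by simp
qed

lemma solution_unique:
  assumes "solution u" "solution v" "u 0 = v 0" "u (Suc 0) = v (Suc 0)"
  shows "u n = v n"
proof -
  have "u n = v n \<and> u (Suc n) = v (Suc n)"
  proof (induction n)
    case (Suc n)
    have "smult (a (Suc n)) (u (Suc (Suc n))) = smult (a (Suc n)) (v (Suc (Suc n)))"
      using assms(1,2) Suc unfolding solution_def by metis
    hence "u (Suc (Suc n)) = v (Suc (Suc n))" by (rule smult_left_cancel) simp
    thus ?case using Suc by simp
  qed (use assms in simp)
  thus ?thesis ..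
qed

lemma solution_decompose: "solution u \<Longrightarrow> u n = u 0 * S n + u (Suc 0) * P n"
  by (rule solution_unique[of u]) (auto intro!: solution_add solution_mult solution_P solution_S)

lemma P_shift': "P (n + q) = P q * S n + P (Suc q) * P n"
  using solution_decompose[OF solution_shift[OF solution_P], of n] by simp

lemma S_shift': "S (n + q) = S q * S n + S (Suc q) * P n"
  using solution_decompose[OF solution_shift[OF solution_S], of n] by simp

lemma solution_wronskian:
  assumes "solution u" "solution v"
  shows "smult (a n) (u (Suc n) * v n - u n * v (Suc n)) =
         smult (a 0) (u (Suc 0) * v 0 - u 0 * v (Suc 0))"
  using wronskian[where A = "\<lambda>n. [:a n:]" and c = "\<lambda>n. [:- b n, 1:]" and h = "\<lambda>_. 0" and u = u and v = v and n = n]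
    assms by (simp add: solution_def)

text \<open>The Wronskian times \<open>a n\<close> is constant in \<open>n\<close>, and the factors
  cancel because \<open>a q = a 0\<close>.\<close>

lemma det_monodromy: "P (Suc q) * S q - P q * S (Suc q) = 1"
  using smult_left_cancel[OF solution_wronskian[OF solution_P solution_S, of q, unfolded a_q]] by simp

lemma P_shift: "P (n + q) = smult (1/2) Disc * P n + B n"
  unfolding P_shift' B_def by (rule poly_real_eqI) (simp add: Disc_def Hq_def field_simps)

text \<open>Cayley-Hamilton for the monodromy matrix: together with \<open>P_shift\<close>, a shift
  by one period acts on the pair \<open>(P n, B n)\<close> by a matrix of determinant 1 that depends
  on \<open>Disc\<close> alone.\<close>

lemma B_shift: "B (n + q) = smult (1/2) Disc * B n - (1 - smult (1/4) (Disc * Disc)) * P n"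
proof (rule poly_real_eqI)
  fix x
  define p s p1 s1 where "p = poly (P q) x" and "s = poly (S q) x"
    and "p1 = poly (P (Suc q)) x" and "s1 = poly (S (Suc q)) x"
  have det: "p * s1 = p1 * s - 1"
    using arg_cong[OF det_monodromy, of "\<lambda>f. poly f x"] by (simp add: p_def s_def p1_def s1_def)
  have "poly (B (n + q)) x = p * (s * poly (S n) x + s1 * poly (P n) x)
          + (p1 - s) / 2 * (p * poly (S n) x + p1 * poly (P n) x)"
    by (simp add: B_def P_shift' S_shift' Hq_def p_def s_def p1_def s1_def)
  also have "\<dots> = p * s * poly (S n) x + (p * s1) * poly (P n) x
          + (p1 - s) / 2 * (p * poly (S n) x + p1 * poly (P n) x)"
    by (simp add: algebra_simps)
  also have "\<dots> = (p1 + s) / 2 * (p * poly (S n) x + (p1 - s) / 2 * poly (P n) x)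
          - (1 - (p1 + s) * (p1 + s) / 4) * poly (P n) x"
    unfolding det by (simp add: field_simps)
  also have "\<dots> = poly (smult (1/2) Disc * B n - (1 - smult (1/4) (Disc * Disc)) * P n) x"
    by (simp add: B_def Hq_def Disc_def p_def s_def p1_def s1_def)
  finally show "poly (B (n + q)) x = poly (smult (1/2) Disc * B n - (1 - smult (1/4) (Disc * Disc)) * P n) x" .
qed

text \<open>Differentiating the recurrence in the energy adds the source \<open>u\<close>, so the
  Green identity applies with \<open>h = u\<close>. The boundary term at 0 vanishes because the
  initial values do not depend on the energy.\<close>

lemma deriv_wronskian:
  assumes "solution u" "solution v" "pderiv (u 0) = 0" "pderiv (u (Suc 0)) = 0"
  shows "a 0 * (poly (pderiv (u (Suc q))) x * poly (v q) x - poly (pderiv (u q)) x * poly (v (Suc q)) x)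
         = (\<Sum>k=1..q. poly (u k) x * poly (v k) x)"
proof -
  have u: "a (Suc n) * poly (pderiv (u (Suc (Suc n)))) x =
     (x - b (Suc n)) * poly (pderiv (u (Suc n))) x - a n * poly (pderiv (u n)) x + poly (u (Suc n)) x" for n
  proof -
    have "poly (pderiv (smult (a (Suc n)) (u (Suc (Suc n))))) x =
          poly (pderiv ([:- b (Suc n), 1:] * u (Suc n) - smult (a n) (u n))) x"
      using assms(1) by (simp only: solution_def)
    thus ?thesis
      unfolding pderiv_smult pderiv_diff pderiv_mult by (simp add: pderiv_pCons algebra_simps)
  qed
  have v: "a (Suc n) * poly (v (Suc (Suc n))) x =
     (x - b (Suc n)) * poly (v (Suc n)) x - a n * poly (v n) x" for n
  proof -
    have "poly (smult (a (Suc n)) (v (Suc (Suc n)))) x =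
          poly ([:- b (Suc n), 1:] * v (Suc n) - smult (a n) (v n)) x"
      using assms(2) by (simp only: solution_def)
    thus ?thesis by (simp add: algebra_simps)
  qed
  show ?thesis
    using wronskian[where A = a and c = "\<lambda>n. x - b n" and h = "\<lambda>n. poly (u n) x"
        and u = "\<lambda>n. poly (pderiv (u n)) x" and v = "\<lambda>n. poly (v n) x" and n = q, OF u v] assms(3,4)
    by (simp add: a_q)
qed

text \<open>
  The four derivative Wronskians of P and S determine the derivative of the discriminant; multiplied
  by \<^term>\<open>P q\<close> the resulting quadratic form becomes a sum of squares, since its
  discriminant is that of the monodromy matrix.
\<close>

lemma P_q_deriv_Disc:
  "a 0 * (poly (P q) x * poly (pderiv Disc) x) =
   (\<Sum>k=1..q. (poly (B k) x)\<^sup>2 + (1 - (poly Disc x / 2)\<^sup>2) * (poly (P k) x)\<^sup>2)"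
proof -
  define p s p1 s1 dp ds dp1 ds1 where "p = poly (P q) x" and "s = poly (S q) x"
    and "p1 = poly (P (Suc q)) x" and "s1 = poly (S (Suc q)) x"
    and "dp = poly (pderiv (P q)) x" and "ds = poly (pderiv (S q)) x"
    and "dp1 = poly (pderiv (P (Suc q))) x" and "ds1 = poly (pderiv (S (Suc q))) x"
  note defs = p_def s_def p1_def s1_def dp_def ds_def dp1_def ds1_def
  define pp ps ss where "pp = (\<Sum>k=1..q. poly (P k) x * poly (P k) x)"
    and "ps = (\<Sum>k=1..q. poly (P k) x * poly (S k) x)"
    and "ss = (\<Sum>k=1..q. poly (S k) x * poly (S k) x)"
  have d0: "pderiv (P 0) = 0" "pderiv (P (Suc 0)) = 0" "pderiv (S 0) = 0" "pderiv (S (Suc 0)) = 0"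
    by (simp_all add: pderiv_1)
  have 1: "a 0 * (dp1 * p - dp * p1) = pp"
    unfolding defs pp_def by (rule deriv_wronskian) (auto intro: solution_P d0)
  have 2: "a 0 * (dp1 * s - dp * s1) = ps"
    unfolding defs ps_def by (rule deriv_wronskian) (auto intro: solution_P solution_S d0)
  have 3: "a 0 * (ds1 * p - ds * p1) = ps"
    unfolding defs ps_def using deriv_wronskian[OF solution_S solution_P d0(3,4), of x]
    by (simp add: mult.commute)
  have 4: "a 0 * (ds1 * s - ds * s1) = ss"
    unfolding defs ss_def by (rule deriv_wronskian) (auto intro: solution_S d0)
  have det: "p1 * s - p * s1 = 1"
    using arg_cong[OF det_monodromy, of "\<lambda>f. poly f x"] by (simp add: defs)
  \<comment> \<open>The four Wronskians are weighted by \<open>- s1\<close>, \<open>p1\<close>,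
    \<open>- s\<close> and \<open>p\<close> so that the determinant of the monodromy matrix factors
    out.\<close>
  have "a 0 * (dp1 + ds) = - s1 * pp + (p1 - s) * ps + p * ss"
  proof -
    have "- s1 * pp + (p1 - s) * ps + p * ss =
        - s1 * (a 0 * (dp1 * p - dp * p1)) + p1 * (a 0 * (dp1 * s - dp * s1))
        - s * (a 0 * (ds1 * p - ds * p1)) + p * (a 0 * (ds1 * s - ds * s1))"
      unfolding 1 2 3 4 by (simp add: algebra_simps)
    also have "\<dots> = a 0 * (p1 * s - p * s1) * (dp1 + ds)" by (simp add: algebra_simps)
    finally have "- s1 * pp + (p1 - s) * ps + p * ss = a 0 * (p1 * s - p * s1) * (dp1 + ds)" .
    thus ?thesis by (simp add: det)
  qed
  hence "p * (a 0 * (dp1 + ds)) = p * (- s1 * pp + (p1 - s) * ps + p * ss)"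
    by (rule arg_cong)
  hence "a 0 * (p * (dp1 + ds)) = p * p * ss + (p1 - s) * p * ps - p * s1 * pp"
    by (simp add: algebra_simps)
  \<comment> \<open>By the determinant relation \<open>p * s1\<close> splits into half the trace and
    half the difference of the diagonal entries; the latter completes the squares of the values
    \<open>B k\<close>.\<close>
  also have "p * s1 = ((p1 + s) / 2)\<^sup>2 - ((p1 - s) / 2)\<^sup>2 - 1"
    using det by (simp add: power2_eq_square field_simps)
  also have "p * p * ss + (p1 - s) * p * ps - (((p1 + s) / 2)\<^sup>2 - ((p1 - s) / 2)\<^sup>2 - 1) * pp =
      (\<Sum>k=1..q. (p * poly (S k) x + (p1 - s) / 2 * poly (P k) x)\<^sup>2
         + (1 - ((p1 + s) / 2)\<^sup>2) * (poly (P k) x)\<^sup>2)"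
    unfolding pp_def ps_def ss_def sum_distrib_left sum_subtractf[symmetric] sum.distrib[symmetric]
    by (intro sum.cong) (auto simp: power2_eq_square field_simps)
  finally show ?thesis
    by (simp add: defs Disc_def B_def Hq_def pderiv_add)
qed

text \<open>All summands are nonnegative on the bands, edges included. This bound keeps the spectral
  density finite up to the edges.\<close>

lemma P_q_deriv_Disc_ge:
  assumes "\<bar>poly Disc x\<bar> \<le> 2" "r \<in> {1..q}"
  shows "(poly (B r) x)\<^sup>2 + (1 - (poly Disc x / 2)\<^sup>2) * (poly (P r) x)\<^sup>2
           \<le> a 0 * (poly (P q) x * poly (pderiv Disc) x)"
proof -
  have "(poly Disc x / 2)\<^sup>2 \<le> 1" using assms(1) by (simp add: abs_square_le_1)
  thus ?thesis
    unfolding P_q_deriv_Disc using assms(2)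
    by (intro member_le_sum[of r _ "\<lambda>r. (poly (B r) x)\<^sup>2 + (1 - (poly Disc x / 2)\<^sup>2) * (poly (P r) x)\<^sup>2"]) auto
qed

text \<open>The summand with \<open>k = 1\<close> is positive because \<open>P 1 = 1\<close>. Hence
  neither \<open>P q\<close> nor the derivative of \<open>Disc\<close> vanishes inside a
  band.\<close>

lemma P_q_deriv_Disc_pos:
  assumes "\<bar>poly Disc x\<bar> < 2"
  shows "poly (P q) x * poly (pderiv Disc) x > 0"
proof -
  have "(poly Disc x / 2)\<^sup>2 < 1" using assms by (simp add: abs_square_less_1)
  hence "0 < (poly (B 1) x)\<^sup>2 + (1 - (poly Disc x / 2)\<^sup>2) * (poly (P 1) x)\<^sup>2"
    by (intro add_nonneg_pos) auto
  also have "\<dots> \<le> a 0 * (poly (P q) x * poly (pderiv Disc) x)"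
    using assms q_pos by (intro P_q_deriv_Disc_ge) auto
  finally show ?thesis using a_pos[of 0] by (simp add: zero_less_mult_iff)
qed

text \<open>Scaling \<open>P\<close> by \<open>sin \<theta>\<close> turns the matrix of
  \<open>P_shift\<close> and \<open>B_shift\<close> into a rotation.\<close>

lemma floquet_rotation:
  assumes "poly Disc x = 2 * cos \<theta>"
  shows "sin \<theta> * poly (P (r + j * q)) x =
           sin \<theta> * poly (P r) x * cos (real j * \<theta>) + poly (B r) x * sin (real j * \<theta>)"
    and "poly (B (r + j * q)) x =
           poly (B r) x * cos (real j * \<theta>) - sin \<theta> * poly (P r) x * sin (real j * \<theta>)"
proof -
  have "sin \<theta> * poly (P (r + j * q)) x =
           sin \<theta> * poly (P r) x * cos (real j * \<theta>) + poly (B r) x * sin (real j * \<theta>) \<and>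
        poly (B (r + j * q)) x =
           poly (B r) x * cos (real j * \<theta>) - sin \<theta> * poly (P r) x * sin (real j * \<theta>)"
  proof (induction j)
    case (Suc j)
    have P: "poly (P (r + Suc j * q)) x = cos \<theta> * poly (P (r + j * q)) x + poly (B (r + j * q)) x"
      using arg_cong[OF P_shift[of "r + j * q"], of "\<lambda>f. poly f x"] assms by (simp add: algebra_simps)
    have "poly (B (r + Suc j * q)) x =
          cos \<theta> * poly (B (r + j * q)) x - (1 - (cos \<theta>)\<^sup>2) * poly (P (r + j * q)) x"
      using arg_cong[OF B_shift[of "r + j * q"], of "\<lambda>f. poly f x"] assms
      by (simp add: algebra_simps power2_eq_square)
    hence B: "poly (B (r + Suc j * q)) x =
          cos \<theta> * poly (B (r + j * q)) x - sin \<theta> * (sin \<theta> * poly (P (r + j * q)) x)"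
      unfolding sin_squared_eq[symmetric] by (simp add: power2_eq_square)
    have cs: "cos (real (Suc j) * \<theta>) = cos (real j * \<theta>) * cos \<theta> - sin (real j * \<theta>) * sin \<theta>"
      "sin (real (Suc j) * \<theta>) = sin (real j * \<theta>) * cos \<theta> + cos (real j * \<theta>) * sin \<theta>"
      by (simp_all add: algebra_simps cos_add sin_add)
    have P': "sin \<theta> * poly (P (r + Suc j * q)) x =
        cos \<theta> * (sin \<theta> * poly (P (r + j * q)) x) + sin \<theta> * poly (B (r + j * q)) x"
      unfolding P by (simp add: algebra_simps)
    show ?case
      unfolding P' B cs Suc[THEN conjunct1] Suc[THEN conjunct2] by (simp add: algebra_simps)
  qed simp
  thus "sin \<theta> * poly (P (r + j * q)) x =
           sin \<theta> * poly (P r) x * cos (real j * \<theta>) + poly (B r) x * sin (real j * \<theta>)"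
    and "poly (B (r + j * q)) x =
           poly (B r) x * cos (real j * \<theta>) - sin \<theta> * poly (P r) x * sin (real j * \<theta>)"
    by auto
qed

section \<open>Degrees and leading coefficients\<close>

lemma degree_P: "degree (P (Suc n)) \<le> n" and degree_S: "degree (S (Suc n)) \<le> n"
  unfolding P_def S_def by (rule degree_recurrence_le; simp)+

lemma coeff_P: "coeff (P (Suc n)) n = (\<Prod>i=1..n. 1 / a i)"
proof (induction n)
  case (Suc n)
  have "P (Suc (Suc n)) = smult (1 / a (Suc n)) ([:- b (Suc n), 1:] * P (Suc n) - smult (a n) (P n))"
    by (simp add: P_def)
  moreover have "coeff (P (Suc n)) (Suc n) = 0"
    using degree_P[of n] by (intro coeff_eq_0) simp
  moreover have "coeff (P n) (Suc n) = 0"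
    using degree_P[of "n - 1"] by (cases n) (auto intro!: coeff_eq_0)
  ultimately show ?case using Suc by simp
qed simp

lemma degree_P_eq: "degree (P (Suc n)) = n"
proof (rule antisym[OF degree_P])
  have "coeff (P (Suc n)) n \<noteq> 0" unfolding coeff_P by simp
  thus "n \<le> degree (P (Suc n))" by (rule le_degree)
qed

lemma Disc_coeff: "coeff Disc q = (\<Prod>i=1..q. 1 / a i)"
  and degree_Disc: "degree Disc = q"
proof -
  obtain m where m: "q = Suc m" using q_pos by (cases q) auto
  have "degree (S q) < q" using degree_S[of m] by (simp add: m)
  hence "coeff (S q) q = 0" by (rule coeff_eq_0)
  thus c: "coeff Disc q = (\<Prod>i=1..q. 1 / a i)" by (simp add: Disc_def coeff_P)
  hence "coeff Disc q \<noteq> 0" by simp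
  hence "q \<le> degree Disc" by (rule le_degree)
  moreover have "degree Disc \<le> q"
    unfolding Disc_def using degree_P[of q] \<open>degree (S q) < q\<close> by (intro degree_add_le) auto
  ultimately show "degree Disc = q" by simp
qed

lemma P_q_coeff: "coeff (P q) (q - 1) = a 0 * coeff Disc q"
proof -
  obtain m where m: "q = Suc m" using q_pos by (cases q) auto
  have "coeff (P q) (q - 1) = (\<Prod>i=1..m. 1 / a i)" using coeff_P[of m] by (simp add: m)
  moreover have "coeff Disc q = (\<Prod>i=1..m. 1 / a i) / a q" unfolding Disc_coeff by (simp add: m)
  ultimately show ?thesis by (simp add: a_q)
qed

text \<open>As a function of \<open>r\<close> this is a solution vanishing at \<open>q\<close>; it
  is the second ingredient, next to \<open>P r\<close>, of the values at \<open>r + j * q\<close> in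
  \<open>floquet_sine\<close>.\<close>

definition X :: "nat \<Rightarrow> real poly" where "X r = S q * P r - P q * S r"

lemma X_q [simp]: "X q = 0" by (simp add: X_def mult.commute)

text \<open>Adding the degrees of the products would give a bound growing with \<open>r\<close>.
  Instead \<open>X r\<close> is read as the value at distance \<open>q - r\<close> of a solution
  started at \<open>r\<close> with 0 and a constant, which bounds its degree by
  \<open>q - r - 1\<close> for \<open>r < q\<close>.\<close>

lemma degree_X: assumes "r \<in> {1..q}" shows "degree (X r) < q" "coeff (X r) (q - 1) = 0"
proof -
  define y where "y k = S (r + k) * P r - P (r + k) * S r" for k
  have sol: "solution (\<lambda>k. P r * S k + (- S r) * P k)"
    by (intro solution_add solution_mult solution_P solution_S)
  have rec: "y (Suc (Suc n)) = smult (1 / a (r + Suc n)) ([:- b (r + Suc n), 1:] * y (Suc n) - smult (a (r + n)) (y n))" for n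
  proof -
    have y: "y k = P r * S (r + k) + (- S r) * P (r + k)" for k by (simp add: y_def mult.commute)
    have "smult (a (Suc (r + n))) (y (Suc (Suc n))) =
        [:- b (Suc (r + n)), 1:] * y (Suc n) - smult (a (r + n)) (y n)"
      using sol[unfolded solution_def, rule_format, of "r + n"] by (simp only: y add_Suc_right)
    hence "smult (1 / a (Suc (r + n))) (smult (a (Suc (r + n))) (y (Suc (Suc n)))) =
        smult (1 / a (Suc (r + n))) ([:- b (Suc (r + n)), 1:] * y (Suc n) - smult (a (r + n)) (y n))"
      by (rule arg_cong)
    thus ?thesis by (simp only: smult_smult add_Suc_right) simp
  qed
  have y1: "smult (a r) (y (Suc 0)) = smult (a 0) (-1)"
    using solution_wronskian[OF solution_S solution_P, of r] by (simp add: y_def algebra_simps)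
  have "degree (smult (a r) (y (Suc 0))) = 0" unfolding y1 by simp
  hence d1: "degree (y (Suc 0)) = 0" by simp
  have dy: "degree (y (Suc n)) \<le> n" for n
    by (rule degree_recurrence_le[where s = "\<lambda>n. 1 / a (r + Suc n)" and t = "\<lambda>n. b (r + Suc n)" and r = "\<lambda>n. a (r + n)"])
       (use rec d1 in \<open>auto simp: y_def mult.commute\<close>)
  have X: "X r = y (q - r)" using assms by (simp add: X_def y_def)
  have "degree (X r) < q \<and> coeff (X r) (q - 1) = 0"
  proof (cases "r = q")
    case True
    thus ?thesis using q_pos by simp
  next
    case False
    then obtain k where k: "q - r = Suc k" using assms by (cases "q - r") auto
    have "degree (X r) \<le> k" using dy[of k] by (simp add: X k)
    moreover have "k < q - 1" using k assms by auto
    ultimately show ?thesis by (auto intro!: coeff_eq_0)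
  qed
  thus "degree (X r) < q" "coeff (X r) (q - 1) = 0" by auto
qed

lemma B_eq: "B r = smult (1/2) Disc * P r - X r"
  unfolding B_def X_def by (rule poly_real_eqI) (simp add: Disc_def Hq_def field_simps)

text \<open>In this Chebyshev form the energy enters only through \<open>P r\<close> and
  \<open>X r\<close>, both of degree below \<open>q\<close> for \<open>r \<in> {1..q}\<close>, so
  that \<open>sum_L\<close> applies.\<close>

lemma floquet_sine:
  assumes "poly Disc x = 2 * cos \<theta>"
  shows "sin \<theta> * poly (P (r + j * q)) x =
           sin (real (Suc j) * \<theta>) * poly (P r) x - sin (real j * \<theta>) * poly (X r) x"
proof -
  have "sin (real (Suc j) * \<theta>) = sin (real j * \<theta>) * cos \<theta> + cos (real j * \<theta>) * sin \<theta>"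
    by (simp add: algebra_simps sin_add)
  thus ?thesis unfolding floquet_rotation(1)[OF assms] B_eq by (simp add: assms algebra_simps)
qed

end

section \<open>Inverse branches of a polynomial on a band\<close>

lemma poly_abs_unbounded:
  fixes f :: "real poly"
  assumes "degree f > 0"
  shows "\<exists>R>0. \<forall>x. \<bar>x\<bar> \<ge> R \<longrightarrow> \<bar>poly f x\<bar> \<ge> K"
proof -
  have "filterlim (poly f) at_infinity at_infinity"
    using assms by (rule filterlim_poly_at_infinity)
  hence "eventually (\<lambda>x. K \<le> norm (poly f x)) at_infinity"
    unfolding filterlim_at_infinity_conv_norm_at_top filterlim_at_top by blast
  then obtain R where "\<And>x. R \<le> norm x \<Longrightarrow> K \<le> norm (poly f x)"
    unfolding eventually_at_infinity by blast
  thus ?thesis by (intro exI[of _ "max R 1"]) auto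
qed

text \<open>Take the least point of \<open>{c..R}\<close> where \<open>\<bar>g\<bar>\<close> has
  reached \<open>K\<close>; a strict inequality there would contradict the intermediate value
  theorem.\<close>

lemma first_exit:
  fixes g :: "real \<Rightarrow> real"
  assumes cont: "continuous_on UNIV g" and c: "\<bar>g c\<bar> < K" and R: "c < R" "\<bar>g R\<bar> \<ge> K"
  obtains e where "c < e" "\<bar>g e\<bar> = K" "\<And>x. c \<le> x \<Longrightarrow> x < e \<Longrightarrow> \<bar>g x\<bar> < K"
proof -
  define T where "T = {c..R} \<inter> {x. K \<le> \<bar>g x\<bar>}"
  have "closed {x. K \<le> \<bar>g x\<bar>}" by (intro closed_Collect_le continuous_intros cont)
  hence "compact T" unfolding T_def by (intro compact_Int_closed) auto
  moreover have "R \<in> T" using R by (simp add: T_def)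
  hence "T \<noteq> {}" by blast
  ultimately obtain e where e: "e \<in> T" "\<And>x. x \<in> T \<Longrightarrow> e \<le> x"
    using compact_attains_inf[of T] by auto
  have ce: "c < e" using e(1) c by (cases "c = e") (auto simp: T_def)
  have less: "\<bar>g x\<bar> < K" if "c \<le> x" "x < e" for x
  proof (rule ccontr)
    assume "\<not> \<bar>g x\<bar> < K"
    hence "x \<in> T" using that e(1) by (simp add: T_def)
    thus False using e(2) that by fastforce
  qed
  have "\<bar>g e\<bar> = K"
  proof (rule ccontr)
    assume "\<bar>g e\<bar> \<noteq> K"
    hence "K < \<bar>g e\<bar>" using e by (auto simp: T_def)
    moreover have "continuous_on {c..e} (\<lambda>x. \<bar>g x\<bar>)"
      by (intro continuous_intros continuous_on_subset[OF cont]) auto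
    ultimately obtain x where "c \<le> x" "x \<le> e" "\<bar>g x\<bar> = K"
      using IVT'[of "\<lambda>x. \<bar>g x\<bar>" c K e] c ce by auto
    thus False using less[of x] \<open>K < \<bar>g e\<bar>\<close> by (cases "x = e") auto
  qed
  with ce less that show ?thesis by blast
qed

text \<open>The first exits from \<open>\<bar>f\<bar> < 2\<close> to both sides of \<open>c\<close>
  bound an interval on which \<open>f\<close> is injective and takes every value between -2 and 2;
  there \<open>L\<close> inverts \<open>arccos (f / 2)\<close>. The clause on the segment ties the
  branch to its root \<open>c\<close> and later separates different bands.\<close>

lemma band_inverse:
  fixes f :: "real poly"
  assumes deg: "degree f > 0"
    and nz: "\<And>x. \<bar>poly f x\<bar> < 2 \<Longrightarrow> poly (pderiv f) x \<noteq> 0"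
    and c: "poly f c = 0"
  shows "\<exists>L. (\<forall>\<theta>\<in>{0<..<pi}. poly f (L \<theta>) = 2 * cos \<theta> \<and>
      (L has_real_derivative - (2 * sin \<theta>) / poly (pderiv f) (L \<theta>)) (at \<theta>) \<and>
      (\<forall>x\<in>closed_segment c (L \<theta>). \<bar>poly f x\<bar> < 2))"
proof -
  obtain R where R: "\<And>x. \<bar>x\<bar> \<ge> R \<Longrightarrow> \<bar>poly f x\<bar> \<ge> 2"
    using poly_abs_unbounded[OF deg] by blast
  have contf: "continuous_on A (poly f)" for A by (intro continuous_intros)
  obtain e2 where e2: "c < e2" "\<bar>poly f e2\<bar> = 2" "\<And>x. c \<le> x \<Longrightarrow> x < e2 \<Longrightarrow> \<bar>poly f x\<bar> < 2"
    by (rule first_exit[OF contf, of c 2 "max (c + 1) R"]) (use R[of "max (c + 1) R"] c in auto)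
  \<comment> \<open>The left edge is the right edge of the reflected polynomial, hence
    \<open>- d\<close>.\<close>
  obtain d where d: "- c < d" "\<bar>poly f (- d)\<bar> = 2" "\<And>x. - c \<le> x \<Longrightarrow> x < d \<Longrightarrow> \<bar>poly f (- x)\<bar> < 2"
    by (rule first_exit[of "\<lambda>x. poly f (- x)" "- c" 2 "max (1 - c) R"])
       (use R[of "- max (1 - c) R"] c in \<open>auto intro!: continuous_intros\<close>)
  define e1 where "e1 = - d"
  have e1: "e1 < c" "\<bar>poly f e1\<bar> = 2" "\<And>x. x \<le> c \<Longrightarrow> e1 < x \<Longrightarrow> \<bar>poly f x\<bar> < 2"
    using d(1,2) d(3)[of "- x" for x] by (auto simp: e1_def)
  have lt2: "\<bar>poly f x\<bar> < 2" if "e1 < x" "x < e2" for x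
    using e1(3)[of x] e2(3)[of x] that by (cases "x \<le> c") auto
  have inj: "x = y" if "poly f x = poly f y" "e1 \<le> x" "x \<le> e2" "e1 \<le> y" "y \<le> e2" for x y
  proof -
    have False if fxy: "poly f x = poly f y" and "e1 \<le> x" "x < y" "y \<le> e2" for x y
    proof -
      have "\<exists>z. x < z \<and> z < y \<and> poly f y - poly f x = (y - x) * poly (pderiv f) z"
        using \<open>x < y\<close> by (intro MVT2) (auto intro: poly_DERIV)
      then obtain z where z: "x < z" "z < y" "poly (pderiv f) z = 0" using fxy \<open>x < y\<close> by auto
      thus False using nz[of z] lt2[of z] that by auto
    qed
    from this[of x y] this[of y x] show ?thesis using that by (cases x y rule: linorder_cases) auto
  qed
  have surj: "\<exists>x. e1 < x \<and> x < e2 \<and> poly f x = v" if v: "- 2 < v" "v < 2" for v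
  proof -
    \<comment> \<open>Both values have modulus 2, so injectivity forces opposite signs.\<close>
    have "poly f e1 \<noteq> poly f e2" using inj[of e1 e2] e1(1) e2(1) by auto
    hence "(poly f e1 = 2 \<and> poly f e2 = - 2) \<or> (poly f e1 = - 2 \<and> poly f e2 = 2)"
      using e1(2) e2(2) by auto
    hence "\<exists>x. e1 \<le> x \<and> x \<le> e2 \<and> poly f x = v"
    proof
      assume "poly f e1 = 2 \<and> poly f e2 = - 2"
      thus ?thesis using IVT2'[of "poly f" e2 v e1, OF _ _ _ contf] v e1(1) e2(1) by auto
    next
      assume "poly f e1 = - 2 \<and> poly f e2 = 2"
      thus ?thesis using IVT'[of "poly f" e1 v e2, OF _ _ _ contf] v e1(1) e2(1) by auto
    qed
    then obtain x where x: "e1 \<le> x" "x \<le> e2" "poly f x = v" by blast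
    moreover have "x \<noteq> e1" "x \<noteq> e2" using x v e1(2) e2(2) by auto
    ultimately show ?thesis by force
  qed
  define L where "L \<theta> = (SOME x. e1 < x \<and> x < e2 \<and> poly f x = 2 * cos \<theta>)" for \<theta>
  have cos: "- 2 < 2 * cos \<theta>" "2 * cos \<theta> < 2" if "\<theta> \<in> {0<..<pi}" for \<theta>
    using that cos_monotone_0_pi[of 0 \<theta>] cos_monotone_0_pi[of \<theta> pi] by auto
  have L: "e1 < L \<theta>" "L \<theta> < e2" "poly f (L \<theta>) = 2 * cos \<theta>" if "\<theta> \<in> {0<..<pi}" for \<theta>
    using someI_ex[OF surj[OF cos[OF that]]] unfolding L_def by auto
  define F where "F x = arccos (poly f x / 2)" for x
  have FL: "F (L \<theta>) = \<theta>" if "\<theta> \<in> {0<..<pi}" for \<theta>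
    using that L(3)[OF that] by (simp add: F_def arccos_cos)
  have F_in: "F x \<in> {0<..<pi}" and cosF: "2 * cos (F x) = poly f x" if "e1 < x" "x < e2" for x
    using arccos_lt_bounded[of "poly f x / 2"] lt2[OF that] by (auto simp: F_def cos_arccos_abs)
  have LF: "L (F x) = x" if "e1 < x" "x < e2" for x
    using L[OF F_in[OF that]] that cosF[OF that] inj[of "L (F x)" x] by simp
  have dF: "(F has_real_derivative - poly (pderiv f) x / (2 * sin (F x))) (at x)"
    if x: "e1 < x" "x < e2" for x
  proof -
    have "((\<lambda>x. arccos (poly f x / 2)) has_real_derivative
        inverse (- sqrt (1 - (poly f x / 2)\<^sup>2)) * (poly (pderiv f) x / 2)) (at x)"
      using lt2[OF x] by (auto intro!: derivative_eq_intros DERIV_arccos[THEN DERIV_chain2] poly_DERIV)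
    moreover have "sqrt (1 - (poly f x / 2)\<^sup>2) = sin (F x)"
      using lt2[OF x] by (simp add: F_def sin_arccos_abs)
    ultimately show ?thesis by (simp add: F_def[abs_def] field_simps)
  qed
  have "(L has_real_derivative - (2 * sin \<theta>) / poly (pderiv f) (L \<theta>)) (at \<theta>)"
    if \<theta>: "\<theta> \<in> {0<..<pi}" for \<theta>
  proof -
    define x where "x = L \<theta>"
    have x: "e1 < x" "x < e2" "F x = \<theta>" using L[OF \<theta>] FL[OF \<theta>] by (auto simp: x_def)
    have "isCont L (F x)"
    proof (rule isCont_inverse_function2[where f = F and x = x and a = "(e1 + x) / 2" and b = "(x + e2) / 2"])
      fix z assume "(e1 + x) / 2 \<le> z" "z \<le> (x + e2) / 2"
      hence z: "e1 < z" "z < e2" using x by auto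
      show "L (F z) = z" by (rule LF[OF z])
      show "isCont F z" using dF[OF z] by (rule DERIV_isCont)
    qed (use x in auto)
    have "(L has_real_derivative inverse (- poly (pderiv f) x / (2 * sin (F x)))) (at \<theta>)"
    proof (rule DERIV_inverse_function[where f = F and a = 0 and b = pi])
      show "(F has_real_derivative - poly (pderiv f) x / (2 * sin (F x))) (at (L \<theta>))"
        using dF[OF x(1,2)] by (simp add: x_def)
      show "- poly (pderiv f) x / (2 * sin (F x)) \<noteq> 0"
        using nz[OF lt2[OF x(1,2)]] sin_gt_zero[of \<theta>] \<theta> x(3) by auto
      show "isCont L \<theta>" using \<open>isCont L (F x)\<close> x(3) by simp
    qed (use \<theta> FL in auto)
    thus ?thesis using x(3) by (simp add: x_def)
  qed
  moreover have "\<bar>poly f y\<bar> < 2" if "\<theta> \<in> {0<..<pi}" "y \<in> closed_segment c (L \<theta>)" for \<theta> y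
    using that L(1,2)[of \<theta>] e1(1) e2(1) lt2[of y] by (auto simp: closed_segment_eq_real_ivl split: if_splits)
  ultimately show ?thesis using L by blast
qed

lemma poly_inj_on_segment:
  fixes f :: "real poly"
  assumes "\<And>x. \<bar>poly f x\<bar> < 2 \<Longrightarrow> poly (pderiv f) x \<noteq> 0"
    and "\<And>x. x \<in> closed_segment c d \<Longrightarrow> \<bar>poly f x\<bar> < 2" and "poly f c = poly f d"
  shows "c = d"
proof -
  have False if "x < y" and fxy: "poly f x = poly f y" and that3: "\<And>z. x \<le> z \<Longrightarrow> z \<le> y \<Longrightarrow> \<bar>poly f z\<bar> < 2" for x y
  proof -
    have "\<exists>z. x < z \<and> z < y \<and> poly f y - poly f x = (y - x) * poly (pderiv f) z"
      using \<open>x < y\<close> by (intro MVT2) (auto intro: poly_DERIV)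
    then obtain z where z: "x < z" "z < y" "poly (pderiv f) z = 0" using fxy by auto
    thus False using assms(1)[of z] that3[of z] by auto
  qed
  from this[of c d] this[of d c] show ?thesis
    using assms(2,3) by (cases c d rule: linorder_cases) (auto simp: closed_segment_eq_real_ivl)
qed

section \<open>Real roots of \<open>P q\<close> and of the discriminant; the band functions\<close>

context jacobi_coeffs
begin

lemma complex_solution:
  fixes z :: complex
  assumes "solution u"
  defines "w \<equiv> \<lambda>n. poly (map_poly of_real (u n)) z"
  shows "of_real (a (Suc n)) * w (Suc (Suc n)) = (z - of_real (b (Suc n))) * w (Suc n) - of_real (a n) * w n"
proof -
  have "map_poly complex_of_real (smult (a (Suc n)) (u (Suc (Suc n)))) =
        map_poly complex_of_real ([:- b (Suc n), 1:] * u (Suc n) - smult (a n) (u n))"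
    using assms(1) unfolding solution_def by metis
  moreover have "map_poly complex_of_real (smult (a (Suc n)) (u (Suc (Suc n)))) =
      smult (of_real (a (Suc n))) (map_poly of_real (u (Suc (Suc n))))"
    by (rule poly_eqI) (simp add: coeff_map_poly)
  moreover have "map_poly complex_of_real ([:- b (Suc n), 1:] * u (Suc n) - smult (a n) (u n)) =
      [:- of_real (b (Suc n)), 1:] * map_poly of_real (u (Suc n)) - smult (of_real (a n)) (map_poly of_real (u n))"
    by (rule poly_eqI) (simp add: coeff_map_poly coeff_pCons split: nat.split)
  ultimately have "smult (of_real (a (Suc n))) (map_poly of_real (u (Suc (Suc n)))) =
     [:- of_real (b (Suc n)), 1:] * map_poly of_real (u (Suc n)) - smult (of_real (a n)) (map_poly complex_of_real (u n))"
    by simp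
  from arg_cong[OF this, of "\<lambda>f. poly f z"] show ?thesis
    by (simp add: w_def algebra_simps)
qed

text \<open>The Wronskian of \<open>u\<close> with its conjugate takes equal boundary values, so the
  accumulated source \<open>z - cnj z\<close> times the sum of the \<open>\<bar>u k\<bar>^2\<close>
  is 0, and that sum is positive.\<close>

lemma real_of_selfadjoint_boundary:
  fixes z :: complex and u :: "nat \<Rightarrow> complex"
  assumes u: "\<And>n. of_real (a (Suc n)) * u (Suc (Suc n)) = (z - of_real (b (Suc n))) * u (Suc n) - of_real (a n) * u n"
    and bd: "u (Suc q) * cnj (u q) - u q * cnj (u (Suc q)) = u (Suc 0) * cnj (u 0) - u 0 * cnj (u (Suc 0))"
    and u1: "u (Suc 0) \<noteq> 0"
  shows "z \<in> \<real>"
proof -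
  have v: "of_real (a (Suc n)) * cnj (u (Suc (Suc n))) =
      (cnj z - of_real (b (Suc n))) * cnj (u (Suc n)) - of_real (a n) * cnj (u n)" for n
    using arg_cong[OF u[of n], of cnj] by simp
  have "of_real (a q) * (u (Suc q) * cnj (u q) - u q * cnj (u (Suc q))) =
      of_real (a 0) * (u (Suc 0) * cnj (u 0) - u 0 * cnj (u (Suc 0)))
      + (\<Sum>k=1..q. (z - cnj z) * u k * cnj (u k))"
    by (rule wronskian[where c = "\<lambda>n. cnj z - of_real (b n)"])
       (unfold u v, simp_all add: algebra_simps)
  hence "(\<Sum>k=1..q. (z - cnj z) * u k * cnj (u k)) = 0"
    by (simp add: bd a_q)
  hence "(z - cnj z) * of_real (\<Sum>k=1..q. (cmod (u k))\<^sup>2) = 0"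
    by (simp only: of_real_sum complex_norm_square sum_distrib_left mult.assoc)
  moreover have "(\<Sum>k=1..q. (cmod (u k))\<^sup>2) > 0"
    using u1 q_pos by (intro sum_pos2[where i = 1]) auto
  ultimately have "z = cnj z" by (auto simp del: of_real_sum)
  thus ?thesis by (simp add: Reals_cnj_iff)
qed

text \<open>At a root, \<open>P\<close> vanishes at both 0 and \<open>q\<close>, a self-adjoint
  boundary condition. Roots are simple because the derivative Wronskian of \<open>P\<close> with
  itself is a positive sum of squares.\<close>

lemma card_roots_P_q: "card {x. poly (P q) x = 0} = q - 1"
proof -
  obtain m where m: "q = Suc m" using q_pos by (cases q) auto
  have "card {x. poly (P q) x = 0} = degree (P q)"
  proof (rule real_rooted_card_roots)
    show "P q \<noteq> 0" using coeff_P[of m] by (auto simp: m)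
    fix z :: complex assume z: "poly (map_poly of_real (P q)) z = 0"
    show "z \<in> \<real>"
      by (rule real_of_selfadjoint_boundary[where u = "\<lambda>n. poly (map_poly of_real (P n)) z"])
         (use complex_solution[OF solution_P] z in auto)
  next
    fix x assume x: "poly (P q) x = 0"
    have "a 0 * (- poly (pderiv (P q)) x * poly (P (Suc q)) x) = (\<Sum>k=1..q. poly (P k) x * poly (P k) x)"
      using deriv_wronskian[OF solution_P solution_P, of x] x by (simp add: pderiv_1)
    moreover have "(\<Sum>k=1..q. poly (P k) x * poly (P k) x) > 0"
      using q_pos by (intro sum_pos2[where i = 1]) auto
    ultimately show "poly (pderiv (P q)) x \<noteq> 0" by auto
  qed
  thus ?thesis using degree_P_eq[of m] by (simp add: m)
qed

text \<open>At a root the monodromy matrix has trace 0 and determinant 1, hence eigenvalues \<i> and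
  -\<i>. A Floquet solution with a multiplier of modulus 1 satisfies the self-adjoint boundary
  condition.\<close>

lemma card_roots_Disc: "card {x. poly Disc x = 0} = q"
proof -
  have "card {x. poly Disc x = 0} = degree Disc"
  proof (rule real_rooted_card_roots)
    show "Disc \<noteq> 0" using degree_Disc q_pos by auto
    show "poly (pderiv Disc) x \<noteq> 0" if "poly Disc x = 0" for x
      using P_q_deriv_Disc_pos[of x] that by auto
    fix z :: complex assume z: "poly (map_poly of_real Disc) z = 0"
    define p where "p n = poly (map_poly complex_of_real (P n)) z" for n
    define s where "s n = poly (map_poly complex_of_real (S n)) z" for n
    have "map_poly complex_of_real Disc = map_poly of_real (P (Suc q)) + map_poly of_real (S q)"
      unfolding Disc_def by (rule poly_eqI) (simp add: coeff_map_poly)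
    hence D: "p (Suc q) = - s q" using z by (simp add: p_def s_def add_eq_0_iff2)
    have "map_poly complex_of_real (P (Suc q) * S q - P q * S (Suc q)) =
        map_poly of_real (P (Suc q)) * map_poly of_real (S q) - map_poly of_real (P q) * map_poly of_real (S (Suc q))"
      by (rule poly_eqI) (simp add: coeff_map_poly coeff_mult)
    from arg_cong[OF this, of "\<lambda>f. poly f z"]
    have det: "p (Suc q) * s q - p q * s (Suc q) = 1"
      by (simp add: det_monodromy p_def s_def)
    \<comment> \<open>Of the two multipliers one differs from \<open>s q\<close>; this gives
      \<open>u (Suc 0) \<noteq> 0\<close>.\<close>
    obtain e where e: "e * e = - 1" "e * cnj e = 1" "e \<noteq> s q"
    proof (cases "s q = \<i>")
      case True
      thus ?thesis using that[of "- \<i>"] by (auto simp: complex_eq_iff)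
    next
      case False
      thus ?thesis using that[of \<i>] by auto
    qed
    \<comment> \<open>The initial vector \<open>(p q, e - s q)\<close> is an eigenvector of the
      monodromy matrix for \<open>e\<close>.\<close>
    define u where "u n = p q * s n + (e - s q) * p n" for n
    have u0: "u 0 = p q" "u (Suc 0) = e - s q" by (simp_all add: u_def p_def s_def)
    have uq: "u q = e * u 0" unfolding u0 by (simp add: u_def algebra_simps)
    have uq1: "u (Suc q) = e * u (Suc 0)"
    proof -
      have "u (Suc q) = p q * s (Suc q) + e * p (Suc q) - s q * p (Suc q)"
        by (simp add: u_def algebra_simps)
      also have "\<dots> = e * p (Suc q) - 1" using det by (simp add: algebra_simps)
      also have "\<dots> = e * u (Suc 0)" unfolding D u0 using e(1) by (simp add: algebra_simps)
      finally show ?thesis .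
    qed
    show "z \<in> \<real>"
    proof (rule real_of_selfadjoint_boundary[where u = u])
      fix n
      have "of_real (a (Suc n)) * u (Suc (Suc n)) =
          p q * (of_real (a (Suc n)) * s (Suc (Suc n))) + (e - s q) * (of_real (a (Suc n)) * p (Suc (Suc n)))"
        by (simp add: u_def algebra_simps)
      also have "\<dots> = (z - of_real (b (Suc n))) * u (Suc n) - of_real (a n) * u n"
        unfolding p_def s_def complex_solution[OF solution_P] complex_solution[OF solution_S]
        by (simp add: u_def p_def s_def algebra_simps)
      finally show "of_real (a (Suc n)) * u (Suc (Suc n)) =
          (z - of_real (b (Suc n))) * u (Suc n) - of_real (a n) * u n" .
    next
      have "u (Suc q) * cnj (u q) = (e * cnj e) * (u (Suc 0) * cnj (u 0))"
        "u q * cnj (u (Suc q)) = (e * cnj e) * (u 0 * cnj (u (Suc 0)))"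
        by (simp_all add: uq uq1 algebra_simps)
      thus "u (Suc q) * cnj (u q) - u q * cnj (u (Suc q)) =
          u (Suc 0) * cnj (u 0) - u 0 * cnj (u (Suc 0))" by (simp add: e)
    qed (use e in \<open>auto simp: u0\<close>)
  qed
  thus ?thesis by (simp add: degree_Disc)
qed

text \<open>These roots label the \<open>q\<close> bands. They lie strictly inside them, so
  neighbouring bands keep distinct labels even when the gap between them is closed.\<close>

definition centers :: "real set" where "centers = {x. poly Disc x = 0}"

text \<open>
  The inverse branches of the discriminant: \<open>L c \<theta>\<close> is the energy of quasimomentum \<open>\<theta>\<close> in
  the band that contains the root \<open>c\<close> of the discriminant.
\<close>

definition L :: "real \<Rightarrow> real \<Rightarrow> real" where
  "L c = (SOME l. \<forall>\<theta>\<in>{0<..<pi}. poly Disc (l \<theta>) = 2 * cos \<theta> \<and>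
      (l has_real_derivative - (2 * sin \<theta>) / poly (pderiv Disc) (l \<theta>)) (at \<theta>) \<and>
      (\<forall>x\<in>closed_segment c (l \<theta>). \<bar>poly Disc x\<bar> < 2))"

lemma finite_centers [simp]: "finite centers"
  unfolding centers_def using q_pos degree_Disc by (intro poly_roots_finite) auto

lemma card_centers: "card centers = q"
  by (simp add: centers_def card_roots_Disc)

lemma pderiv_Disc_nz: "\<bar>poly Disc x\<bar> < 2 \<Longrightarrow> poly (pderiv Disc) x \<noteq> 0"
  using P_q_deriv_Disc_pos by fastforce

lemma
  assumes "c \<in> centers" "\<theta> \<in> {0<..<pi}"
  shows Disc_L: "poly Disc (L c \<theta>) = 2 * cos \<theta>"
    and deriv_L: "(L c has_real_derivative - (2 * sin \<theta>) / poly (pderiv Disc) (L c \<theta>)) (at \<theta>)"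
    and L_segment: "\<And>x. x \<in> closed_segment c (L c \<theta>) \<Longrightarrow> \<bar>poly Disc x\<bar> < 2"
proof -
  have "\<exists>l. \<forall>\<theta>\<in>{0<..<pi}. poly Disc (l \<theta>) = 2 * cos \<theta> \<and>
      (l has_real_derivative - (2 * sin \<theta>) / poly (pderiv Disc) (l \<theta>)) (at \<theta>) \<and>
      (\<forall>x\<in>closed_segment c (l \<theta>). \<bar>poly Disc x\<bar> < 2)"
    by (rule band_inverse) (use assms(1) q_pos pderiv_Disc_nz in \<open>simp_all add: degree_Disc centers_def\<close>)
  from someI_ex[OF this, folded L_def] assms(2)
  show "poly Disc (L c \<theta>) = 2 * cos \<theta>"
    "(L c has_real_derivative - (2 * sin \<theta>) / poly (pderiv Disc) (L c \<theta>)) (at \<theta>)"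
    "\<And>x. x \<in> closed_segment c (L c \<theta>) \<Longrightarrow> \<bar>poly Disc x\<bar> < 2" by blast+
qed

lemma abs_Disc_L: "c \<in> centers \<Longrightarrow> \<theta> \<in> {0<..<pi} \<Longrightarrow> \<bar>poly Disc (L c \<theta>)\<bar> < 2"
  by (rule L_segment) auto

lemma L_inj:
  assumes "c \<in> centers" "\<theta> \<in> {0<..<pi}" "\<phi> \<in> {0<..<pi}" "L c \<theta> = L c \<phi>"
  shows "\<theta> = \<phi>"
proof -
  have "cos \<theta> = cos \<phi>" using Disc_L[OF assms(1,2)] Disc_L[OF assms(1,3)] unfolding assms(4) by linarith
  thus ?thesis using assms(2,3) cos_inj_pi[of \<theta> \<phi>] by simp
qed

text \<open>The two segments ending at a common energy cover the segment from \<open>c\<close> to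
  \<open>d\<close>. On it \<open>Disc\<close> would be injective, yet it vanishes at both
  ends.\<close>

lemma L_disjoint:
  assumes "c \<in> centers" "d \<in> centers" "\<theta> \<in> {0<..<pi}" "L c \<theta> = L d \<theta>"
  shows "c = d"
proof (rule poly_inj_on_segment)
  fix x assume "x \<in> closed_segment c d"
  hence "x \<in> closed_segment c (L c \<theta>) \<or> x \<in> closed_segment d (L d \<theta>)"
    unfolding assms(4) by (auto simp: closed_segment_eq_real_ivl split: if_splits)
  thus "\<bar>poly Disc x\<bar> < 2" using L_segment assms by blast
qed (use assms in \<open>auto simp: centers_def pderiv_Disc_nz\<close>)

lemma L_bounded: "\<exists>R>0. \<forall>c\<in>centers. \<forall>\<theta>\<in>{0<..<pi}. \<bar>L c \<theta>\<bar> \<le> R"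
proof -
  obtain R where R: "R > 0" "\<And>x. \<bar>x\<bar> \<ge> R \<Longrightarrow> \<bar>poly Disc x\<bar> \<ge> 2"
    using poly_abs_unbounded[of Disc 2] q_pos by (auto simp: degree_Disc)
  have "\<bar>L c \<theta>\<bar> \<le> R" if "c \<in> centers" "\<theta> \<in> {0<..<pi}" for c \<theta>
    using R(2)[of "L c \<theta>"] abs_Disc_L[OF that] by (cases "\<bar>L c \<theta>\<bar> \<le> R") auto
  thus ?thesis using R(1) by blast
qed

text \<open>The \<open>q\<close> energies \<open>L c \<theta>\<close> are all roots of
  \<open>Disc - [:2 * cos \<theta>:]\<close>, a polynomial with the derivative and leading
  coefficient of \<open>Disc\<close>.\<close>

lemma sum_L:
  assumes \<theta>: "\<theta> \<in> {0<..<pi}" and g: "degree g < q"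
  shows "(\<Sum>c\<in>centers. poly g (L c \<theta>) / poly (pderiv Disc) (L c \<theta>)) = coeff g (q - 1) / coeff Disc q"
proof -
  define f where "f = Disc - [:2 * cos \<theta>:]"
  have inj: "inj_on (\<lambda>c. L c \<theta>) centers" using \<theta> by (intro inj_onI) (auto dest: L_disjoint)
  have degf: "degree f = q"
    unfolding f_def using q_pos degree_Disc degree_add_eq_left[of "- [:2 * cos \<theta>:]" Disc]
    by (simp del: minus_pCons)
  have lead: "lead_coeff f = coeff Disc q"
    unfolding degf using q_pos by (cases q) (simp_all add: f_def)
  have froot: "poly f (L c \<theta>) = 0" if "c \<in> centers" for c
    using Disc_L[OF that \<theta>] by (simp add: f_def)
  have pd: "pderiv f = pderiv Disc" by (simp add: f_def pderiv_diff pderiv_pCons)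
  have "(\<Sum>x\<in>(\<lambda>c. L c \<theta>) ` centers. poly g x / poly (pderiv f) x) = coeff g (degree f - 1) / lead_coeff f"
    by (rule lagrange_coeff)
       (use \<theta> g froot in \<open>auto simp: card_image inj card_centers degf\<close>)
  thus ?thesis unfolding sum.reindex[OF inj] pd lead unfolding degf by simp
qed

end

section \<open>The continuous part of the spectral measure\<close>

lemma integral_sin_sin:
  assumes "k \<ge> 1"
  shows "integral\<^sup>L (lebesgue_on {0<..<pi}) (\<lambda>\<theta>. sin \<theta> * sin (real k * \<theta>)) = (if k = 1 then pi / 2 else 0)"
proof -
  \<comment> \<open>The antiderivative comes from the product-to-sum formula; \<open>k = 1\<close>
    is separate because the frequency \<open>k - 1\<close> vanishes.\<close>
  define F where "F \<theta> = (if k = 1 then \<theta> / 2 - sin (2 * \<theta>) / 4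
     else sin (real (k - 1) * \<theta>) / (2 * real (k - 1)) - sin (real (k + 1) * \<theta>) / (2 * real (k + 1)))" for \<theta>
  have F: "(F has_real_derivative sin \<theta> * sin (real k * \<theta>)) (at \<theta> within A)" for \<theta> A
  proof (cases "k = 1")
    case True
    have "((\<lambda>\<theta>. \<theta> / 2 - sin (2 * \<theta>) / 4) has_real_derivative 1 / 2 - cos (2 * \<theta>) / 2) (at \<theta> within A)"
      by (auto intro!: derivative_eq_intros)
    moreover have "1 / 2 - cos (2 * \<theta>) / 2 = sin \<theta> * sin \<theta>"
      using cos_double_sin[of \<theta>] unfolding power2_eq_square by linarith
    ultimately show ?thesis using True by (simp add: F_def[abs_def])
  next
    case False
    hence k: "k > 1" using assms by simp
    have "((\<lambda>\<theta>. sin (real (k - 1) * \<theta>) / (2 * real (k - 1)) - sin (real (k + 1) * \<theta>) / (2 * real (k + 1)))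
      has_real_derivative cos (real (k - 1) * \<theta>) / 2 - cos (real (k + 1) * \<theta>) / 2) (at \<theta> within A)"
    proof (rule DERIV_diff)
      have "((\<lambda>\<theta>. sin (s * \<theta>) / (2 * s)) has_real_derivative cos (s * \<theta>) / 2) (at \<theta> within A)"
        if "s \<noteq> 0" for s :: real
        using that by (auto intro!: derivative_eq_intros)
      from this[of "real (k - 1)"] this[of "real (k + 1)"] k
      show "((\<lambda>\<theta>. sin (real (k - 1) * \<theta>) / (2 * real (k - 1))) has_real_derivative
              cos (real (k - 1) * \<theta>) / 2) (at \<theta> within A)"
        "((\<lambda>\<theta>. sin (real (k + 1) * \<theta>) / (2 * real (k + 1))) has_real_derivative
              cos (real (k + 1) * \<theta>) / 2) (at \<theta> within A)" by auto
    qed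
    moreover have "real (k - 1) * \<theta> = real k * \<theta> - \<theta>" "real (k + 1) * \<theta> = real k * \<theta> + \<theta>"
      using k by (simp_all add: algebra_simps of_nat_diff)
    hence "cos (real (k - 1) * \<theta>) / 2 - cos (real (k + 1) * \<theta>) / 2 = sin \<theta> * sin (real k * \<theta>)"
      by (simp only: cos_add cos_diff) (simp add: field_simps)
    ultimately show ?thesis using False by (simp add: F_def[abs_def])
  qed
  have "((\<lambda>\<theta>. sin \<theta> * sin (real k * \<theta>)) has_integral F pi - F 0) {0..pi}"
    using F by (intro fundamental_theorem_of_calculus) (auto simp: has_real_derivative_iff_has_vector_derivative)
  moreover have "F pi - F 0 = (if k = 1 then pi / 2 else 0)"
    using sin_npi[of "k - 1"] sin_npi[of "k + 1"] by (simp add: F_def del: sin_npi sin_npi2 of_nat_add of_nat_diff)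
  ultimately have "((\<lambda>\<theta>. sin \<theta> * sin (real k * \<theta>)) has_integral (if k = 1 then pi / 2 else 0)) {0<..<pi}"
    by (simp add: has_integral_Icc_iff_Ioo)
  moreover have "integral\<^sup>L (lebesgue_on {0<..<pi}) (\<lambda>\<theta>. sin \<theta> * sin (real k * \<theta>)) =
      integral {0<..<pi} (\<lambda>\<theta>. sin \<theta> * sin (real k * \<theta>))"
  proof (rule lebesgue_integral_eq_integral)
    interpret finite_measure "lebesgue_on {0<..<pi}" by (rule finite_measure_lebesgue_on) simp
    show "integrable (lebesgue_on {0<..<pi}) (\<lambda>\<theta>. sin \<theta> * sin (real k * \<theta>))"
      by (rule integrable_const_bound[where B = 1])
         (auto intro!: AE_I2 continuous_imp_measurable_on_sets_lebesgue continuous_intros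
            simp: abs_mult mult_le_one)
  qed simp
  ultimately show ?thesis by (simp add: integral_unique)
qed

section \<open>The spectral density in the quasimomentum\<close>

context jacobi_coeffs
begin

abbreviation qmeas :: "real measure" where "qmeas \<equiv> lebesgue_on {0<..<pi}"

text \<open>By \<open>P_q_deriv_Disc\<close> this is the sum over one period of the squared lengths
  of the vectors \<open>(sin \<theta> * P k, B k)\<close> at energy
  \<open>L c \<theta>\<close>.\<close>

definition weight :: "real \<Rightarrow> real \<Rightarrow> real" where
  "weight c \<theta> = a 0 * (poly (P q) (L c \<theta>) * poly (pderiv Disc) (L c \<theta>))"

text \<open>One factor \<open>sin \<theta>\<close> belongs to the density in the energy, the other
  to the Jacobian of \<open>L c\<close>. Each is attached to one solution, which makes both factors
  bounded by the square root of the weight.\<close>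

definition kern :: "real \<Rightarrow> nat \<Rightarrow> nat \<Rightarrow> real \<Rightarrow> real" where
  "kern c n m \<theta> = 2 / pi * (sin \<theta> * poly (P n) (L c \<theta>)) * (sin \<theta> * poly (P m) (L c \<theta>)) / weight c \<theta>"

text \<open>
  In the energy variable this is the integral of \<open>\<phi> p\<^sub>n p\<^sub>m\<close> against the absolutely continuous part
  of the spectral measure.
\<close>

definition Kf :: "(real \<Rightarrow> complex) \<Rightarrow> nat \<Rightarrow> nat \<Rightarrow> complex" where
  "Kf \<phi> n m = (\<Sum>c\<in>centers. integral\<^sup>L qmeas (\<lambda>\<theta>. \<phi> (L c \<theta>) * of_real (kern c n m \<theta>)))"

lemma weight_pos: "c \<in> centers \<Longrightarrow> \<theta> \<in> {0<..<pi} \<Longrightarrow> weight c \<theta> > 0"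
  unfolding weight_def using abs_Disc_L[of c \<theta>] a_pos[of 0]
  by (intro mult_pos_pos[OF _ P_q_deriv_Disc_pos]) auto

lemma weight_ge:
  assumes "c \<in> centers" "\<theta> \<in> {0<..<pi}" "r \<in> {1..q}"
  shows "(sin \<theta> * poly (P r) (L c \<theta>))\<^sup>2 + (poly (B r) (L c \<theta>))\<^sup>2 \<le> weight c \<theta>"
  using P_q_deriv_Disc_ge[of "L c \<theta>" r] abs_Disc_L[OF assms(1,2)] assms(3)
  by (simp add: weight_def Disc_L[OF assms(1,2)] sin_squared_eq power_mult_distrib add.commute)

text \<open>Residues run through \<open>{1..q}\<close>, the range of the sum in
  \<open>P_q_deriv_Disc\<close>. The bound \<open>j < n\<close> later yields
  \<open>1 + j + k \<le> n + m\<close>.\<close>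

lemma index_decompose:
  assumes "n \<ge> 1"
  obtains r j where "r \<in> {1..q}" "n = r + j * q" "j < n"
proof
  show "(n - 1) mod q + 1 \<in> {1..q}" using q_pos by (auto simp: Suc_le_eq)
  show "n = (n - 1) mod q + 1 + (n - 1) div q * q"
    using assms mod_mult_div_eq[of "n - 1" q] by (simp add: mult.commute)
  show "(n - 1) div q < n" using assms by (metis diff_less div_le_dividend le_less_trans less_numeral_extra(1) One_nat_def Suc_le_lessD)
qed

text \<open>The rotation preserves length, so the Cauchy-Schwarz inequality reduces every index to
  its residue in the first period.\<close>

lemma P_sq_le_weight:
  assumes c: "c \<in> centers" and \<theta>: "\<theta> \<in> {0<..<pi}"
  shows "(sin \<theta> * poly (P n) (L c \<theta>))\<^sup>2 \<le> weight c \<theta>"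
proof (cases "n = 0")
  case True
  thus ?thesis using weight_pos[OF c \<theta>] by simp
next
  case False
  hence "n \<ge> 1" by simp
  then obtain r j where r: "r \<in> {1..q}" "n = r + j * q" using index_decompose[of n] by metis
  define A B' C D where "A = sin \<theta> * poly (P r) (L c \<theta>)" and "B' = poly (B r) (L c \<theta>)"
    and "C = cos (real j * \<theta>)" and "D = sin (real j * \<theta>)"
  have "sin \<theta> * poly (P n) (L c \<theta>) = A * C + B' * D"
    unfolding r(2) floquet_rotation(1)[OF Disc_L[OF c \<theta>]] by (simp add: A_def B'_def C_def D_def)
  also have "(A * C + B' * D)\<^sup>2 \<le> (A\<^sup>2 + B'\<^sup>2) * (C\<^sup>2 + D\<^sup>2)"
    using zero_le_power2[of "A * D - B' * C"] by (simp add: power2_eq_square algebra_simps)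
  also have "C\<^sup>2 + D\<^sup>2 = 1" by (simp add: C_def D_def)
  also have "(A\<^sup>2 + B'\<^sup>2) * 1 \<le> weight c \<theta>" using weight_ge[OF c \<theta> r(1)] by (simp add: A_def B'_def)
  finally show ?thesis .
qed

lemma abs_kern_le:
  assumes c: "c \<in> centers" and \<theta>: "\<theta> \<in> {0<..<pi}"
  shows "\<bar>kern c n m \<theta>\<bar> \<le> 2 / pi"
proof -
  define x y where "x = sin \<theta> * poly (P n) (L c \<theta>)" and "y = sin \<theta> * poly (P m) (L c \<theta>)"
  have "x\<^sup>2 \<le> weight c \<theta>" "y\<^sup>2 \<le> weight c \<theta>"
    using P_sq_le_weight[OF c \<theta>] by (auto simp: x_def y_def)
  moreover have "2 * \<bar>x * y\<bar> \<le> x\<^sup>2 + y\<^sup>2"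
    using sum_squares_bound[of "\<bar>x\<bar>" "\<bar>y\<bar>"] by (simp add: abs_mult)
  ultimately have "\<bar>x * y\<bar> \<le> weight c \<theta>" by linarith
  moreover have "kern c n m \<theta> = 2 / pi * (x * y / weight c \<theta>)"
    by (simp add: kern_def x_def y_def)
  moreover have "\<bar>x * y / weight c \<theta>\<bar> \<le> 1"
    using weight_pos[OF c \<theta>] \<open>\<bar>x * y\<bar> \<le> weight c \<theta>\<close> by (simp add: abs_divide)
  ultimately show ?thesis
    using mult_left_mono[of "\<bar>x * y / weight c \<theta>\<bar>" 1 "2 / pi"] by (simp add: abs_mult)
qed

lemma continuous_L: "c \<in> centers \<Longrightarrow> continuous_on {0<..<pi} (L c)"
  by (rule DERIV_continuous_on[where D = "\<lambda>\<theta>. - (2 * sin \<theta>) / poly (pderiv Disc) (L c \<theta>)"])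
     (rule has_field_derivative_at_within[OF deriv_L])

lemma continuous_kern:
  assumes "c \<in> centers" shows "continuous_on {0<..<pi} (kern c n m)"
proof -
  have "continuous_on {0<..<pi} (\<lambda>\<theta>. 2 / pi * (sin \<theta> * poly (P n) (L c \<theta>)) * (sin \<theta> * poly (P m) (L c \<theta>)) / weight c \<theta>)"
    using weight_pos[OF assms] unfolding weight_def
    by (intro continuous_intros continuous_L assms) (auto simp: less_le)
  thus ?thesis by (simp add: kern_def[abs_def])
qed

lemma finite_measure_qmeas: "finite_measure qmeas"
  by (rule finite_measure_lebesgue_on) simp

lemma integrable_qmeas:
  fixes f :: "real \<Rightarrow> 'b::euclidean_space"
  assumes "continuous_on {0<..<pi} f" "\<And>\<theta>. \<theta> \<in> {0<..<pi} \<Longrightarrow> norm (f \<theta>) \<le> K"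
  shows "integrable qmeas f"
  using assms by (intro finite_measure.integrable_const_bound[OF finite_measure_qmeas, of _ K]
      continuous_imp_measurable_on_sets_lebesgue AE_I2) auto

definition Lbound :: real where
  "Lbound = (SOME R. R > 0 \<and> (\<forall>c\<in>centers. \<forall>\<theta>\<in>{0<..<pi}. \<bar>L c \<theta>\<bar> \<le> R))"

lemma Lbound: "Lbound > 0" "c \<in> centers \<Longrightarrow> \<theta> \<in> {0<..<pi} \<Longrightarrow> \<bar>L c \<theta>\<bar> \<le> Lbound"
  using someI_ex[OF L_bounded, folded Lbound_def] by auto

lemma continuous_integrand:
  "c \<in> centers \<Longrightarrow> continuous_on UNIV \<phi> \<Longrightarrow>
     continuous_on {0<..<pi} (\<lambda>\<theta>. \<phi> (L c \<theta>) * complex_of_real (kern c n m \<theta>))"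
  by (intro continuous_on_mult continuous_on_of_real continuous_kern
      continuous_on_compose2[of UNIV \<phi>, OF _ continuous_L]) auto

lemma bounded_on_bands:
  fixes \<phi> :: "real \<Rightarrow> complex"
  assumes "continuous_on UNIV \<phi>"
  obtains K where "K > 0" "\<And>c \<theta>. c \<in> centers \<Longrightarrow> \<theta> \<in> {0<..<pi} \<Longrightarrow> norm (\<phi> (L c \<theta>)) \<le> K"
proof -
  have "bounded (\<phi> ` {- Lbound..Lbound})"
    by (intro compact_imp_bounded compact_continuous_image continuous_on_subset[OF assms]) auto
  then obtain K where K: "K > 0" "\<And>x. x \<in> {- Lbound..Lbound} \<Longrightarrow> norm (\<phi> x) \<le> K"
    by (auto simp: bounded_pos)
  show ?thesis
  proof (rule that[OF K(1)])
    fix c \<theta> assume "c \<in> centers" "\<theta> \<in> {0<..<pi}"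
    thus "norm (\<phi> (L c \<theta>)) \<le> K" using Lbound(2)[of c \<theta>] by (intro K(2)) auto
  qed
qed

lemma integrable_integrand:
  assumes c: "c \<in> centers" and "continuous_on UNIV \<phi>"
  shows "integrable qmeas (\<lambda>\<theta>. \<phi> (L c \<theta>) * complex_of_real (kern c n m \<theta>))"
proof -
  obtain K where K: "K > 0" "\<And>c \<theta>. c \<in> centers \<Longrightarrow> \<theta> \<in> {0<..<pi} \<Longrightarrow> norm (\<phi> (L c \<theta>)) \<le> K"
    using bounded_on_bands[OF assms(2)] by blast
  show ?thesis
  proof (rule integrable_qmeas)
    fix \<theta> assume \<theta>: "\<theta> \<in> {0<..<pi}"
    have "norm (\<phi> (L c \<theta>)) * \<bar>kern c n m \<theta>\<bar> \<le> K * (2 / pi)"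
      using K c \<theta> by (intro mult_mono abs_kern_le) auto
    thus "norm (\<phi> (L c \<theta>) * complex_of_real (kern c n m \<theta>)) \<le> K * (2 / pi)"
      by (simp add: norm_mult)
  qed (intro continuous_integrand assms)
qed

lemma Kf_cong:
  assumes "\<And>c \<theta>. c \<in> centers \<Longrightarrow> \<theta> \<in> {0<..<pi} \<Longrightarrow>
     \<phi> (L c \<theta>) * of_real (kern c n m \<theta>) = \<psi> (L c \<theta>) * of_real (kern c n' m' \<theta>)"
  shows "Kf \<phi> n m = Kf \<psi> n' m'"
  unfolding Kf_def using assms by (intro sum.cong refl Bochner_Integration.integral_cong) auto

lemma Kf_0 [simp]: "Kf \<phi> 0 m = 0"
  by (simp add: Kf_def kern_def)

lemma Kf_add:
  assumes "continuous_on UNIV \<phi>" "continuous_on UNIV \<psi>"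
  shows "Kf (\<lambda>x. \<phi> x + \<psi> x) n m = Kf \<phi> n m + Kf \<psi> n m"
  unfolding Kf_def sum.distrib[symmetric]
  by (intro sum.cong refl) (simp add: distrib_right Bochner_Integration.integral_add integrable_integrand assms)

lemma Kf_cmult: "Kf (\<lambda>x. k * \<phi> x) n m = k * Kf \<phi> n m"
  unfolding Kf_def sum_distrib_left by (intro sum.cong refl) (simp add: mult.assoc)

text \<open>Multiplication by the energy acts on the first index as the Jacobi operator does; the
  boundary is right because \<open>Kf \<phi> 0 m = 0\<close>.\<close>

lemma Kf_recurrence:
  assumes "continuous_on UNIV \<phi>"
  shows "Kf (\<lambda>x. of_real x * \<phi> x) (Suc n) m =
    of_real (a n) * Kf \<phi> n m + of_real (b (Suc n)) * Kf \<phi> (Suc n) m + of_real (a (Suc n)) * Kf \<phi> (Suc (Suc n)) m"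
proof -
  have P: "x * poly (P (Suc n)) x =
      a n * poly (P n) x + b (Suc n) * poly (P (Suc n)) x + a (Suc n) * poly (P (Suc (Suc n))) x" for x
  proof -
    have "poly (smult (a (Suc n)) (P (Suc (Suc n)))) x =
        poly ([:- b (Suc n), 1:] * P (Suc n) - smult (a n) (P n)) x"
      using solution_P unfolding solution_def by metis
    thus ?thesis by (simp add: algebra_simps)
  qed
  have kern: "L c \<theta> * kern c (Suc n) m \<theta> =
      a n * kern c n m \<theta> + b (Suc n) * kern c (Suc n) m \<theta> + a (Suc n) * kern c (Suc (Suc n)) m \<theta>" for c \<theta>
  proof -
    define k where "k = 2 / pi * sin \<theta> * (sin \<theta> * poly (P m) (L c \<theta>)) / weight c \<theta>"
    have k: "kern c i m \<theta> = k * poly (P i) (L c \<theta>)" for i by (simp add: kern_def k_def)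
    have "L c \<theta> * kern c (Suc n) m \<theta> = k * (L c \<theta> * poly (P (Suc n)) (L c \<theta>))" by (simp add: k)
    also have "\<dots> = a n * kern c n m \<theta> + b (Suc n) * kern c (Suc n) m \<theta> + a (Suc n) * kern c (Suc (Suc n)) m \<theta>"
      unfolding P k by (simp add: algebra_simps)
    finally show ?thesis .
  qed
  have "integral\<^sup>L qmeas (\<lambda>\<theta>. of_real (L c \<theta>) * \<phi> (L c \<theta>) * of_real (kern c (Suc n) m \<theta>)) =
     of_real (a n) * integral\<^sup>L qmeas (\<lambda>\<theta>. \<phi> (L c \<theta>) * of_real (kern c n m \<theta>))
     + of_real (b (Suc n)) * integral\<^sup>L qmeas (\<lambda>\<theta>. \<phi> (L c \<theta>) * of_real (kern c (Suc n) m \<theta>))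
     + of_real (a (Suc n)) * integral\<^sup>L qmeas (\<lambda>\<theta>. \<phi> (L c \<theta>) * of_real (kern c (Suc (Suc n)) m \<theta>))"
    if c: "c \<in> centers" for c
  proof -
    have "of_real (L c \<theta>) * \<phi> (L c \<theta>) * of_real (kern c (Suc n) m \<theta>) =
      of_real (a n) * (\<phi> (L c \<theta>) * of_real (kern c n m \<theta>))
      + of_real (b (Suc n)) * (\<phi> (L c \<theta>) * of_real (kern c (Suc n) m \<theta>))
      + of_real (a (Suc n)) * (\<phi> (L c \<theta>) * of_real (kern c (Suc (Suc n)) m \<theta>))" for \<theta>
    proof -
      have "of_real (L c \<theta>) * \<phi> (L c \<theta>) * of_real (kern c (Suc n) m \<theta>) =
        \<phi> (L c \<theta>) * of_real (L c \<theta> * kern c (Suc n) m \<theta>)" by simp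
      thus ?thesis unfolding kern by (simp add: algebra_simps)
    qed
    thus ?thesis
      by (simp add: Bochner_Integration.integral_add integrable_integrand[OF c assms]
           integrable_mult_right)
  qed
  thus ?thesis unfolding Kf_def by (simp add: sum.distrib sum_distrib_left)
qed

text \<open>Column \<open>m\<close> is reduced to column 1, the counterpart of
  \<open>polJ_P\<close>.\<close>

lemma Kf_swap_P: "Kf (\<lambda>x. of_real (poly (P m) x) * \<phi> x) n (Suc 0) = Kf \<phi> n m"
  by (rule Kf_cong) (simp add: kern_def mult.commute mult.left_commute)

text \<open>The bound on \<open>kern\<close> makes a constant an integrable majorant. Convergence is
  asked for only almost everywhere, so that a single energy may be excepted.\<close>

lemma Kf_dominated:
  assumes \<phi>: "\<And>k. continuous_on UNIV (\<phi> k)" and \<psi>: "continuous_on UNIV \<psi>"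
    and bd: "\<And>k c \<theta>. c \<in> centers \<Longrightarrow> \<theta> \<in> {0<..<pi} \<Longrightarrow> norm (\<phi> k (L c \<theta>)) \<le> K"
    and lim: "\<And>c. c \<in> centers \<Longrightarrow> AE \<theta> in qmeas. (\<lambda>k. \<phi> k (L c \<theta>)) \<longlonglongrightarrow> \<psi> (L c \<theta>)"
  shows "(\<lambda>k. Kf (\<phi> k) n m) \<longlonglongrightarrow> Kf \<psi> n m"
  unfolding Kf_def
proof (rule tendsto_sum)
  fix c assume c: "c \<in> centers"
  show "(\<lambda>k. integral\<^sup>L qmeas (\<lambda>\<theta>. \<phi> k (L c \<theta>) * of_real (kern c n m \<theta>))) \<longlonglongrightarrow>
      integral\<^sup>L qmeas (\<lambda>\<theta>. \<psi> (L c \<theta>) * of_real (kern c n m \<theta>))"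
  proof (rule integral_dominated_convergence[where w = "\<lambda>_. K * (2 / pi)"])
    show "(\<lambda>\<theta>. \<psi> (L c \<theta>) * of_real (kern c n m \<theta>)) \<in> borel_measurable qmeas"
      "(\<lambda>\<theta>. \<phi> k (L c \<theta>) * of_real (kern c n m \<theta>)) \<in> borel_measurable qmeas" for k
      by (intro borel_measurable_integrable integrable_integrand c \<phi> \<psi>)+
    show "integrable qmeas (\<lambda>_. K * (2 / pi))"
      by (rule finite_measure.integrable_const[OF finite_measure_qmeas])
    show "AE \<theta> in qmeas. (\<lambda>k. \<phi> k (L c \<theta>) * of_real (kern c n m \<theta>)) \<longlonglongrightarrow> \<psi> (L c \<theta>) * of_real (kern c n m \<theta>)"
      using lim[OF c] by eventually_elim (intro tendsto_intros)
    show "AE \<theta> in qmeas. norm (\<phi> k (L c \<theta>) * of_real (kern c n m \<theta>)) \<le> K * (2 / pi)" for k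
    proof (rule AE_I2)
      fix \<theta> assume "\<theta> \<in> space qmeas"
      hence \<theta>: "\<theta> \<in> {0<..<pi}" by simp
      have "norm (\<phi> k (L c \<theta>)) * \<bar>kern c n m \<theta>\<bar> \<le> K * (2 / pi)"
        using bd[OF c \<theta>, of k] order.trans[OF norm_ge_zero bd[OF c \<theta>, of k]] c \<theta>
        by (intro mult_mono abs_kern_le) auto
      thus "norm (\<phi> k (L c \<theta>) * of_real (kern c n m \<theta>)) \<le> K * (2 / pi)" by (simp add: norm_mult)
    qed
  qed
qed

text \<open>The factor \<open>P q\<close> cancels the one in the weight. What remains are quotients
  by the derivative of \<open>Disc\<close>, and \<open>sum_L\<close> extracts coefficients of degree
  \<open>q - 1\<close>: zero for \<open>X r\<close>, and nonzero for \<open>P r\<close> only if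
  \<open>r = q\<close>.\<close>

lemma sum_kern:
  assumes \<theta>: "\<theta> \<in> {0<..<pi}" and r: "r \<in> {1..q}"
  shows "(\<Sum>c\<in>centers. poly (P q) (L c \<theta>) * kern c (r + j * q) (Suc 0) \<theta>) =
    (if r = q then 2 / pi * (sin \<theta> * sin (real (Suc j) * \<theta>)) else 0)"
proof -
  have kern: "poly (P q) (L c \<theta>) * kern c (r + j * q) (Suc 0) \<theta> =
      2 / (pi * a 0) * sin \<theta> * (sin (real (Suc j) * \<theta>) * (poly (P r) (L c \<theta>) / poly (pderiv Disc) (L c \<theta>))
        - sin (real j * \<theta>) * (poly (X r) (L c \<theta>) / poly (pderiv Disc) (L c \<theta>)))" if c: "c \<in> centers" for c
  proof -
    have "poly (P q) (L c \<theta>) \<noteq> 0" "poly (pderiv Disc) (L c \<theta>) \<noteq> 0"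
      using weight_pos[OF c \<theta>] by (auto simp: weight_def)
    thus ?thesis unfolding kern_def weight_def floquet_sine[OF Disc_L[OF c \<theta>]]
      by (simp add: field_simps)
  qed
  have "degree (P r) < q" using degree_P_eq[of "r - 1"] r by (cases r) auto
  hence sP: "(\<Sum>c\<in>centers. poly (P r) (L c \<theta>) / poly (pderiv Disc) (L c \<theta>)) = coeff (P r) (q - 1) / coeff Disc q"
    by (rule sum_L[OF \<theta>])
  have sX: "(\<Sum>c\<in>centers. poly (X r) (L c \<theta>) / poly (pderiv Disc) (L c \<theta>)) = 0"
    using sum_L[OF \<theta> degree_X(1)[OF r]] degree_X(2)[OF r] by simp
  have "(\<Sum>c\<in>centers. poly (P q) (L c \<theta>) * kern c (r + j * q) (Suc 0) \<theta>) =
      2 / (pi * a 0) * sin \<theta> * (sin (real (Suc j) * \<theta>) * (coeff (P r) (q - 1) / coeff Disc q))"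
    by (simp only: kern cong: sum.cong)
       (simp only: sum_subtractf sum_distrib_left[symmetric] sP sX mult_zero_right diff_zero)
  also have "\<dots> = (if r = q then 2 / pi * (sin \<theta> * sin (real (Suc j) * \<theta>)) else 0)"
  proof (cases "r = q")
    case True
    have "coeff Disc q \<noteq> 0" unfolding Disc_coeff by simp
    hence "coeff (P r) (q - 1) / coeff Disc q = a 0" using True P_q_coeff by simp
    thus ?thesis using True by simp
  next
    case False
    hence "coeff (P r) (q - 1) = 0"
      using r degree_P_eq[of "r - 1"] by (intro coeff_eq_0) (cases r, auto)
    thus ?thesis using False by simp
  qed
  finally show ?thesis .
qed

text \<open>Summing over the bands before integrating leaves the orthogonality of sines. The values
  are the entries of \<open>unit_vec q\<close>, as \<open>polJ (P q) (unit_vec 1)\<close>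
  requires.\<close>

lemma Kf_P_q:
  assumes "n \<ge> 1"
  shows "Kf (\<lambda>x. of_real (poly (P q) x)) n (Suc 0) = (if n = q then 1 else 0)"
proof -
  obtain r j where r: "r \<in> {1..q}" "n = r + j * q" by (rule index_decompose[OF assms])
  have "Kf (\<lambda>x. of_real (poly (P q) x)) n (Suc 0) =
      integral\<^sup>L qmeas (\<lambda>\<theta>. \<Sum>c\<in>centers. of_real (poly (P q) (L c \<theta>)) * complex_of_real (kern c n (Suc 0) \<theta>))"
    unfolding Kf_def
    by (subst Bochner_Integration.integral_sum)
       (auto intro!: integrable_integrand[where \<phi> = "\<lambda>x. complex_of_real (poly (P q) x)"] continuous_intros)
  also have "\<dots> = integral\<^sup>L qmeas (\<lambda>\<theta>. complex_of_real (if r = q then 2 / pi * (sin \<theta> * sin (real (Suc j) * \<theta>)) else 0))"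
    unfolding r(2) by (intro Bochner_Integration.integral_cong refl, subst sum_kern[symmetric])
      (use r in \<open>auto simp del: of_nat_Suc\<close>)
  also have "\<dots> = of_real (integral\<^sup>L qmeas (\<lambda>\<theta>. if r = q then 2 / pi * (sin \<theta> * sin (real (Suc j) * \<theta>)) else 0))"
    by (rule integral_complex_of_real)
  also have "integral\<^sup>L qmeas (\<lambda>\<theta>. if r = q then 2 / pi * (sin \<theta> * sin (real (Suc j) * \<theta>)) else 0) =
      (if r = q \<and> j = 0 then 1 else 0)"
    using integral_sin_sin[of "Suc j"] by (cases "r = q") (auto simp del: of_nat_Suc)
  also have "r = q \<and> j = 0 \<longleftrightarrow> n = q" using r by (cases j) auto
  finally show ?thesis by simp
qed

end

section \<open>Spectral representation\<close>

lemma cinner_sums: "(\<lambda>n. cnj (ent u n) * ent v n) sums cinner u v"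
proof -
  have "((\<lambda>n. cnj (ent u n) * ent v n) has_sum cinner u v) {1..}"
    unfolding cinner_def using cinner_summable by (rule has_sum_infsum)
  hence "((\<lambda>n. cnj (ent u n) * ent v n) has_sum cinner u v) UNIV"
    by (rule has_sum_cong_neutral[THEN iffD1, rotated -1]) (auto simp: not_le)
  thus ?thesis by (rule has_sum_imp_sums)
qed

lemma ent_tendsto_0: "ent u \<longlonglongrightarrow> 0"
proof -
  have "(\<lambda>n. cnj (ent u n) * ent u n) \<longlonglongrightarrow> 0"
    using cinner_sums[of u u] by (auto intro: summable_LIMSEQ_zero sums_summable)
  hence "(\<lambda>n. norm (cnj (ent u n) * ent u n)) \<longlonglongrightarrow> 0" by (rule tendsto_norm_zero)
  hence "(\<lambda>n. sqrt (norm (cnj (ent u n) * ent u n))) \<longlonglongrightarrow> sqrt 0" by (rule tendsto_real_sqrt)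
  thus ?thesis by (simp add: norm_mult tendsto_norm_zero_iff)
qed

lemma cinner_scaleR_right: "cinner u (r *\<^sub>R v) = of_real r * cinner u v"
  by (simp add: scaleR_scaleC cinner_scaleC_right)

lemma cinner_add_left: "cinner (u + v) w = cinner u w + cinner v w"
  by (metis cinner_commute cinner_add_right complex_cnj_add)

lemma cinner_diff_left: "cinner (u - v) w = cinner u w - cinner v w"
  by (metis cinner_commute cinner_diff_right complex_cnj_diff)

lemma cinner_scaleR_left: "cinner (r *\<^sub>R u) v = of_real r * cinner u v"
  by (simp add: scaleR_scaleC cinner_scaleC_left)

lemma cinner_0_right [simp]: "cinner u 0 = 0" and cinner_0_left [simp]: "cinner 0 u = 0"
  by (simp_all add: cinner_def)

lemma cinner_self: "cinner u u = of_real ((norm u)\<^sup>2)"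
  using power2_norm_eq_inner[of u] cinner_commute[of u u]
  by (simp add: inner_ell2_def complex_eq_iff)

lemma cmod_cinner_le: "cmod (cinner u v) \<le> norm u * norm v"
proof (cases "cinner u v = 0")
  case False
  define s where "s = cinner u v / of_real (cmod (cinner u v))"
  have s: "cmod s = 1" using False by (simp add: s_def norm_divide)
  have "inner (s *\<^sub>C u) v = Re (cnj s * cinner u v)"
    by (simp add: inner_ell2_def cinner_scaleC_left)
  also have "cnj s * cinner u v = of_real (cmod (cinner u v))"
    using False complex_norm_square[of "cinner u v"]
    by (simp add: s_def divide_simps power2_eq_square mult.commute)
  finally have "cmod (cinner u v) = inner (s *\<^sub>C u) v" by simp
  also have "\<dots> \<le> norm (s *\<^sub>C u) * norm v" by (rule norm_cauchy_schwarz)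
  finally show ?thesis by (simp add: norm_scaleC s)
qed simp

text \<open>The condition \<open>n \<noteq> 0\<close> makes \<open>unit_vec 0\<close> the zero
  vector, so \<open>J_unit_vec\<close> and \<open>polJ_P\<close> include the boundary.\<close>

definition unit_vec :: "nat \<Rightarrow> ell2" where
  "unit_vec m = Ell2 (\<lambda>n. if n = m \<and> n \<noteq> 0 then 1 else 0)"

lemma unit_vec: "ent (unit_vec m) n = (if n = m \<and> n \<noteq> 0 then 1 else 0)" "norm (unit_vec m) \<le> 1"
proof -
  have "(\<Sum>n\<in>F. (cmod (if n = m \<and> n \<noteq> 0 then 1 else 0))\<^sup>2) \<le> 1\<^sup>2" if F: "finite F" "F \<subseteq> {1..}" for F
  proof -
    have "(\<Sum>n\<in>F. (cmod (if n = m \<and> n \<noteq> 0 then 1 else 0))\<^sup>2) \<le> (\<Sum>n\<in>F. if n = m then 1 else 0)"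
      by (intro sum_mono) auto
    also have "\<dots> \<le> 1" using F by simp
    finally show ?thesis by simp
  qed
  note * = Ell2_bounded[of "\<lambda>n. if n = m \<and> n \<noteq> 0 then 1 else 0" 1, OF _ _ this, folded unit_vec_def]
  show "ent (unit_vec m) n = (if n = m \<and> n \<noteq> 0 then 1 else 0)" by (subst *(1)) auto
  show "norm (unit_vec m) \<le> 1" by (rule *(2)) auto
qed

lemma bounded_linear_ent: "bounded_linear (\<lambda>v. ent v n)"
  by (rule bounded_linear_intro[where K = 1]) (auto simp: cmod_ent_le_norm)

text \<open>In the expanded square the term of order \<open>c^2\<close> is absorbed by the term of
  order \<open>c\<close>, because \<open>c * M^2 \<le> 1\<close>. This takes the place of the
  functional calculus for \<open>1 - c * A^2\<close>.\<close>

lemma one_minus_square_contraction: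
  fixes A :: "'a::real_inner \<Rightarrow> 'a"
  assumes sym: "\<And>u v. inner (A u) v = inner u (A v)" and M: "\<And>v. norm (A v) \<le> M * norm v"
    and c: "0 \<le> c" "c * M\<^sup>2 \<le> 1"
  shows "norm (v - c *\<^sub>R A (A v)) \<le> norm v"
proof (rule power2_le_imp_le)
  have "(norm (v - c *\<^sub>R A (A v)))\<^sup>2 = (norm v)\<^sup>2 - 2 * c * (norm (A v))\<^sup>2 + c\<^sup>2 * (norm (A (A v)))\<^sup>2"
    unfolding power2_norm_eq_inner
    by (simp add: inner_diff_left inner_diff_right sym power2_eq_square inner_commute algebra_simps)
  also have "c\<^sup>2 * (norm (A (A v)))\<^sup>2 \<le> c\<^sup>2 * (M * norm (A v))\<^sup>2"
    by (intro mult_left_mono power_mono M) auto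
  also have "\<dots> = c * (c * M\<^sup>2) * (norm (A v))\<^sup>2" by (simp add: power2_eq_square)
  also have "\<dots> \<le> c * 1 * (norm (A v))\<^sup>2"
    using c by (intro mult_right_mono mult_left_mono) auto
  finally show "(norm (v - c *\<^sub>R A (A v)))\<^sup>2 \<le> (norm v)\<^sup>2"
    using mult_nonneg_nonneg[OF c(1) zero_le_power2[of "norm (A v)"]] by linarith
qed simp

section \<open>Polynomials in the Jacobi operator and their matrix entries\<close>

locale jacobi_operator = jacobi_coeffs +
  fixes J :: "ell2 \<Rightarrow>\<^sub>L ell2"
  assumes J: "jacobi_op a b J"
begin

lemma ent_J: "ent (J v) (Suc n) =
    of_real (a n) * ent v n + of_real (b (Suc n)) * ent v (Suc n) + of_real (a (Suc n)) * ent v (Suc (Suc n))"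
proof (cases n)
  case 0
  thus ?thesis using J by (simp add: jacobi_op_def numeral_2_eq_2)
next
  case (Suc k)
  thus ?thesis using J by (auto simp: jacobi_op_def)
qed

lemma J_eqI: "(\<And>n. ent u (Suc n) = ent v (Suc n)) \<Longrightarrow> u = v"
  by (rule ell2_eqI) (metis One_nat_def Suc_le_D)

lemma J_scaleC: "J (c *\<^sub>C v) = c *\<^sub>C J v"
  by (rule J_eqI) (simp add: ent_J algebra_simps)

lemma a_bounded: "\<exists>K>0. \<forall>n. a n \<le> K"
proof -
  have "a n = a (n mod q)" for n
  proof (induction n rule: less_induct)
    case (less n)
    show ?case
    proof (cases "n < q")
      case False
      hence "a (n - q) = a ((n - q) mod q)" using q_pos by (intro less.IH) auto
      thus ?thesis using False a_per[of "n - q"] by (simp add: le_mod_geq)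
    qed simp
  qed
  hence "a n \<le> (\<Sum>k<q. a k)" for n
    using q_pos a_pos by (metis (no_types, lifting) finite_lessThan lessThan_iff less_eq_real_def member_le_sum mod_less_divisor Suc_le_eq One_nat_def)
  moreover have "0 < (\<Sum>k<q. a k)" using q_pos a_pos by (intro sum_pos) (auto simp: lessThan_empty_iff)
  ultimately show ?thesis by blast
qed

text \<open>Partial sums of the difference telescope to the boundary term \<open>W n\<close>, which
  tends to 0 because \<open>a\<close> is bounded and the entries tend to 0.\<close>

lemma J_symmetric: "cinner (J u) v = cinner u (J v)"
proof -
  obtain K where K: "\<And>n. a n \<le> K" using a_bounded by blast
  define W where "W n = of_real (a n) * (cnj (ent u (Suc n)) * ent v n - cnj (ent u n) * ent v (Suc n))" for n
  have W: "(\<Sum>k<Suc n. cnj (ent (J u) k) * ent v k - cnj (ent u k) * ent (J v) k) = W n" for n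
  proof (induction n)
    case 0
    show ?case by (simp add: W_def)
  next
    case (Suc n)
    have "(\<Sum>k<Suc (Suc n). cnj (ent (J u) k) * ent v k - cnj (ent u k) * ent (J v) k) =
        W n + (cnj (ent (J u) (Suc n)) * ent v (Suc n) - cnj (ent u (Suc n)) * ent (J v) (Suc n))"
      by (subst sum.lessThan_Suc) (simp only: Suc.IH)
    also have "\<dots> = W (Suc n)" unfolding ent_J W_def by (simp add: algebra_simps)
    finally show ?case .
  qed
  have "(\<lambda>n. cnj (ent u (Suc n)) * ent v n - cnj (ent u n) * ent v (Suc n)) \<longlonglongrightarrow> cnj 0 * 0 - cnj 0 * 0"
    by (intro tendsto_intros ent_tendsto_0 LIMSEQ_Suc)
  hence lim: "(\<lambda>n. cnj (ent u (Suc n)) * ent v n - cnj (ent u n) * ent v (Suc n)) \<longlonglongrightarrow> 0" by simp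
  have "W \<longlonglongrightarrow> 0"
  proof (rule tendsto_0_le[OF lim, of _ K], rule always_eventually, rule allI)
    fix n
    show "norm (W n) \<le> norm (cnj (ent u (Suc n)) * ent v n - cnj (ent u n) * ent v (Suc n)) * K"
      unfolding W_def norm_mult[of "of_real (a n)"] mult.commute[of _ K]
      using K[of n] a_pos[of n] by (intro mult_right_mono) auto
  qed
  moreover have "(\<lambda>n. \<Sum>k<Suc n. cnj (ent (J u) k) * ent v k - cnj (ent u k) * ent (J v) k)
      \<longlonglongrightarrow> cinner (J u) v - cinner u (J v)"
    using sums_diff[OF cinner_sums[of "J u" v] cinner_sums[of u "J v"]]
    unfolding sums_def by (rule LIMSEQ_Suc)
  ultimately have "cinner (J u) v - cinner u (J v) = 0"
    unfolding W by (metis LIMSEQ_unique)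
  thus ?thesis by simp
qed

text \<open>Horner's scheme for a polynomial in \<open>J\<close>; real coefficients keep it
  symmetric.\<close>

definition polJ :: "real poly \<Rightarrow> ell2 \<Rightarrow> ell2" where
  "polJ h v = fold_coeffs (\<lambda>c w. c *\<^sub>R v + J w) h 0"

lemma polJ_0 [simp]: "polJ 0 v = 0" by (simp add: polJ_def)

lemma polJ_pCons [simp]: "polJ (pCons c h) v = c *\<^sub>R v + J (polJ h v)"
  by (cases "h = 0"; cases "c = 0") (simp_all add: polJ_def blinfun.zero_right)

lemma polJ_1 [simp]: "polJ 1 v = v"
  by (simp add: one_pCons blinfun.zero_right)

lemma polJ_add: "polJ (g + h) v = polJ g v + polJ h v"
proof (induction g arbitrary: h)
  case (pCons c g)
  show ?case
  proof (cases h)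
    fix d k assume "h = pCons d k"
    thus ?thesis by (simp add: pCons.IH blinfun.add_right algebra_simps)
  qed
qed simp

lemma polJ_smult: "polJ (smult c h) v = c *\<^sub>R polJ h v"
  by (induction h) (auto simp: blinfun.scaleR_right algebra_simps)

lemma polJ_diff: "polJ (g - h) v = polJ g v - polJ h v"
  using polJ_add[of "g - h" h v] by simp

lemma polJ_sum: "polJ (\<Sum>i\<in>I. h i) v = (\<Sum>i\<in>I. polJ (h i) v)"
  by (induction I rule: infinite_finite_induct) (auto simp: polJ_add)

lemma polJ_vec_add: "polJ h (u + v) = polJ h u + polJ h v"
  by (induction h) (auto simp: blinfun.add_right algebra_simps)

lemma polJ_vec_scaleR: "polJ h (c *\<^sub>R v) = c *\<^sub>R polJ h v"
  by (induction h) (auto simp: blinfun.scaleR_right algebra_simps)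

lemma polJ_vec_diff: "polJ h (u - v) = polJ h u - polJ h v"
  using polJ_vec_add[of h "u - v" v] by simp

lemma polJ_vec_0 [simp]: "polJ h 0 = 0"
  using polJ_vec_scaleR[of h 0 0] by simp

lemma polJ_J: "polJ h (J v) = J (polJ h v)"
  by (induction h) (auto simp: blinfun.add_right blinfun.scaleR_right blinfun.zero_right)

lemma polJ_mult: "polJ (g * h) v = polJ g (polJ h v)"
  by (induction g) (auto simp: polJ_add polJ_smult)

lemma polJ_symmetric: "cinner (polJ h u) v = cinner u (polJ h v)"
  by (induction h arbitrary: u v)
     (auto simp: cinner_add_left cinner_add_right cinner_scaleR_left cinner_scaleR_right J_symmetric polJ_J)

lemma polJ_bounded: "\<exists>M\<ge>0. \<forall>v. norm (polJ h v) \<le> M * norm v"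
proof (induction h)
  case 0
  show ?case by auto
next
  case (pCons c h)
  then obtain M where M: "M \<ge> 0" "\<And>v. norm (polJ h v) \<le> M * norm v" by blast
  have "norm (polJ (pCons c h) v) \<le> (\<bar>c\<bar> + norm J * M) * norm v" for v
  proof -
    have "norm (polJ (pCons c h) v) \<le> \<bar>c\<bar> * norm v + norm J * norm (polJ h v)"
      unfolding polJ_pCons by (rule order.trans[OF norm_triangle_ineq]) (intro add_mono norm_blinfun, simp)
    also have "norm J * norm (polJ h v) \<le> norm J * (M * norm v)"
      by (intro mult_left_mono M) auto
    finally show ?thesis by (simp add: algebra_simps)
  qed
  thus ?case using M(1) by (intro exI[of _ "\<bar>c\<bar> + norm J * M"]) auto
qed

lemma unit_vec_0: "unit_vec 0 = 0"
  by (rule ell2_eqI) (simp add: unit_vec)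

lemma J_unit_vec: "J (unit_vec (Suc n)) =
    a n *\<^sub>R unit_vec n + b (Suc n) *\<^sub>R unit_vec (Suc n) + a (Suc n) *\<^sub>R unit_vec (Suc (Suc n))"
proof (rule J_eqI)
  fix k
  consider "k = n" | "Suc k = n" | "k = Suc n" | "k \<noteq> n" "Suc k \<noteq> n" "k \<noteq> Suc n" by blast
  thus "ent (J (unit_vec (Suc n))) (Suc k) = ent (a n *\<^sub>R unit_vec n + b (Suc n) *\<^sub>R unit_vec (Suc n) + a (Suc n) *\<^sub>R unit_vec (Suc (Suc n))) (Suc k)"
    unfolding ent_J by cases (auto simp: unit_vec scaleR_conv_of_real)
qed

text \<open>The first unit vector is cyclic and the \<open>P n\<close> are its orthonormal
  polynomials.\<close>

lemma polJ_P: "polJ (P n) (unit_vec (Suc 0)) = unit_vec n"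
proof -
  have "polJ (P n) (unit_vec (Suc 0)) = unit_vec n \<and> polJ (P (Suc n)) (unit_vec (Suc 0)) = unit_vec (Suc n)"
  proof (induction n)
    case 0
    show ?case by (simp add: unit_vec_0)
  next
    case (Suc n)
    have "a (Suc n) *\<^sub>R polJ (P (Suc (Suc n))) (unit_vec (Suc 0)) =
        polJ (smult (a (Suc n)) (P (Suc (Suc n)))) (unit_vec (Suc 0))"
      by (simp add: polJ_smult)
    also have "smult (a (Suc n)) (P (Suc (Suc n))) = [:- b (Suc n), 1:] * P (Suc n) - smult (a n) (P n)"
      using solution_P unfolding solution_def by metis
    also have "polJ \<dots> (unit_vec (Suc 0)) = - b (Suc n) *\<^sub>R unit_vec (Suc n) + J (unit_vec (Suc n)) - a n *\<^sub>R unit_vec n"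
      unfolding polJ_diff polJ_mult polJ_smult Suc[THEN conjunct1] Suc[THEN conjunct2]
      by (simp add: blinfun.zero_right)
    also have "\<dots> = a (Suc n) *\<^sub>R unit_vec (Suc (Suc n))" by (simp add: J_unit_vec)
    finally show ?case using Suc by simp
  qed
  thus ?thesis ..
qed

lemma continuous_of_real_poly: "continuous_on A (\<lambda>x. complex_of_real (poly h x))"
  by (intro continuous_intros)

text \<open>Induction on \<open>h\<close>: the constant coefficient contributes the entries from
  \<open>Kf_P_q\<close>, and the factor \<open>x\<close> is matched with \<open>J\<close> by
  \<open>Kf_recurrence\<close>.\<close>

lemma polJ_P_q_entry: "ent (polJ (h * P q) (unit_vec (Suc 0))) n = Kf (\<lambda>x. of_real (poly (h * P q) x)) n (Suc 0)"
proof (induction h arbitrary: n)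
  case 0
  thus ?case by (simp add: Kf_def)
next
  case (pCons c h)
  show ?case
  proof (cases n)
    case (Suc k)
    have "Kf (\<lambda>x. of_real (poly (pCons c h * P q) x)) n (Suc 0) =
        Kf (\<lambda>x. of_real c * of_real (poly (P q) x) + of_real x * of_real (poly (h * P q) x)) n (Suc 0)"
      by (rule Kf_cong) (simp add: algebra_simps)
    also have "\<dots> = of_real c * Kf (\<lambda>x. of_real (poly (P q) x)) n (Suc 0)
        + Kf (\<lambda>x. of_real x * of_real (poly (h * P q) x)) n (Suc 0)"
      by (subst Kf_add) (auto intro!: continuous_intros simp: Kf_cmult)
    also have "Kf (\<lambda>x. of_real (poly (P q) x)) n (Suc 0) = ent (unit_vec q) n"
      using Kf_P_q[of n] Suc by (simp add: unit_vec)
    also have "Kf (\<lambda>x. of_real x * of_real (poly (h * P q) x)) n (Suc 0) =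
        ent (J (polJ (h * P q) (unit_vec (Suc 0)))) n"
      unfolding Suc ent_J by (subst Kf_recurrence) (auto intro: continuous_of_real_poly simp only: pCons.IH)
    also have "of_real c * ent (unit_vec q) n + ent (J (polJ (h * P q) (unit_vec (Suc 0)))) n =
        ent (polJ (pCons c h * P q) (unit_vec (Suc 0))) n"
      by (simp add: polJ_mult polJ_P polJ_add polJ_smult scaleR_conv_of_real)
    finally show ?thesis by simp
  qed simp
qed

text \<open>\<open>Kf\<close> carries only the absolutely continuous part; the factor
  \<open>P q\<close> removes the point part on the other side.\<close>

lemma polJ_entry:
  assumes "P q dvd h"
  shows "ent (polJ h (unit_vec m)) n = Kf (\<lambda>x. of_real (poly h x)) n m"
proof -
  obtain g where g: "h = P q * g" using assms by (elim dvdE)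
  have "polJ h (unit_vec m) = polJ ((g * P m) * P q) (unit_vec (Suc 0))"
    by (simp add: g polJ_P[symmetric, of m] polJ_mult[symmetric] mult_ac)
  also have "ent \<dots> n = Kf (\<lambda>x. of_real (poly ((g * P m) * P q) x)) n (Suc 0)"
    by (rule polJ_P_q_entry)
  also have "\<dots> = Kf (\<lambda>x. of_real (poly (P m) x) * of_real (poly h x)) n (Suc 0)"
    by (rule Kf_cong) (simp add: g)
  also have "\<dots> = Kf (\<lambda>x. of_real (poly h x)) n m" by (rule Kf_swap_P)
  finally show ?thesis .
qed

end

section \<open>Weak limits, eigenvectors and the absolutely continuous part of a unit vector\<close>

lemma cinner_unit_vec: "cinner (unit_vec n) v = ent v n"
proof -
  have "(\<lambda>k. cnj (ent (unit_vec n) k) * ent v k) = (\<lambda>k. if k = n then ent v k else 0)"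
    by (auto simp: unit_vec)
  moreover have "(\<lambda>k. if k = n then ent v k else 0) sums ent v n" by (rule sums_single)
  ultimately show ?thesis using sums_unique2[OF cinner_sums[of "unit_vec n" v]] by simp
qed

lemma norm_sums: "(\<lambda>n. (cmod (ent v n))\<^sup>2) sums (norm v)\<^sup>2"
proof -
  have "(\<lambda>n. cnj (ent v n) * ent v n) = (\<lambda>n. of_real ((cmod (ent v n))\<^sup>2))"
    by (simp only: complex_norm_square mult.commute)
  thus ?thesis using cinner_sums[of v v] unfolding cinner_self by (simp only: sums_of_real_iff)
qed

lemma ent_sum: "ent (\<Sum>i\<in>I. f i) n = (\<Sum>i\<in>I. ent (f i) n)"
  by (induction I rule: infinite_finite_induct) auto

lemma unit_vec_expansion: "(\<lambda>n. ent v n *\<^sub>C unit_vec n) sums v"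
proof -
  define d where "d N = v - (\<Sum>n<N. ent v n *\<^sub>C unit_vec n)" for N
  have ent_d: "ent (d N) k = (if k < N then 0 else ent v k)" for N k
  proof -
    have "(\<Sum>n<N. ent v n * ent (unit_vec n) k) = (\<Sum>n<N. if n = k then ent v k else 0)"
      by (intro sum.cong) (auto simp: unit_vec)
    thus ?thesis by (simp add: d_def ent_sum)
  qed
  have "(norm (d N))\<^sup>2 = (norm v)\<^sup>2 - (\<Sum>n<N. (cmod (ent v n))\<^sup>2)" for N
  proof -
    have "(\<lambda>n. (cmod (ent v n))\<^sup>2 - (cmod (ent (d N) n))\<^sup>2) sums (\<Sum>n<N. (cmod (ent v n))\<^sup>2 - (cmod (ent (d N) n))\<^sup>2)"
      by (rule sums_finite) (auto simp: ent_d)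
    moreover have "(\<Sum>n<N. (cmod (ent v n))\<^sup>2 - (cmod (ent (d N) n))\<^sup>2) = (\<Sum>n<N. (cmod (ent v n))\<^sup>2)"
      by (intro sum.cong) (auto simp: ent_d)
    ultimately show ?thesis
      using sums_unique2[OF sums_diff[OF norm_sums[of v] norm_sums[of "d N"]]] by fastforce
  qed
  moreover have "(\<lambda>N. (norm v)\<^sup>2 - (\<Sum>n<N. (cmod (ent v n))\<^sup>2)) \<longlonglongrightarrow> (norm v)\<^sup>2 - (norm v)\<^sup>2"
    using norm_sums[of v] unfolding sums_def by (intro tendsto_intros)
  ultimately have "(\<lambda>N. sqrt ((norm (d N))\<^sup>2)) \<longlonglongrightarrow> sqrt 0" by (intro tendsto_real_sqrt) simp
  hence "d \<longlonglongrightarrow> 0" by (simp add: tendsto_norm_zero_iff)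
  hence "(\<lambda>N. v - d N) \<longlonglongrightarrow> v - 0" by (intro tendsto_intros)
  thus ?thesis by (simp add: sums_def d_def)
qed

text \<open>Truncating \<open>v\<close> leaves a finite sum of entries and an error controlled by
  the norm bound.\<close>

lemma weak_null:
  assumes bd: "\<And>k. norm (x k) \<le> K" and ent: "\<And>n. (\<lambda>k. ent (x k) n) \<longlonglongrightarrow> 0"
  shows "(\<lambda>k. cinner v (x k)) \<longlonglongrightarrow> 0"
proof (rule LIMSEQ_I)
  fix e :: real assume e: "e > 0"
  have K0: "K \<ge> 0" using order.trans[OF norm_ge_zero bd] .
  define s where "s N = (\<Sum>n<N. ent v n *\<^sub>C unit_vec n)" for N
  have "s \<longlonglongrightarrow> v" using unit_vec_expansion[of v] by (simp add: sums_def s_def[abs_def])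
  then obtain N where "norm (s N - v) < e / (2 * (K + 1))"
    using e K0 LIMSEQ_D[of s v "e / (2 * (K + 1))"] by auto
  hence N: "norm (v - s N) * (K + 1) < e / 2"
    using K0 by (simp add: norm_minus_commute field_simps)
  have sc: "cinner (s N) w = (\<Sum>n<N. cnj (ent v n) * ent w n)" for w
    unfolding s_def by (induction N) (auto simp: cinner_add_left cinner_scaleC_left cinner_unit_vec)
  have "(\<lambda>k. cinner (s N) (x k)) \<longlonglongrightarrow> (\<Sum>n<N. cnj (ent v n) * 0)"
    unfolding sc by (intro tendsto_intros ent)
  then obtain k0 where k0: "\<And>k. k \<ge> k0 \<Longrightarrow> cmod (cinner (s N) (x k)) < e / 2"
    using e LIMSEQ_D[of "\<lambda>k. cinner (s N) (x k)" 0 "e / 2"] by auto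
  have "norm (cinner v (x k) - 0) < e" if "k \<ge> k0" for k
  proof -
    have "cinner v (x k) = cinner (s N) (x k) + cinner (v - s N) (x k)"
      by (simp add: cinner_diff_left)
    hence "cmod (cinner v (x k)) \<le> cmod (cinner (s N) (x k)) + cmod (cinner (v - s N) (x k))"
      by (simp add: norm_triangle_ineq)
    also have "cmod (cinner (v - s N) (x k)) \<le> norm (v - s N) * norm (x k)" by (rule cmod_cinner_le)
    also have "\<dots> \<le> norm (v - s N) * (K + 1)" using bd[of k] by (intro mult_left_mono) auto
    finally show ?thesis using N k0[OF that] by simp
  qed
  thus "\<exists>k0. \<forall>k\<ge>k0. norm (cinner v (x k) - 0) < e" by blast
qed

context jacobi_operator
begin

lemma polJ_symmetric_inner: "inner (polJ h u) v = inner u (polJ h v)"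
  by (simp add: inner_ell2_def polJ_symmetric)

lemma damping:
  "\<exists>k>0. (\<forall>v. norm (v - k *\<^sub>R polJ g (polJ g v)) \<le> norm v) \<and>
     (\<forall>c\<in>centers. \<forall>\<theta>\<in>{0<..<pi}. k * (poly g (L c \<theta>))\<^sup>2 \<le> 1)"
proof -
  obtain M where M: "M \<ge> 0" "\<And>v. norm (polJ g v) \<le> M * norm v" using polJ_bounded by blast
  obtain K where K: "K > 0" "\<And>c \<theta>. c \<in> centers \<Longrightarrow> \<theta> \<in> {0<..<pi} \<Longrightarrow> norm (complex_of_real (poly g (L c \<theta>))) \<le> K"
    by (rule bounded_on_bands[OF continuous_of_real_poly]) blast
  \<comment> \<open>One constant for two demands: \<open>k * M\<^sup>2 \<le> 1\<close> for the
    contraction and \<open>k * K\<^sup>2 \<le> 1\<close> on the bands.\<close>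
  define k where "k = 1 / (M\<^sup>2 + K\<^sup>2)"
  have k: "k > 0" using K(1) by (simp add: k_def add_nonneg_pos)
  have "k * M\<^sup>2 \<le> 1" using K(1) by (simp add: k_def divide_simps add_nonneg_pos)
  hence "norm (v - k *\<^sub>R polJ g (polJ g v)) \<le> norm v" for v
    using k M by (intro one_minus_square_contraction) (auto simp: polJ_symmetric_inner)
  moreover have "k * (poly g (L c \<theta>))\<^sup>2 \<le> 1" if "c \<in> centers" "\<theta> \<in> {0<..<pi}" for c \<theta>
  proof -
    have "(poly g (L c \<theta>))\<^sup>2 \<le> K\<^sup>2" using K(2)[OF that] power_mono[of "\<bar>poly g (L c \<theta>)\<bar>" K 2] by simp
    hence "k * (poly g (L c \<theta>))\<^sup>2 \<le> k * K\<^sup>2" using k by (intro mult_left_mono) auto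
    also have "\<dots> \<le> 1" using K(1) by (simp add: k_def divide_simps add_nonneg_pos)
    finally show ?thesis .
  qed
  ultimately show ?thesis using k by blast
qed

lemma polJ_damping: "polJ (1 - smult k (g\<^sup>2)) v = v - k *\<^sub>R polJ g (polJ g v)"
  by (simp add: polJ_diff polJ_smult polJ_mult power2_eq_square)

lemma damping_power_norm:
  assumes "\<And>v. norm (v - k *\<^sub>R polJ g (polJ g v)) \<le> norm v"
  shows "norm (polJ ((1 - smult k (g\<^sup>2)) ^ i) v) \<le> norm v"
proof (induction i)
  case (Suc i)
  have "polJ ((1 - smult k (g\<^sup>2)) ^ Suc i) v = polJ (1 - smult k (g\<^sup>2)) (polJ ((1 - smult k (g\<^sup>2)) ^ i) v)"
    by (simp only: power_Suc polJ_mult)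
  thus ?case using order.trans[OF assms Suc] by (simp only: polJ_damping)
qed simp

text \<open>The absolutely continuous part of \<open>unit_vec m\<close>, prescribed by its entries;
  square-summability is established in lemma \<open>Kvec\<close>.\<close>

definition Kvec :: "nat \<Rightarrow> ell2" where "Kvec m = Ell2 (\<lambda>n. Kf (\<lambda>_. 1) n m)"

text \<open>
  \<open>Kvec m\<close> is the weak limit of \<open>(1 - (1 - k P\<^sub>q(J)\<^sup>2)\<^sup>i) \<delta>\<^sub>m\<close>. The polynomials involved
  are divisible by \<open>P\<^sub>q\<close>, so that the point part of the spectral measure does not contribute.
\<close>

lemma Kvec: "ent (Kvec m) n = Kf (\<lambda>_. 1) n m" "norm (Kvec m) \<le> 2"
proof -
  obtain k where k: "k > 0" "\<And>v. norm (v - k *\<^sub>R polJ (P q) (polJ (P q) v)) \<le> norm v"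
    "\<And>c \<theta>. c \<in> centers \<Longrightarrow> \<theta> \<in> {0<..<pi} \<Longrightarrow> k * (poly (P q) (L c \<theta>))\<^sup>2 \<le> 1"
    using damping[of "P q"] by blast
  define g where "g i = 1 - (1 - smult k ((P q)\<^sup>2)) ^ i" for i :: nat
  have dvd: "P q dvd g i" for i
  proof -
    have "1 - (1 - smult k ((P q)\<^sup>2)) dvd 1 - (1 - smult k ((P q)\<^sup>2)) ^ i"
      by (simp only: one_diff_power_eq dvd_triv_left)
    moreover have "P q dvd 1 - (1 - smult k ((P q)\<^sup>2))"
      by (simp add: power2_eq_square dvd_smult)
    ultimately show ?thesis unfolding g_def by (rule dvd_trans[rotated])
  qed
  have y: "0 < k * (poly (P q) (L c \<theta>))\<^sup>2" if "c \<in> centers" "\<theta> \<in> {0<..<pi}" for c \<theta>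
  proof -
    have "poly (P q) (L c \<theta>) \<noteq> 0" using weight_pos[OF that] by (auto simp: weight_def)
    thus ?thesis using k(1) by simp
  qed
  have polyg: "poly (g i) x = 1 - (1 - k * (poly (P q) x)\<^sup>2) ^ i" for i x
    by (simp add: g_def)
  have norm: "norm (polJ (g i) (unit_vec m)) \<le> 2" for i
  proof -
    have "norm (polJ (g i) (unit_vec m)) \<le> norm (unit_vec m) + norm (polJ ((1 - smult k ((P q)\<^sup>2)) ^ i) (unit_vec m))"
      unfolding g_def polJ_diff polJ_1 by (rule norm_triangle_ineq4)
    also have "\<dots> \<le> 1 + 1"
      by (intro add_mono unit_vec(2) order.trans[OF damping_power_norm[OF k(2)] unit_vec(2)])
    finally show ?thesis by simp
  qed
  have lim: "(\<lambda>i. ent (polJ (g i) (unit_vec m)) n) \<longlonglongrightarrow> Kf (\<lambda>_. 1) n m" for n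
    unfolding polJ_entry[OF dvd]
  proof (rule Kf_dominated[where K = 1])
    fix c \<theta> i assume c: "c \<in> centers" "\<theta> \<in> {0<..<pi}"
    have "0 \<le> (1 - k * (poly (P q) (L c \<theta>))\<^sup>2) ^ i" "(1 - k * (poly (P q) (L c \<theta>))\<^sup>2) ^ i \<le> 1"
      using y[OF c] k(3)[OF c] by (auto intro!: power_le_one)
    thus "norm (complex_of_real (poly (g i) (L c \<theta>))) \<le> 1" by (simp add: polyg del: of_real_diff)
  next
    fix c assume c: "c \<in> centers"
    show "AE \<theta> in qmeas. (\<lambda>i. complex_of_real (poly (g i) (L c \<theta>))) \<longlonglongrightarrow> 1"
    proof (rule AE_I2)
      fix \<theta> assume "\<theta> \<in> space qmeas"
      hence \<theta>: "\<theta> \<in> {0<..<pi}" by simp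
      have "(\<lambda>i. (1 - k * (poly (P q) (L c \<theta>))\<^sup>2) ^ i) \<longlonglongrightarrow> 0"
        using y[OF c \<theta>] k(3)[OF c \<theta>] by (intro LIMSEQ_power_zero) auto
      hence "(\<lambda>i. complex_of_real (1 - (1 - k * (poly (P q) (L c \<theta>))\<^sup>2) ^ i)) \<longlonglongrightarrow> of_real (1 - 0)"
        by (rule tendsto_of_real[OF tendsto_diff[OF tendsto_const]])
      thus "(\<lambda>i. complex_of_real (poly (g i) (L c \<theta>))) \<longlonglongrightarrow> 1"
        by (simp only: polyg diff_zero of_real_1)
    qed
  qed (intro continuous_intros)+
  \<comment> \<open>Bounds on finite sums survive the entrywise limit, which gives
    square-summability and the norm bound at once.\<close>
  have fin: "(\<Sum>n\<in>F. (cmod (Kf (\<lambda>_. 1) n m))\<^sup>2) \<le> 2\<^sup>2" if F: "finite F" "F \<subseteq> {1..}" for F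
  proof (rule LIMSEQ_le_const2)
    show "(\<lambda>i. \<Sum>n\<in>F. (cmod (ent (polJ (g i) (unit_vec m)) n))\<^sup>2) \<longlonglongrightarrow> (\<Sum>n\<in>F. (cmod (Kf (\<lambda>_. 1) n m))\<^sup>2)"
      by (intro tendsto_intros lim)
    have "(\<Sum>n\<in>F. (cmod (ent (polJ (g i) (unit_vec m)) n))\<^sup>2) \<le> 2\<^sup>2" for i
      using finite_sum_le_norm[OF F, of "polJ (g i) (unit_vec m)"] power_mono[OF norm[of i], of 2] by simp
    thus "\<exists>N. \<forall>i\<ge>N. (\<Sum>n\<in>F. (cmod (ent (polJ (g i) (unit_vec m)) n))\<^sup>2) \<le> 2\<^sup>2" by blast
  qed
  note * = Ell2_bounded[of "\<lambda>n. Kf (\<lambda>_. 1) n m" 2, OF _ _ fin, folded Kvec_def]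
  show "ent (Kvec m) n = Kf (\<lambda>_. 1) n m" by (subst *(1)) auto
  show "norm (Kvec m) \<le> 2" by (rule *(2)) auto
qed

text \<open>\<open>Kvec m\<close> carries no point part, so the representation holds for every
  polynomial.\<close>

lemma polJ_Kvec: "ent (polJ h (Kvec m)) n = Kf (\<lambda>x. of_real (poly h x)) n m"
proof (induction h arbitrary: n)
  case 0
  thus ?case by (simp add: Kf_def)
next
  case (pCons c h)
  show ?case
  proof (cases n)
    case (Suc k)
    have "Kf (\<lambda>x. of_real (poly (pCons c h) x)) n m =
        Kf (\<lambda>x. of_real c * 1 + of_real x * of_real (poly h x)) n m"
      by (rule Kf_cong) simp
    also have "\<dots> = of_real c * Kf (\<lambda>_. 1) n m + Kf (\<lambda>x. of_real x * of_real (poly h x)) n m"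
      by (subst Kf_add) (auto intro!: continuous_intros simp only: Kf_cmult)
    also have "Kf (\<lambda>x. of_real x * of_real (poly h x)) n m = ent (J (polJ h (Kvec m))) n"
      unfolding Suc ent_J by (subst Kf_recurrence) (auto intro: continuous_of_real_poly simp only: pCons.IH)
    finally show ?thesis by (simp add: Kvec(1) scaleR_conv_of_real)
  qed simp
qed

lemma residual_annihilated: "polJ (P q) (unit_vec m - Kvec m) = 0"
  by (rule ell2_eqI) (simp add: polJ_vec_diff polJ_entry polJ_Kvec)

text \<open>Interpolating 1 at the simple real roots of \<open>P q\<close> splits \<open>v\<close>
  into pieces \<open>l x (J) v\<close>, each annihilated by \<open>J - x\<close>.\<close>

lemma annihilated_in_span:
  assumes "polJ (P q) v = 0"
  shows "v \<in> ell2.span (eigenvectors J)"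
\<comment> \<open>For \<open>q = 1\<close> there are no roots to interpolate at, but then
  \<open>P q = 1\<close> and \<open>v = 0\<close>.\<close>
proof (cases "q = 1")
  case True
  hence "P q = 1" by simp
  thus ?thesis using assms ell2.span_zero by simp
next
  case False
  define R where "R = {x. poly (P q) x = 0}"
  have deg: "degree (P q) = q - 1" using degree_P_eq[of "q - 1"] q_pos by simp
  have nz: "P q \<noteq> 0" using deg False q_pos by auto
  have R: "finite R" "card R = degree (P q)" "\<And>x. x \<in> R \<Longrightarrow> poly (P q) x = 0"
    using poly_roots_finite[OF nz] card_roots_P_q deg by (auto simp: R_def)
  define l where "l x = smult (lead_coeff (P q)) (\<Prod>y\<in>R - {x}. [:-y, 1:])" for x
  define s where "s x = poly 1 x / poly (pderiv (P q)) x" for x :: real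
  have one: "1 = (\<Sum>x\<in>R. smult (s x) (l x))"
    unfolding s_def l_def by (rule lagrange_interpolation[OF R]) (use deg False q_pos in auto)
  have "polJ (l x) v \<in> ell2.span (eigenvectors J)" if x: "x \<in> R" for x
  proof (cases "polJ (l x) v = 0")
    case False
    have "[:-x, 1:] * l x = smult (lead_coeff (P q)) (\<Prod>y\<in>R. [:-y, 1:])"
      unfolding l_def mult_smult_right prod.remove[OF R(1) x] ..
    also have "\<dots> = P q" by (rule poly_eq_prod_roots[OF R, symmetric])
    finally have "[:-x, 1:] * l x = P q" .
    hence "polJ [:-x, 1:] (polJ (l x) v) = 0" using assms by (metis polJ_mult)
    hence "J (polJ (l x) v) = x *\<^sub>R polJ (l x) v" by (simp add: blinfun.zero_right)
    hence "polJ (l x) v \<in> eigenvectors J"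
      using False unfolding eigenvectors_def scaleR_scaleC by blast
    thus ?thesis by (rule ell2.span_base)
  qed (simp add: ell2.span_zero)
  hence "(\<Sum>x\<in>R. of_real (s x) *\<^sub>C polJ (l x) v) \<in> ell2.span (eigenvectors J)"
    by (intro ell2.span_sum ell2.span_scale)
  moreover have "v = polJ (\<Sum>x\<in>R. smult (s x) (l x)) v" by (simp flip: one)
  hence "v = (\<Sum>x\<in>R. of_real (s x) *\<^sub>C polJ (l x) v)"
    by (simp add: polJ_sum polJ_smult scaleR_scaleC)
  ultimately show ?thesis by simp
qed

lemma AE_L_neq:
  assumes "c \<in> centers"
  shows "AE \<theta> in qmeas. L c \<theta> \<noteq> x"
proof (cases "\<exists>\<theta>\<in>{0<..<pi}. L c \<theta> = x")
  case True
  then obtain \<theta>0 where \<theta>0: "\<theta>0 \<in> {0<..<pi}" "L c \<theta>0 = x" by blast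
  have "AE \<theta> in lebesgue. \<theta> \<noteq> \<theta>0"
    using AE_lborel_singleton[of \<theta>0] by (rule AE_completion)
  hence "AE \<theta> in lebesgue. \<theta> \<in> {0<..<pi} \<longrightarrow> L c \<theta> \<noteq> x"
    by eventually_elim (use L_inj[OF assms] \<theta>0 in blast)
  thus ?thesis by (subst AE_restrict_space_iff) auto
qed (auto intro!: AE_I2)

text \<open>The powers \<open>f i\<close> fix the eigenvector, while on the bands they tend to 0 at
  every energy other than the eigenvalue. Symmetry moves them from one side of the inner product to
  the other.\<close>

lemma cinner_eigenvector_Kvec:
  assumes "v \<in> eigenvectors J"
  shows "cinner v (Kvec m) = 0"
proof -
  obtain z where v: "v \<noteq> 0" "J v = z *\<^sub>C v" using assms by (auto simp: eigenvectors_def)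
  have "cnj z * cinner v v = z * cinner v v"
    using J_symmetric[of v v] by (simp add: v cinner_scaleC_left cinner_scaleC_right)
  hence "cnj z = z" using v(1) by (simp add: cinner_self)
  then obtain x where x: "z = of_real x" by (metis Reals_cnj_iff Reals_cases)
  have Jv: "J v = x *\<^sub>R v" by (simp add: v(2) x scaleR_scaleC)
  define g where "g = [:- x, 1:]"
  have gv: "polJ g v = 0" by (simp add: g_def Jv blinfun.zero_right)
  obtain k where k: "k > 0" "\<And>v. norm (v - k *\<^sub>R polJ g (polJ g v)) \<le> norm v"
    "\<And>c \<theta>. c \<in> centers \<Longrightarrow> \<theta> \<in> {0<..<pi} \<Longrightarrow> k * (poly g (L c \<theta>))\<^sup>2 \<le> 1"
    using damping[of g] by blast
  define f where "f i = (1 - smult k (g\<^sup>2)) ^ i" for i :: nat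
  have fv: "polJ (f i) v = v" for i
    by (induction i) (simp_all add: f_def polJ_mult polJ_damping gv)
  have polyf: "poly (f i) y = (1 - k * (poly g y)\<^sup>2) ^ i" for i y by (simp add: f_def)
  have "(\<lambda>i. cinner v (polJ (f i) (Kvec m))) \<longlonglongrightarrow> 0"
  proof (rule weak_null)
    show "norm (polJ (f i) (Kvec m)) \<le> 2" for i
      unfolding f_def by (rule order.trans[OF damping_power_norm[OF k(2)] Kvec(2)])
    fix n
    have "(\<lambda>i. Kf (\<lambda>x. of_real (poly (f i) x)) n m) \<longlonglongrightarrow> Kf (\<lambda>_. 0) n m"
    proof (rule Kf_dominated[where K = 1])
      fix c \<theta> i assume c: "c \<in> centers" "\<theta> \<in> {0<..<pi}"
      have "0 \<le> (1 - k * (poly g (L c \<theta>))\<^sup>2) ^ i" "(1 - k * (poly g (L c \<theta>))\<^sup>2) ^ i \<le> 1"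
        using k(1) k(3)[OF c] by (auto intro!: power_le_one)
      thus "norm (complex_of_real (poly (f i) (L c \<theta>))) \<le> 1"
        unfolding norm_of_real polyf by simp
    next
      fix c assume c: "c \<in> centers"
      have "AE \<theta> in qmeas. \<theta> \<in> {0<..<pi}" by (rule AE_I2) simp
      with AE_L_neq[OF c, of x]
      show "AE \<theta> in qmeas. (\<lambda>i. complex_of_real (poly (f i) (L c \<theta>))) \<longlonglongrightarrow> 0"
      proof eventually_elim
        fix \<theta> assume \<theta>: "L c \<theta> \<noteq> x" "\<theta> \<in> {0<..<pi}"
        have "0 < k * (poly g (L c \<theta>))\<^sup>2" using \<theta>(1) k(1) by (simp add: g_def)
        hence "(\<lambda>i. (1 - k * (poly g (L c \<theta>))\<^sup>2) ^ i) \<longlonglongrightarrow> 0"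
          using k(3)[OF c \<theta>(2)] by (intro LIMSEQ_power_zero) auto
        hence "(\<lambda>i. complex_of_real ((1 - k * (poly g (L c \<theta>))\<^sup>2) ^ i)) \<longlonglongrightarrow> of_real 0"
          by (rule tendsto_of_real)
        thus "(\<lambda>i. complex_of_real (poly (f i) (L c \<theta>))) \<longlonglongrightarrow> 0" by (simp only: polyf of_real_0)
      qed
    qed (intro continuous_intros)+
    thus "(\<lambda>i. ent (polJ (f i) (Kvec m)) n) \<longlonglongrightarrow> 0"
      unfolding polJ_Kvec by (simp add: Kf_def)
  qed
  moreover have "cinner v (polJ (f i) (Kvec m)) = cinner v (Kvec m)" for i
    using polJ_symmetric[of "f i" v "Kvec m"] by (simp add: fv)
  ultimately show ?thesis by (simp add: LIMSEQ_const_iff)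
qed

end

section \<open>The projection and the propagator as series in the vectors
  \<open>Kvec m\<close>\<close>

lemma ell1_1_weights:
  assumes "u \<in> ellp_space 1 1"
  shows "(\<lambda>n. real n * cmod (u n)) sums ellp_norm 1 1 u"
proof -
  have S: "(\<lambda>n. real n * cmod (u n)) summable_on {1..}"
    using assms by (simp add: ellp_space_def norm_mult)
  \<comment> \<open>Raising to the power 1 with \<open>powr\<close> is the identity only on
    nonnegative reals.\<close>
  have "infsum (\<lambda>n. real n * cmod (u n)) {1..} \<ge> 0" by (intro infsum_nonneg) auto
  hence "ellp_norm 1 1 u = infsum (\<lambda>n. real n * cmod (u n)) {1..}"
    by (simp add: ellp_norm_def norm_mult)
  hence "((\<lambda>n. real n * cmod (u n)) has_sum ellp_norm 1 1 u) {1..}"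
    using S by (simp add: has_sum_infsum)
  hence "((\<lambda>n. real n * cmod (u n)) has_sum ellp_norm 1 1 u) UNIV"
    by (rule has_sum_cong_neutral[THEN iffD1, rotated -1]) (auto simp: not_le)
  thus ?thesis by (rule has_sum_imp_sums)
qed

lemma sums_in_closed_subspace:
  assumes "ell2.subspace V" "closed V" "f sums (s :: ell2)" "\<And>n. f n \<in> V"
  shows "s \<in> V"
proof (rule closed_sequentially[OF assms(2)])
  show "(\<lambda>n. \<Sum>i<n. f i) \<longlonglongrightarrow> s" using assms(3) by (simp add: sums_def)
  show "(\<Sum>i<n. f i) \<in> V" for n using assms(4) by (intro ell2.subspace_sum[OF assms(1)])
qed

lemma cinner_eq_0_commute: "cinner v w = 0 \<longleftrightarrow> cinner w v = 0"
  by (subst cinner_commute) simp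

context jacobi_operator
begin

definition cont_space :: "ell2 set" where
  "cont_space = orth_compl (closure (ell2.span (eigenvectors J)))"

lemma Kvec_in_cont_space: "Kvec m \<in> cont_space"
proof -
  have "eigenvectors J \<subseteq> orth_compl {Kvec m}"
    using cinner_eigenvector_Kvec[of _ m] cinner_eq_0_commute[of "Kvec m"]
    by (auto simp: orth_compl_def)
  hence "closure (ell2.span (eigenvectors J)) \<subseteq> orth_compl {Kvec m}"
    by (intro closure_minimal ell2.span_minimal subspace_orth_compl closed_orth_compl)
  thus ?thesis
    using cinner_eq_0_commute[of "Kvec m"] unfolding cont_space_def orth_compl_def by blast
qed

lemma residual_orthogonal: "unit_vec m - Kvec m \<in> orth_compl cont_space"
proof -
  have "unit_vec m - Kvec m \<in> closure (ell2.span (eigenvectors J))"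
    using annihilated_in_span[OF residual_annihilated] closure_subset by blast
  thus ?thesis
    using cinner_eq_0_commute[of "unit_vec m - Kvec m"] unfolding cont_space_def orth_compl_def by blast
qed

text \<open>The series converges absolutely by \<open>norm (Kvec m) \<le> 2\<close>. Its sum lies in
  \<open>cont_space\<close> and differs from \<open>Ell2 u\<close> by a vector orthogonal to that
  space, so uniqueness of the projection identifies it.\<close>

lemma P_c_expansion:
  assumes u: "u \<in> ellp_space 1 1"
  shows "(\<lambda>m. u m *\<^sub>C Kvec m) sums P_c J (Ell2 u)"
proof -
  have u0: "u 0 = 0" using u by (simp add: ellp_space_def)
  have "summable (\<lambda>m. u m *\<^sub>C Kvec m)"
  proof (rule summable_comparison_test)
    show "summable (\<lambda>n. 2 * (real n * cmod (u n)))"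
      using ell1_1_weights[OF u] by (intro summable_mult) (auto dest: sums_summable)
    have "norm (u n *\<^sub>C Kvec n) \<le> 2 * (real n * cmod (u n))" if "n \<ge> 1" for n
    proof -
      have "norm (u n *\<^sub>C Kvec n) \<le> cmod (u n) * 2"
        unfolding norm_scaleC by (intro mult_left_mono Kvec(2)) auto
      also have "cmod (u n) \<le> real n * cmod (u n)" using that mult_right_mono[of 1 "real n" "cmod (u n)"] by simp
      finally show ?thesis by simp
    qed
    thus "\<exists>N. \<forall>n\<ge>N. norm (u n *\<^sub>C Kvec n) \<le> 2 * (real n * cmod (u n))" by blast
  qed
  then obtain x where x: "(\<lambda>m. u m *\<^sub>C Kvec m) sums x" by (auto simp: summable_def)
  have sub: "ell2.subspace cont_space" "closed cont_space"
    unfolding cont_space_def by (rule subspace_orth_compl closed_orth_compl)+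
  have "x \<in> cont_space"
    by (rule sums_in_closed_subspace[OF sub x]) (intro ell2.subspace_scale[OF sub(1)] Kvec_in_cont_space)
  have "(\<lambda>m. ent (Ell2 u) m *\<^sub>C unit_vec m) sums Ell2 u" by (rule unit_vec_expansion)
  hence "(\<lambda>m. u m *\<^sub>C unit_vec m) sums Ell2 u" by (simp only: ell1_1_subset_ell2[OF u])
  from sums_diff[OF this x] have "(\<lambda>m. u m *\<^sub>C (unit_vec m - Kvec m)) sums (Ell2 u - x)"
    by (simp add: ell2.scale_right_diff_distrib)
  hence "Ell2 u - x \<in> orth_compl cont_space"
    by (rule sums_in_closed_subspace[OF subspace_orth_compl closed_orth_compl])
       (intro ell2.subspace_scale[OF subspace_orth_compl] residual_orthogonal)
  moreover have "P_c J (Ell2 u) \<in> cont_space" "Ell2 u - P_c J (Ell2 u) \<in> orth_compl cont_space"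
    unfolding cont_space_def by (rule P_c_orth_proj)+
  ultimately have "P_c J (Ell2 u) = x"
    using orth_proj_unique[OF sub(1) \<open>x \<in> cont_space\<close>] by blast
  with x show ?thesis by simp
qed

lemma op_power_propagator:
  "op_power (scaleC_op c o\<^sub>L J) k v = c ^ k *\<^sub>C polJ (monom 1 k) v"
proof (induction k)
  case 0
  show ?case by (simp add: op_power_def monom_0 one_pCons[symmetric])
next
  case (Suc k)
  have "op_power (scaleC_op c o\<^sub>L J) (Suc k) v = c *\<^sub>C J (op_power (scaleC_op c o\<^sub>L J) k v)"
    by (simp add: op_power_def scaleC_op.rep_eq)
  thus ?case by (simp add: Suc.IH J_scaleC monom_Suc)
qed

lemma propagator_sums: "(\<lambda>k. ((- \<i> * of_real t) ^ k /\<^sub>R fact k) *\<^sub>C polJ (monom 1 k) v) sums propagator J t v"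
proof -
  have "(\<lambda>k. op_power (scaleC_op (- \<i> * of_real t) o\<^sub>L J) k /\<^sub>R fact k) sums propagator J t"
    unfolding propagator_def op_exp_def by (rule summable_sums[OF op_exp_summable])
  from bounded_linear.sums[OF blinfun.bounded_linear_left[of v] this] show ?thesis
    by (simp add: blinfun.scaleR_left op_power_propagator scaleR_scaleC scaleR_conv_of_real)
qed

lemma Kf_sum:
  assumes "\<And>i. continuous_on UNIV (\<phi> i)"
  shows "Kf (\<lambda>x. \<Sum>i<k. \<phi> i x) n m = (\<Sum>i<(k::nat). Kf (\<phi> i) n m)"
proof (induction k)
  case 0
  show ?case by (simp add: Kf_def)
next
  case (Suc k)
  have "Kf (\<lambda>x. (\<Sum>i<k. \<phi> i x) + \<phi> k x) n m = Kf (\<lambda>x. \<Sum>i<k. \<phi> i x) n m + Kf (\<phi> k) n m"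
    by (intro Kf_add continuous_intros assms)
  thus ?case by (simp add: Suc.IH)
qed

lemma polJ_scaleC: "polJ h (c *\<^sub>C v) = c *\<^sub>C polJ h v"
  by (induction h) (auto simp: J_scaleC scaleR_scaleC ell2.scale_right_distrib mult.commute)

text \<open>The exponential series is represented term by term through \<open>polJ_Kvec\<close>,
  with majorant \<open>exp (\<bar>t\<bar> * Lbound)\<close> on the bands. The scalar
  \<open>c\<close> is carried along because the type of the propagator guarantees real linearity
  only.\<close>

lemma propagator_Kvec:
  "ent (propagator J t (c *\<^sub>C Kvec m)) n = c * Kf (\<lambda>x. exp (- \<i> * of_real (t * x))) n m"
proof -
  define z where "z = - \<i> * complex_of_real t"
  define \<phi> where "\<phi> i x = (z * of_real x) ^ i /\<^sub>R fact i" for i x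
  have \<phi>: "continuous_on UNIV (\<phi> i)" for i unfolding \<phi>_def by (intro continuous_intros)
  have "(\<lambda>k. ent ((z ^ k /\<^sub>R fact k) *\<^sub>C polJ (monom 1 k) (c *\<^sub>C Kvec m)) n) sums ent (propagator J t (c *\<^sub>C Kvec m)) n"
    using bounded_linear.sums[OF bounded_linear_ent propagator_sums] unfolding z_def .
  moreover have "ent ((z ^ k /\<^sub>R fact k) *\<^sub>C polJ (monom 1 k) (c *\<^sub>C Kvec m)) n = c * Kf (\<phi> k) n m" for k
  proof -
    have "Kf (\<phi> k) n m = Kf (\<lambda>x. (z ^ k /\<^sub>R fact k) * of_real (poly (monom 1 k) x)) n m"
      by (rule Kf_cong) (simp add: \<phi>_def poly_monom power_mult_distrib)
    thus ?thesis by (simp only: Kf_cmult) (simp add: polJ_scaleC polJ_Kvec)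
  qed
  ultimately have "(\<lambda>k. c * Kf (\<phi> k) n m) sums ent (propagator J t (c *\<^sub>C Kvec m)) n" by simp
  hence "(\<lambda>k. c * Kf (\<lambda>x. \<Sum>i<k. \<phi> i x) n m) \<longlonglongrightarrow> ent (propagator J t (c *\<^sub>C Kvec m)) n"
    by (simp add: sums_def Kf_sum[OF \<phi>] sum_distrib_left)
  moreover have "(\<lambda>k. Kf (\<lambda>x. \<Sum>i<k. \<phi> i x) n m) \<longlonglongrightarrow> Kf (\<lambda>x. exp (- \<i> * of_real (t * x))) n m"
  proof (rule Kf_dominated[where K = "exp (\<bar>t\<bar> * Lbound)"])
    show "continuous_on UNIV (\<lambda>x. \<Sum>i<k. \<phi> i x)" for k by (intro continuous_intros \<phi>)
    show "continuous_on UNIV (\<lambda>x. exp (- \<i> * complex_of_real (t * x)))" by (intro continuous_intros)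
    fix c \<theta> and k :: nat assume c: "c \<in> centers" "\<theta> \<in> {0<..<pi}"
    have "norm (\<Sum>i<k. \<phi> i (L c \<theta>)) \<le> (\<Sum>i<k. (\<bar>t\<bar> * Lbound) ^ i /\<^sub>R fact i)"
    proof (rule sum_norm_le)
      fix i
      have "\<bar>t * L c \<theta>\<bar> ^ i \<le> (\<bar>t\<bar> * Lbound) ^ i"
        unfolding abs_mult by (intro power_mono mult_left_mono Lbound(2) c) auto
      thus "norm (\<phi> i (L c \<theta>)) \<le> (\<bar>t\<bar> * Lbound) ^ i /\<^sub>R fact i"
        by (simp add: \<phi>_def z_def norm_power norm_mult abs_mult divide_right_mono)
    qed
    also have "\<dots> \<le> exp (\<bar>t\<bar> * Lbound)"
      using Lbound(1) sums_unique[OF exp_converges[of "\<bar>t\<bar> * Lbound"]]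
      by (simp only:) (intro sum_le_suminf summable_exp_generic, auto)
    finally show "norm (\<Sum>i<k. \<phi> i (L c \<theta>)) \<le> exp (\<bar>t\<bar> * Lbound)" .
  next
    fix c assume c: "c \<in> centers"
    have "(\<lambda>k. \<Sum>i<k. \<phi> i (L c \<theta>)) \<longlonglongrightarrow> exp (- \<i> * of_real (t * L c \<theta>))" for \<theta>
      using exp_converges[of "z * of_real (L c \<theta>)"] by (simp add: sums_def \<phi>_def z_def mult.assoc)
    thus "AE \<theta> in qmeas. (\<lambda>k. \<Sum>i<k. \<phi> i (L c \<theta>)) \<longlonglongrightarrow> exp (- \<i> * of_real (t * L c \<theta>))"
      by simp
  qed
  hence "(\<lambda>k. c * Kf (\<lambda>x. \<Sum>i<k. \<phi> i x) n m) \<longlonglongrightarrow> c * Kf (\<lambda>x. exp (- \<i> * of_real (t * x))) n m"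
    by (intro tendsto_intros)
  ultimately show ?thesis by (rule LIMSEQ_unique)
qed

lemma propagator_P_c_sums:
  assumes "u \<in> ellp_space 1 1"
  shows "(\<lambda>m. u m * Kf (\<lambda>x. exp (- \<i> * of_real (t * x))) n m) sums ent (propagator J t (P_c J (Ell2 u))) n"
proof -
  have "(\<lambda>m. ent (propagator J t (u m *\<^sub>C Kvec m)) n) sums ent (propagator J t (P_c J (Ell2 u))) n"
    by (rule bounded_linear.sums[OF bounded_linear_ent])
       (rule bounded_linear.sums[OF blinfun.bounded_linear_right P_c_expansion[OF assms]])
  thus ?thesis by (simp only: propagator_Kvec)
qed

end

section \<open>The dispersive estimate\<close>

text \<open>The integral is the total variation of \<open>f\<close>. Between zeros of
  \<open>f'\<close> the function is monotone and contributes at most \<open>2 * M\<close>; the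
  induction splits the interval at a zero.\<close>

lemma integral_abs_deriv_le:
  fixes f f' :: "real \<Rightarrow> real"
  assumes "a \<le> b"
    and deriv: "\<And>x. x \<in> {a..b} \<Longrightarrow> (f has_real_derivative f' x) (at x within {a..b})"
    and cont: "continuous_on {a..b} f'"
    and bd: "\<And>x. x \<in> {a..b} \<Longrightarrow> \<bar>f x\<bar> \<le> M"
    and fin: "finite {x \<in> {a<..<b}. f' x = 0}" "card {x \<in> {a<..<b}. f' x = 0} \<le> N"
  shows "integral {a..b} (\<lambda>x. \<bar>f' x\<bar>) \<le> 2 * (real N + 1) * M"
  using assms
proof (induction N arbitrary: a b rule: less_induct)
  case (less N)
  note deriv = less.prems(2) and cont = less.prems(3) and bd = less.prems(4)
  have M: "M \<ge> 0" using bd[of a] less.prems(1) by auto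
  show ?case
  proof (cases "{x \<in> {a<..<b}. f' x = 0} = {}")
    case True
    have int: "(f' has_integral f b - f a) {a..b}"
      using less.prems(1) deriv by (intro fundamental_theorem_of_calculus)
        (auto simp: has_real_derivative_iff_has_vector_derivative)
    have "\<exists>s\<in>{1, -1}. \<forall>x\<in>{a<..<b}. \<bar>f' x\<bar> = s * f' x"
    proof (cases "\<forall>x\<in>{a<..<b}. 0 \<le> f' x")
      case False
      then obtain x where x: "x \<in> {a<..<b}" "f' x \<le> 0" by (meson linear)
      have "f' y \<le> 0" if y: "y \<in> {a<..<b}" for y
      proof (rule ccontr)
        assume "\<not> f' y \<le> 0"
        hence fy: "0 \<le> f' y" by simp
        have "connected (f' ` {a<..<b})"
          by (intro connected_continuous_image continuous_on_subset[OF cont] connected_Ioo) auto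
        hence "0 \<in> f' ` {a<..<b}"
          unfolding connected_iff_interval using x y fy by blast
        thus False using True by auto
      qed
      thus ?thesis by (intro bexI[of _ "-1"]) auto
    qed (intro bexI[of _ 1], auto)
    then obtain s where s: "s \<in> {1, -1}" "\<And>x. x \<in> {a<..<b} \<Longrightarrow> \<bar>f' x\<bar> = s * f' x" by blast
    have "integral {a..b} (\<lambda>x. \<bar>f' x\<bar>) = integral {a..b} (\<lambda>x. s * f' x)"
      by (rule integral_spike[of "{a, b}"]) (use s(2) in auto)
    also have "\<dots> = s * (f b - f a)" using int by (simp add: integral_unique)
    also have "\<dots> \<le> \<bar>f b\<bar> + \<bar>f a\<bar>" using s(1) by auto
    also have "\<dots> \<le> M + M" using less.prems(1) by (intro add_mono bd) auto
    also have "\<dots> \<le> 2 * (real N + 1) * M" using M by (simp add: algebra_simps)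
    finally show ?thesis .
  next
    case False
    then obtain z where z: "z \<in> {a<..<b}" "f' z = 0" by blast
    define Z1 Z2 where "Z1 = {x \<in> {a<..<z}. f' x = 0}" and "Z2 = {x \<in> {z<..<b}. f' x = 0}"
    have sub: "insert z (Z1 \<union> Z2) \<subseteq> {x \<in> {a<..<b}. f' x = 0}"
      using z by (auto simp: Z1_def Z2_def)
    have f12: "finite Z1" "finite Z2" using finite_subset[OF sub less.prems(5)] by auto
    have "card (insert z (Z1 \<union> Z2)) \<le> N"
      using card_mono[OF less.prems(5) sub] less.prems(6) by linarith
    moreover have "z \<notin> Z1 \<union> Z2" "Z1 \<inter> Z2 = {}" by (auto simp: Z1_def Z2_def)
    ultimately have card: "Suc (card Z1 + card Z2) \<le> N" using f12 by (simp add: card_Un_disjoint)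
    have 1: "integral {a..z} (\<lambda>x. \<bar>f' x\<bar>) \<le> 2 * (real (card Z1) + 1) * M"
    proof (rule less.IH)
      show "(f has_real_derivative f' x) (at x within {a..z})" if "x \<in> {a..z}" for x
        by (rule DERIV_subset[OF deriv]) (use that z in auto)
    qed (use card z bd f12(1) continuous_on_subset[OF cont] in \<open>auto simp: Z1_def\<close>)
    have 2: "integral {z..b} (\<lambda>x. \<bar>f' x\<bar>) \<le> 2 * (real (card Z2) + 1) * M"
    proof (rule less.IH)
      show "(f has_real_derivative f' x) (at x within {z..b})" if "x \<in> {z..b}" for x
        by (rule DERIV_subset[OF deriv]) (use that z in auto)
    qed (use card z bd f12(2) continuous_on_subset[OF cont] in \<open>auto simp: Z2_def\<close>)
    have "integral {a..b} (\<lambda>x. \<bar>f' x\<bar>) = integral {a..z} (\<lambda>x. \<bar>f' x\<bar>) + integral {z..b} (\<lambda>x. \<bar>f' x\<bar>)"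
      by (rule Henstock_Kurzweil_Integration.integral_combine[symmetric])
         (use z in \<open>auto intro!: integrable_continuous_interval continuous_intros cont\<close>)
    also have "\<dots> \<le> 2 * (real (card Z1) + 1) * M + 2 * (real (card Z2) + 1) * M" using 1 2 by (rule add_mono)
    also have "\<dots> = 2 * (real (Suc (card Z1 + card Z2)) + 1) * M" by (simp add: algebra_simps)
    also have "\<dots> \<le> 2 * (real N + 1) * M" using card M by (intro mult_right_mono) (auto simp del: of_nat_Suc)
    finally show ?thesis .
  qed
qed

text \<open>Since the velocity \<open>\<Lambda>'\<close> is part of the integrand, its product with
  the exponential is \<open>\<i> / t\<close> times the derivative of the exponential. After
  integration by parts the boundary costs \<open>2 * M\<close>, the factor \<open>Q'\<close> costs
  \<open>V\<close>, and \<open>T'\<close> costs \<open>M * l * (b - a)\<close>.\<close>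

lemma oscillatory_integral_bound:
  fixes \<Lambda> \<Lambda>' Q Q' T T' :: "real \<Rightarrow> real"
  assumes t: "t > 0" and ab: "a \<le> b"
    and \<Lambda>: "\<And>x. x \<in> {a..b} \<Longrightarrow> (\<Lambda> has_real_derivative \<Lambda>' x) (at x within {a..b})"
    and Q: "\<And>x. x \<in> {a..b} \<Longrightarrow> (Q has_real_derivative Q' x) (at x within {a..b})"
    and T: "\<And>x. x \<in> {a..b} \<Longrightarrow> (T has_real_derivative T' x) (at x within {a..b})"
    and cont: "continuous_on {a..b} Q'" "continuous_on {a..b} T'"
    and bd: "\<And>x. x \<in> {a..b} \<Longrightarrow> \<bar>Q x\<bar> \<le> M" "\<And>x. x \<in> {a..b} \<Longrightarrow> \<bar>T x\<bar> \<le> 1"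
      "\<And>x. x \<in> {a..b} \<Longrightarrow> \<bar>T' x\<bar> \<le> l"
    and V: "integral {a..b} (\<lambda>x. \<bar>Q' x\<bar>) \<le> V"
  shows "norm (integral {a..b} (\<lambda>x. exp (- \<i> * of_real (t * \<Lambda> x)) * of_real (\<Lambda>' x * Q x * T x)))
           \<le> (2 * M + V + M * l * (b - a)) / t"
proof -
  define E where "E x = exp (- \<i> * complex_of_real (t * \<Lambda> x))" for x
  have normE: "norm (E x) = 1" for x by (simp add: E_def)
  define I where "I = (\<lambda>x. E x * of_real (\<Lambda>' x * Q x * T x))"
  define R where "R = (\<lambda>x. E x * of_real (Q' x * T x + Q x * T' x))"
  have M: "M \<ge> 0" using bd(1)[of a] ab by auto
  have cts: "continuous_on {a..b} \<Lambda>" "continuous_on {a..b} Q" "continuous_on {a..b} T"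
    using DERIV_continuous_on[OF \<Lambda>] DERIV_continuous_on[OF Q] DERIV_continuous_on[OF T] by blast+
  have contR: "continuous_on {a..b} R"
    unfolding R_def E_def by (intro continuous_intros cts cont)
  have D: "((\<lambda>x. E x * of_real (Q x * T x)) has_vector_derivative - \<i> * of_real t * I x + R x) (at x within {a..b})"
    if x: "x \<in> {a..b}" for x
  proof -
    have L: "((\<lambda>x. - \<i> * complex_of_real (t * \<Lambda> x)) has_vector_derivative - \<i> * of_real (t * \<Lambda>' x)) (at x within {a..b})"
      by (intro has_vector_derivative_mult_right has_vector_derivative_of_real)
         (use \<Lambda>[OF x] in \<open>auto intro!: DERIV_cmult\<close>)
    have "(E has_vector_derivative - \<i> * of_real (t * \<Lambda>' x) * E x) (at x within {a..b})"
      using field_vector_diff_chain_within[OF L DERIV_subset[OF DERIV_exp]] unfolding E_def o_def by simp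
    moreover have "((\<lambda>x. complex_of_real (Q x * T x)) has_vector_derivative of_real (Q' x * T x + Q x * T' x)) (at x within {a..b})"
      using DERIV_mult[OF Q[OF x] T[OF x]]
      by (intro has_vector_derivative_of_real) (simp add: algebra_simps)
    ultimately have "((\<lambda>x. E x * of_real (Q x * T x)) has_vector_derivative
       E x * of_real (Q' x * T x + Q x * T' x) + - \<i> * of_real (t * \<Lambda>' x) * E x * of_real (Q x * T x)) (at x within {a..b})"
      by (rule has_vector_derivative_mult)
    thus ?thesis by (simp add: I_def R_def algebra_simps)
  qed
  have F: "((\<lambda>x. - \<i> * of_real t * I x + R x) has_integral
     E b * of_real (Q b * T b) - E a * of_real (Q a * T a)) {a..b}"
    using ab D by (rule fundamental_theorem_of_calculus)
  have Rint: "R integrable_on {a..b}" by (rule integrable_continuous_interval[OF contR])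
  have "((\<lambda>x. - \<i> * of_real t * I x) has_integral
     E b * of_real (Q b * T b) - E a * of_real (Q a * T a) - integral {a..b} R) {a..b}"
    using has_integral_diff[OF F integrable_integral[OF Rint]] by simp
  from has_integral_mult_right[OF this, of "\<i> / of_real t"] t
  have Iint: "integral {a..b} I = \<i> / of_real t *
     (E b * of_real (Q b * T b) - E a * of_real (Q a * T a) - integral {a..b} R)"
    by (intro integral_unique) (simp add: field_simps)
  have QT: "norm (E x * of_real (Q x * T x)) \<le> M" if "x \<in> {a..b}" for x
    using mult_mono[OF bd(1)[OF that] bd(2)[OF that]] M by (simp add: norm_mult normE abs_mult)
  have "norm (integral {a..b} R) \<le> integral {a..b} (\<lambda>x. \<bar>Q' x\<bar> + M * l)"
  proof (rule integral_norm_bound_integral[OF Rint])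
    show "(\<lambda>x. \<bar>Q' x\<bar> + M * l) integrable_on {a..b}"
      by (intro integrable_continuous_interval continuous_intros cont)
    fix x assume x: "x \<in> {a..b}"
    have "norm (R x) = \<bar>Q' x * T x + Q x * T' x\<bar>" by (simp only: R_def norm_mult normE norm_of_real mult_1)
    also have "\<dots> \<le> \<bar>Q' x\<bar> * \<bar>T x\<bar> + \<bar>Q x\<bar> * \<bar>T' x\<bar>"
      using abs_triangle_ineq[of "Q' x * T x" "Q x * T' x"] by (simp add: abs_mult)
    also have "\<dots> \<le> \<bar>Q' x\<bar> * 1 + M * l"
      using bd[OF x] M by (intro add_mono mult_mono) auto
    finally show "norm (R x) \<le> \<bar>Q' x\<bar> + M * l" by simp
  qed
  also have "\<dots> = integral {a..b} (\<lambda>x. \<bar>Q' x\<bar>) + M * l * (b - a)"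
    using ab by (subst integral_add) (auto intro!: integrable_continuous_interval continuous_intros cont)
  also have "\<dots> \<le> V + M * l * (b - a)" using V by simp
  finally have R: "norm (integral {a..b} R) \<le> V + M * l * (b - a)" .
  have "norm (integral {a..b} I) = norm (E b * of_real (Q b * T b) - E a * of_real (Q a * T a) - integral {a..b} R) / t"
    unfolding Iint using t by (simp add: norm_mult norm_divide)
  also have "\<dots> \<le> (M + M + (V + M * l * (b - a))) / t"
    using t ab QT[of a] QT[of b] R
    by (intro divide_right_mono order.trans[OF norm_triangle_ineq4] add_mono order.trans[OF norm_triangle_ineq4]) auto
  finally show ?thesis by (simp add: I_def E_def algebra_simps)
qed

lemma sin_ge_on_middle:
  assumes e: "0 < e" "e \<le> 1" and x: "x \<in> {e..pi - e}"
  shows "e / 2 \<le> sin x"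
proof -
  have *: "e / 2 \<le> sin y" if y: "e \<le> y" "y \<le> pi / 2" for y
  proof -
    have "\<exists>z>0. z < e \<and> sin e - sin 0 = (e - 0) * cos z"
      using e by (intro MVT2) (auto intro!: derivative_eq_intros)
    then obtain z where z: "0 < z" "z < e" "sin e = e * cos z" by auto
    \<comment> \<open>Here \<open>z < 1 < pi / 3\<close>, where the cosine is still at least
      1/2.\<close>
    have "cos (pi / 3) \<le> cos z" using z e pi_gt3 by (intro cos_monotone_0_pi_le) auto
    hence "e * (1 / 2) \<le> e * cos z" using e by (intro mult_left_mono) (auto simp: cos_60)
    hence "e / 2 \<le> sin e" using z by simp
    also have "\<dots> \<le> sin y" using e y by (intro sin_monotone_2pi_le) auto
    finally show ?thesis .
  qed
  show ?thesis
  proof (cases "x \<le> pi / 2")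
    case False
    have "e / 2 \<le> sin (pi - x)" using x False by (intro *) auto
    thus ?thesis by simp
  qed (use * x in auto)
qed

text \<open>The Boolean selects sine or cosine, so that the four products arising from two rotations
  are indexed uniformly.\<close>

definition trig :: "bool \<Rightarrow> nat \<Rightarrow> real \<Rightarrow> real" where
  "trig \<alpha> j \<theta> = (if \<alpha> then sin (real j * \<theta>) else cos (real j * \<theta>))"

definition trig' :: "bool \<Rightarrow> nat \<Rightarrow> real \<Rightarrow> real" where
  "trig' \<alpha> j \<theta> = (if \<alpha> then real j * cos (real j * \<theta>) else - real j * sin (real j * \<theta>))"

lemma trig:
  "(trig \<alpha> j has_real_derivative trig' \<alpha> j \<theta>) (at \<theta> within A)"
  "continuous_on A (trig \<alpha> j)" "continuous_on A (trig' \<alpha> j)"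
  "\<bar>trig \<alpha> j \<theta>\<bar> \<le> 1" "\<bar>trig' \<alpha> j \<theta>\<bar> \<le> real j"
proof -
  show "(trig \<alpha> j has_real_derivative trig' \<alpha> j \<theta>) (at \<theta> within A)"
    by (cases \<alpha>) (auto simp: trig_def[abs_def] trig'_def intro!: derivative_eq_intros)
  show "continuous_on A (trig \<alpha> j)" "continuous_on A (trig' \<alpha> j)"
    by (cases \<alpha>; simp add: trig_def[abs_def] trig'_def[abs_def]; intro continuous_intros)+
  show "\<bar>trig \<alpha> j \<theta>\<bar> \<le> 1" by (simp add: trig_def)
  show "\<bar>trig' \<alpha> j \<theta>\<bar> \<le> real j" by (simp add: trig'_def abs_mult mult_left_le)
qed

section \<open>Amplitudes and the estimate on a single band\<close>

context jacobi_coeffs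
begin

text \<open>The coefficient that \<open>floquet_rotation\<close> attaches to the sine
  (\<open>True\<close>) or the cosine (\<open>False\<close>).\<close>

definition Y :: "bool \<Rightarrow> nat \<Rightarrow> real \<Rightarrow> real \<Rightarrow> real" where
  "Y \<alpha> r c \<theta> = (if \<alpha> then poly (B r) (L c \<theta>) else sin \<theta> * poly (P r) (L c \<theta>))"

definition amplitude :: "bool \<Rightarrow> bool \<Rightarrow> nat \<Rightarrow> nat \<Rightarrow> real \<Rightarrow> real \<Rightarrow> real" where
  "amplitude \<alpha> \<beta> r s c \<theta> = 2 / pi * (Y \<alpha> r c \<theta> * Y \<beta> s c \<theta> / weight c \<theta>)"

lemma kern_eq_amplitudes:
  assumes "c \<in> centers" "\<theta> \<in> {0<..<pi}"
  shows "kern c (r + j * q) (s + k * q) \<theta> =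
    (\<Sum>\<alpha>\<in>UNIV. \<Sum>\<beta>\<in>UNIV. amplitude \<alpha> \<beta> r s c \<theta> * (trig \<alpha> j \<theta> * trig \<beta> k \<theta>))"
  unfolding kern_def floquet_rotation(1)[OF Disc_L[OF assms]]
  by (simp add: UNIV_bool amplitude_def Y_def trig_def add_divide_distrib algebra_simps)

lemma abs_amplitude_le:
  assumes c: "c \<in> centers" and \<theta>: "\<theta> \<in> {0<..<pi}" and r: "r \<in> {1..q}" "s \<in> {1..q}"
  shows "\<bar>amplitude \<alpha> \<beta> r s c \<theta>\<bar> \<le> 2 / pi"
proof -
  have Y: "(Y \<alpha> r c \<theta>)\<^sup>2 \<le> weight c \<theta>" if "r \<in> {1..q}" for \<alpha> r
  proof -
    have "(sin \<theta> * poly (P r) (L c \<theta>))\<^sup>2 \<le> weight c \<theta>" "(poly (B r) (L c \<theta>))\<^sup>2 \<le> weight c \<theta>"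
      using weight_ge[OF c \<theta> that] zero_le_power2[of "sin \<theta> * poly (P r) (L c \<theta>)"]
        zero_le_power2[of "poly (B r) (L c \<theta>)"] by linarith+
    thus ?thesis by (simp add: Y_def)
  qed
  have "2 * \<bar>Y \<alpha> r c \<theta> * Y \<beta> s c \<theta>\<bar> \<le> (Y \<alpha> r c \<theta>)\<^sup>2 + (Y \<beta> s c \<theta>)\<^sup>2"
    using sum_squares_bound[of "\<bar>Y \<alpha> r c \<theta>\<bar>" "\<bar>Y \<beta> s c \<theta>\<bar>"] by (simp add: abs_mult)
  hence "\<bar>Y \<alpha> r c \<theta> * Y \<beta> s c \<theta>\<bar> \<le> weight c \<theta>" using Y[OF r(1), of \<alpha>] Y[OF r(2), of \<beta>] by linarith
  hence "\<bar>Y \<alpha> r c \<theta> * Y \<beta> s c \<theta> / weight c \<theta>\<bar> \<le> 1"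
    using weight_pos[OF c \<theta>] by (simp add: abs_divide)
  thus ?thesis
    using mult_left_mono[of "\<bar>Y \<alpha> r c \<theta> * Y \<beta> s c \<theta> / weight c \<theta>\<bar>" 1 "2 / pi"]
    by (simp add: amplitude_def abs_mult)
qed

lemma continuous_amplitude:
  assumes "c \<in> centers" shows "continuous_on {0<..<pi} (amplitude \<alpha> \<beta> r s c)"
proof -
  have Y: "continuous_on {0<..<pi} (Y \<alpha> r c)" for \<alpha> r
    unfolding Y_def[abs_def] by (cases \<alpha>; simp; intro continuous_intros continuous_L assms)
  have "continuous_on {0<..<pi} (weight c)"
    unfolding weight_def[abs_def] by (intro continuous_intros continuous_L assms)
  thus ?thesis
    unfolding amplitude_def[abs_def] using weight_pos[OF assms]
    by (intro continuous_intros Y) (auto simp: less_le)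
qed

text \<open>
  The amplitude divided by the group velocity \<open>L'\<close>. Up to nonvanishing factors its derivative is a
  polynomial in the energy, hence it has finitely many monotonicity intervals, uniformly in the
  cutoff.
\<close>

lemma amplitude_over_velocity:
  assumes c: "c \<in> centers"
  shows "\<exists>Q Q' N.
     (\<forall>\<theta>\<in>{0<..<pi}. amplitude \<alpha> \<beta> r s c \<theta> = - (2 * sin \<theta>) / poly (pderiv Disc) (L c \<theta>) * Q \<theta> \<and>
        (Q has_real_derivative Q' \<theta>) (at \<theta>) \<and> isCont Q' \<theta>) \<and>
     ((\<forall>\<theta>\<in>{0<..<pi}. Q' \<theta> = 0) \<or>
        (finite {\<theta>\<in>{0<..<pi}. Q' \<theta> = 0} \<and> card {\<theta>\<in>{0<..<pi}. Q' \<theta> = 0} \<le> (N::nat)))"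
proof -
  \<comment> \<open>After one factor \<open>sin \<theta>\<close> has gone into the velocity, the
    power of \<open>sin \<theta>\<close> left over is \<open>h\<close>, with exponent
    \<open>\<kappa>\<close>.\<close>
  define h :: "real \<Rightarrow> real" where "h \<theta> = (if \<alpha> \<and> \<beta> then 1 / sin \<theta> else if \<alpha> \<or> \<beta> then 1 else sin \<theta>)" for \<theta>
  define \<kappa> :: real where "\<kappa> = (if \<alpha> \<and> \<beta> then - 1 else if \<alpha> \<or> \<beta> then 0 else 1)"
  define g where "g = (if \<alpha> then B r else P r) * (if \<beta> then B s else P s)"
  define K where "K = - 1 / (pi * a 0)"
  \<comment> \<open>The numerator of \<open>Q'\<close>, made a polynomial in the energy by writing
    \<open>cos \<theta>\<close> as \<open>Disc / 2\<close> and \<open>sin \<theta>\<close> squared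
    as \<open>1 - Disc^2 / 4\<close>.\<close>
  define Z where "Z = smult (\<kappa> / 2) (Disc * g * P q * pderiv Disc)
     - smult 2 ((1 - smult (1/4) (Disc * Disc)) * (pderiv g * P q - g * pderiv (P q)))"
  define Q where "Q \<theta> = K * h \<theta> * (poly g (L c \<theta>) / poly (P q) (L c \<theta>))" for \<theta>
  define w where "w \<theta> = K * h \<theta> / (sin \<theta> * (poly (P q) (L c \<theta>))\<^sup>2 * poly (pderiv Disc) (L c \<theta>))" for \<theta>
  define Q' where "Q' \<theta> = w \<theta> * poly Z (L c \<theta>)" for \<theta>
  have K0: "K \<noteq> 0" by (simp add: K_def)
  have sin0: "sin \<theta> > 0" if "\<theta> \<in> {0<..<pi}" for \<theta> using that by (auto intro: sin_gt_zero)
  have nz: "poly (P q) (L c \<theta>) \<noteq> 0" "poly (pderiv Disc) (L c \<theta>) \<noteq> 0" if "\<theta> \<in> {0<..<pi}" for \<theta>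
    using weight_pos[OF c that] by (auto simp: weight_def)
  have h0: "h \<theta> \<noteq> 0" if "\<theta> \<in> {0<..<pi}" for \<theta> using sin0[OF that] by (simp add: h_def)
  have dh: "(h has_real_derivative \<kappa> * h \<theta> * cos \<theta> / sin \<theta>) (at \<theta>)" if "\<theta> \<in> {0<..<pi}" for \<theta>
  proof -
    consider "\<alpha> \<and> \<beta>" | "\<alpha> \<noteq> \<beta>" | "\<not> \<alpha> \<and> \<not> \<beta>" by blast
    thus ?thesis
    proof cases
      case 1
      have "((\<lambda>\<theta>. 1 / sin \<theta>) has_real_derivative - 1 * (1 / sin \<theta>) * cos \<theta> / sin \<theta>) (at \<theta>)"
        using sin0[OF that] by (auto intro!: derivative_eq_intros simp: field_simps power2_eq_square)
      thus ?thesis using 1 by (simp add: h_def[abs_def] \<kappa>_def)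
    next
      case 2
      hence "h = (\<lambda>_. 1)" "\<kappa> = 0" by (auto simp: h_def[abs_def] \<kappa>_def)
      thus ?thesis by simp
    next
      case 3
      hence "h = sin" "\<kappa> = 1" by (auto simp: h_def[abs_def] \<kappa>_def)
      thus ?thesis using sin0[OF that] by (auto intro!: derivative_eq_intros)
    qed
  qed
  have amp: "amplitude \<alpha> \<beta> r s c \<theta> = - (2 * sin \<theta>) / poly (pderiv Disc) (L c \<theta>) * Q \<theta>"
    if "\<theta> \<in> {0<..<pi}" for \<theta>
  proof -
    have "Y \<alpha> r c \<theta> * Y \<beta> s c \<theta> = sin \<theta> * (h \<theta> * poly g (L c \<theta>))"
      using sin0[OF that] by (cases \<alpha>; cases \<beta>) (simp_all add: Y_def h_def g_def)
    thus ?thesis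
      using nz[OF that] sin0[OF that] by (simp add: amplitude_def Q_def K_def weight_def field_simps)
  qed
  have dQ: "(Q has_real_derivative Q' \<theta>) (at \<theta>)" if \<theta>: "\<theta> \<in> {0<..<pi}" for \<theta>
  proof -
    define x where "x = L c \<theta>"
    define p dp g0 dg D where "p = poly (P q) x" and "dp = poly (pderiv (P q)) x" and "g0 = poly g x"
      and "dg = poly (pderiv g) x" and "D = poly (pderiv Disc) x"
    have nz': "p \<noteq> 0" "D \<noteq> 0" "sin \<theta> \<noteq> 0" using nz[OF \<theta>] sin0[OF \<theta>] by (auto simp: p_def D_def x_def)
    have dL: "(L c has_real_derivative - (2 * sin \<theta>) / D) (at \<theta>)"
      using deriv_L[OF c \<theta>] by (simp add: D_def x_def)
    have comp: "((\<lambda>\<theta>. poly f (L c \<theta>)) has_real_derivative poly (pderiv f) x * (- (2 * sin \<theta>) / D)) (at \<theta>)" for f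
      unfolding x_def by (rule DERIV_chain2[OF poly_DERIV]) (use dL in \<open>simp add: x_def\<close>)
    have "((\<lambda>\<theta>. poly g (L c \<theta>) / poly (P q) (L c \<theta>)) has_real_derivative
        (dg * (- (2 * sin \<theta>) / D) * p - g0 * (dp * (- (2 * sin \<theta>) / D))) / (p * p)) (at \<theta>)"
      using DERIV_divide[OF comp[of g] comp[of "P q"]] nz' by (simp add: p_def dp_def g0_def dg_def x_def)
    from DERIV_mult[OF DERIV_cmult[OF dh[OF \<theta>], of K] this]
    have "(Q has_real_derivative K * (\<kappa> * h \<theta> * cos \<theta> / sin \<theta>) * (g0 / p)
       + (dg * (- (2 * sin \<theta>) / D) * p - g0 * (dp * (- (2 * sin \<theta>) / D))) / (p * p) * (K * h \<theta>)) (at \<theta>)"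
      by (simp add: Q_def[abs_def] g0_def p_def x_def)
    moreover have "K * (\<kappa> * h \<theta> * cos \<theta> / sin \<theta>) * (g0 / p)
       + (dg * (- (2 * sin \<theta>) / D) * p - g0 * (dp * (- (2 * sin \<theta>) / D))) / (p * p) * (K * h \<theta>)
       = K * h \<theta> / (sin \<theta> * p\<^sup>2 * D) * (\<kappa> * cos \<theta> * g0 * p * D - 2 * (sin \<theta>)\<^sup>2 * (dg * p - g0 * dp))"
      using nz' by (simp add: field_simps power2_eq_square)
    moreover have "poly Z x = \<kappa> * cos \<theta> * g0 * p * D - 2 * (sin \<theta>)\<^sup>2 * (dg * p - g0 * dp)"
    proof -
      have "poly Z x = \<kappa> / 2 * (poly Disc x * g0 * p * D)
          - 2 * ((1 - 1 / 4 * (poly Disc x * poly Disc x)) * (dg * p - g0 * dp))"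
        by (simp add: Z_def g0_def p_def D_def dg_def dp_def)
      moreover have "1 - 1 / 4 * (poly Disc x * poly Disc x) = (sin \<theta>)\<^sup>2"
        using Disc_L[OF c \<theta>] by (simp add: x_def power2_eq_square[of "sin \<theta>"] sin_squared_eq[unfolded power2_eq_square])
      ultimately show ?thesis using Disc_L[OF c \<theta>] by (simp add: x_def)
    qed
    ultimately show ?thesis by (simp add: Q'_def w_def x_def p_def D_def)
  qed
  have contQ': "isCont Q' \<theta>" if \<theta>: "\<theta> \<in> {0<..<pi}" for \<theta>
  proof -
    have L: "isCont (L c) \<theta>" by (rule DERIV_isCont[OF deriv_L[OF c \<theta>]])
    have "isCont h \<theta>" by (rule DERIV_isCont[OF dh[OF \<theta>]])
    thus ?thesis
      unfolding Q'_def[abs_def] w_def using nz[OF \<theta>] sin0[OF \<theta>]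
      by (intro continuous_intros L isCont_o2[OF L poly_isCont]) auto
  qed
  have w0: "w \<theta> \<noteq> 0" if "\<theta> \<in> {0<..<pi}" for \<theta>
    using nz[OF that] sin0[OF that] h0[OF that] K0 by (simp add: w_def)
  \<comment> \<open>Unless \<open>Z = 0\<close>, the injective map \<open>L c\<close> sends the
    zeros of \<open>Q'\<close> into the roots of \<open>Z\<close>.\<close>
  have "(\<forall>\<theta>\<in>{0<..<pi}. Q' \<theta> = 0) \<or>
     (finite {\<theta>\<in>{0<..<pi}. Q' \<theta> = 0} \<and> card {\<theta>\<in>{0<..<pi}. Q' \<theta> = 0} \<le> card {x. poly Z x = 0})"
  proof (cases "Z = 0")
    case False
    hence fin: "finite {x. poly Z x = 0}" by (rule poly_roots_finite)
    have inj: "inj_on (L c) {\<theta>\<in>{0<..<pi}. Q' \<theta> = 0}"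
      by (rule inj_onI) (auto intro: L_inj[OF c])
    have img: "L c ` {\<theta>\<in>{0<..<pi}. Q' \<theta> = 0} \<subseteq> {x. poly Z x = 0}"
      using w0 by (auto simp: Q'_def)
    show ?thesis
      using card_inj_on_le[OF inj img fin] inj_on_finite[OF inj img fin] by blast
  qed (simp add: Q'_def)
  thus ?thesis using amp dQ contQ' by blast
qed

lemma integrable_amplitude_integrand:
  assumes c: "c \<in> centers" and r: "r \<in> {1..q}" "s \<in> {1..q}"
  shows "integrable qmeas (\<lambda>\<theta>. exp (- \<i> * of_real (t * L c \<theta>)) *
     complex_of_real (amplitude \<alpha> \<beta> r s c \<theta> * (trig \<alpha> j \<theta> * trig \<beta> k \<theta>)))"
    and "\<And>\<theta>. \<theta> \<in> {0<..<pi} \<Longrightarrow> norm (exp (- \<i> * of_real (t * L c \<theta>)) *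
     complex_of_real (amplitude \<alpha> \<beta> r s c \<theta> * (trig \<alpha> j \<theta> * trig \<beta> k \<theta>))) \<le> 2 / pi"
proof -
  show *: "norm (exp (- \<i> * of_real (t * L c \<theta>)) *
     complex_of_real (amplitude \<alpha> \<beta> r s c \<theta> * (trig \<alpha> j \<theta> * trig \<beta> k \<theta>))) \<le> 2 / pi"
    if "\<theta> \<in> {0<..<pi}" for \<theta>
  proof -
    have "\<bar>amplitude \<alpha> \<beta> r s c \<theta>\<bar> * (\<bar>trig \<alpha> j \<theta>\<bar> * \<bar>trig \<beta> k \<theta>\<bar>) \<le> 2 / pi * (1 * 1)"
      by (intro mult_mono abs_amplitude_le c r that trig) auto
    thus ?thesis by (simp add: norm_mult abs_mult)
  qed
  show "integrable qmeas (\<lambda>\<theta>. exp (- \<i> * of_real (t * L c \<theta>)) *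
     complex_of_real (amplitude \<alpha> \<beta> r s c \<theta> * (trig \<alpha> j \<theta> * trig \<beta> k \<theta>)))"
    by (rule integrable_qmeas[OF _ *]) (intro continuous_intros continuous_L continuous_amplitude trig c)
qed

text \<open>Growth in \<open>j\<close> and \<open>k\<close> comes only from differentiating the
  trigonometric factors; everything else depends on the band and the residues.\<close>

lemma band_estimate:
  assumes c: "c \<in> centers" and r: "r \<in> {1..q}" "s \<in> {1..q}"
  shows "\<exists>C\<ge>0. \<forall>t>0. \<forall>j k. norm (integral\<^sup>L qmeas (\<lambda>\<theta>. exp (- \<i> * of_real (t * L c \<theta>)) *
     complex_of_real (amplitude \<alpha> \<beta> r s c \<theta> * (trig \<alpha> j \<theta> * trig \<beta> k \<theta>))))
     \<le> C * (1 + real j + real k) * t powr (- 1 / 2)"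
proof -
  obtain Q Q' and N :: nat where QQ: "\<forall>\<theta>\<in>{0<..<pi}.
        amplitude \<alpha> \<beta> r s c \<theta> = - (2 * sin \<theta>) / poly (pderiv Disc) (L c \<theta>) * Q \<theta> \<and>
        (Q has_real_derivative Q' \<theta>) (at \<theta>) \<and> isCont Q' \<theta>"
    and N: "(\<forall>\<theta>\<in>{0<..<pi}. Q' \<theta> = 0) \<or>
        (finite {\<theta>\<in>{0<..<pi}. Q' \<theta> = 0} \<and> card {\<theta>\<in>{0<..<pi}. Q' \<theta> = 0} \<le> N)"
    using amplitude_over_velocity[OF c, of \<alpha> \<beta> r s] by (elim exE conjE) (rule that)
  have Q: "\<And>\<theta>. \<theta> \<in> {0<..<pi} \<Longrightarrow>
        amplitude \<alpha> \<beta> r s c \<theta> = - (2 * sin \<theta>) / poly (pderiv Disc) (L c \<theta>) * Q \<theta>"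
      "\<And>\<theta>. \<theta> \<in> {0<..<pi} \<Longrightarrow> (Q has_real_derivative Q' \<theta>) (at \<theta>)"
      "\<And>\<theta>. \<theta> \<in> {0<..<pi} \<Longrightarrow> isCont Q' \<theta>"
    using QQ by blast+
  obtain D where D: "D > 0" "\<And>c \<theta>. c \<in> centers \<Longrightarrow> \<theta> \<in> {0<..<pi} \<Longrightarrow>
      norm (complex_of_real (poly (pderiv Disc) (L c \<theta>))) \<le> D"
    by (rule bounded_on_bands[of "\<lambda>x. complex_of_real (poly (pderiv Disc) x)"]) (intro continuous_intros, blast)
  \<comment> \<open>\<open>2\<close> is the trivial bound for \<open>t < 1\<close>,
    \<open>4 / pi\<close> pays for the two edge pieces, and the rest comes from the integration by
    parts with \<open>M = 2 * D / e\<close>.\<close>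
  define C where "C = 2 + 4 / pi + 2 * D * (4 + 2 * real N + pi)"
  have "norm (integral\<^sup>L qmeas (\<lambda>\<theta>. exp (- \<i> * of_real (t * L c \<theta>)) *
     complex_of_real (amplitude \<alpha> \<beta> r s c \<theta> * (trig \<alpha> j \<theta> * trig \<beta> k \<theta>))))
     \<le> C * (1 + real j + real k) * t powr (- 1 / 2)" if t: "t > 0" for t j k
  proof -
    define f where "f \<theta> = exp (- \<i> * of_real (t * L c \<theta>)) *
       complex_of_real (amplitude \<alpha> \<beta> r s c \<theta> * (trig \<alpha> j \<theta> * trig \<beta> k \<theta>))" for \<theta>
    \<comment> \<open>Extension by 0, so that the integral over the closed interval can be split at
      \<open>e\<close> and \<open>pi - e\<close>.\<close>
    define F where "F \<theta> = (if \<theta> \<in> {0<..<pi} then f \<theta> else 0)" for \<theta>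
    have fint: "integrable qmeas f" and fbd: "\<And>\<theta>. \<theta> \<in> {0<..<pi} \<Longrightarrow> norm (f \<theta>) \<le> 2 / pi"
      unfolding f_def using integrable_amplitude_integrand[OF c r] by blast+
    have Fbd: "norm (F \<theta>) \<le> 2 / pi" for \<theta> using fbd[of \<theta>] by (simp add: F_def)
    have "(f has_integral integral\<^sup>L qmeas f) {0<..<pi}"
      by (rule has_integral_integral_lebesgue_on[OF fint]) simp
    hence "(F has_integral integral\<^sup>L qmeas f) {0<..<pi}"
      by (rule has_integral_eq[rotated]) (simp add: F_def)
    hence Fint: "(F has_integral integral\<^sup>L qmeas f) {0..pi}" by (simp add: has_integral_Icc_iff_Ioo)
    hence FI: "F integrable_on {0..pi}" by (rule has_integral_integrable)
    \<comment> \<open>Edge pieces cost a multiple of \<open>e\<close>, the middle a multiple of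
      \<open>1 / (t * e)\<close>; this cutoff balances them.\<close>
    define e where "e = t powr (- 1 / 2)"
    have e0: "e > 0" using t by (simp add: e_def)
    have te: "1 / (t * e) = e"
    proof -
      have "t * e * e = t * t powr (- 1 / 2 + - 1 / 2)" unfolding e_def powr_add by simp
      also have "\<dots> = 1" using t by (simp add: powr_minus)
      finally show ?thesis using e0 t by (simp add: field_simps)
    qed
    have jk: "1 \<le> 1 + real j + real k" by simp
    have short: "norm (integral {x..y} F) \<le> 2 / pi * (y - x)" if "0 \<le> x" "x \<le> y" "y \<le> pi" for x y
    proof -
      have "norm (integral {x..y} F) \<le> integral {x..y} (\<lambda>_. 2 / pi)"
        using that by (intro integral_norm_bound_integral Fbd integrable_on_subinterval[OF FI]) auto
      thus ?thesis using that by (simp add: mult.commute)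
    qed
    show ?thesis
    proof (cases "e \<le> 1")
      case False
      have "norm (integral\<^sup>L qmeas f) \<le> 2 / pi * (pi - 0)"
        using short[of 0 pi] integral_unique[OF Fint] by simp
      also have "\<dots> = 2 * 1 * 1" by simp
      also have "\<dots> \<le> C * (1 + real j + real k) * e"
        using False D(1) jk by (intro mult_mono) (auto simp: C_def)
      finally show ?thesis by (simp add: f_def[abs_def] e_def)
    next
      case True
      have epi: "e < pi / 2" using True pi_gt3 by simp
      have sub: "{e..pi - e} \<subseteq> {0<..<pi}" using e0 by auto
      have sin: "e / 2 \<le> sin \<theta>" if "\<theta> \<in> {e..pi - e}" for \<theta> by (rule sin_ge_on_middle[OF e0 True that])
      \<comment> \<open>Dividing the bounded amplitude by the velocity loses
        \<open>1 / sin \<theta>\<close>, which is at most \<open>2 / e\<close> on the middle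
        part.\<close>
      define M where "M = 2 * D / e"
      have M0: "M > 0" using D(1) e0 by (simp add: M_def)
      have Qbd: "\<bar>Q \<theta>\<bar> \<le> M" if "\<theta> \<in> {e..pi - e}" for \<theta>
      proof -
        have \<theta>: "\<theta> \<in> {0<..<pi}" using that sub by blast
        have nz: "poly (pderiv Disc) (L c \<theta>) \<noteq> 0" using pderiv_Disc_nz[OF abs_Disc_L[OF c \<theta>]] .
        have s0: "sin \<theta> > 0" using sin[OF that] e0 by linarith
        have "Q \<theta> = - (amplitude \<alpha> \<beta> r s c \<theta> * poly (pderiv Disc) (L c \<theta>)) / (2 * sin \<theta>)"
          using Q(1)[OF \<theta>] nz s0 by (simp add: field_simps)
        hence "\<bar>Q \<theta>\<bar> = \<bar>amplitude \<alpha> \<beta> r s c \<theta>\<bar> * \<bar>poly (pderiv Disc) (L c \<theta>)\<bar> / (2 * sin \<theta>)"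
          using s0 by (simp add: abs_mult)
        also have "\<dots> \<le> 2 / pi * D / (2 * (e / 2))"
          using D(2)[OF c \<theta>] D(1) e0 sin[OF that]
          by (intro frac_le mult_mono abs_amplitude_le c \<theta> r) auto
        also have "2 / pi * D / (2 * (e / 2)) = 2 / pi * D / e" by simp
        also have "\<dots> \<le> 2 * D / e"
        proof -
          have "2 / pi \<le> 2" using pi_gt3 by (simp add: divide_le_eq)
          thus ?thesis using D(1) e0 by (intro divide_right_mono mult_right_mono) auto
        qed
        finally show ?thesis by (simp add: M_def)
      qed
      have contQ': "continuous_on {e..pi - e} Q'"
        using Q(3) sub by (intro continuous_at_imp_continuous_on) blast
      have dQ: "(Q has_real_derivative Q' \<theta>) (at \<theta> within {e..pi - e})" if "\<theta> \<in> {e..pi - e}" for \<theta>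
        using Q(2) that sub by (blast intro: has_field_derivative_at_within)
      have V: "integral {e..pi - e} (\<lambda>\<theta>. \<bar>Q' \<theta>\<bar>) \<le> 2 * (real N + 1) * M"
        using N
      proof
        assume "\<forall>\<theta>\<in>{0<..<pi}. Q' \<theta> = 0"
        hence "integral {e..pi - e} (\<lambda>\<theta>. \<bar>Q' \<theta>\<bar>) = integral {e..pi - e} (\<lambda>\<theta>. 0)"
          using sub by (intro integral_cong) auto
        thus ?thesis using M0 by simp
      next
        assume fin: "finite {\<theta>\<in>{0<..<pi}. Q' \<theta> = 0} \<and> card {\<theta>\<in>{0<..<pi}. Q' \<theta> = 0} \<le> N"
        have subset: "{\<theta>\<in>{e<..<pi - e}. Q' \<theta> = 0} \<subseteq> {\<theta>\<in>{0<..<pi}. Q' \<theta> = 0}" using e0 by auto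
        show ?thesis
        proof (rule integral_abs_deriv_le[OF _ dQ contQ' Qbd])
          show "finite {\<theta>\<in>{e<..<pi - e}. Q' \<theta> = 0}" using finite_subset[OF subset] fin by blast
          show "card {\<theta>\<in>{e<..<pi - e}. Q' \<theta> = 0} \<le> N"
            using card_mono[OF _ subset] fin by linarith
        qed (use epi in auto)
      qed
      have "norm (integral {e..pi - e} (\<lambda>\<theta>. exp (- \<i> * of_real (t * L c \<theta>)) *
           of_real (- (2 * sin \<theta>) / poly (pderiv Disc) (L c \<theta>) * Q \<theta> * (trig \<alpha> j \<theta> * trig \<beta> k \<theta>))))
         \<le> (2 * M + 2 * (real N + 1) * M + M * (real j + real k) * (pi - e - e)) / t"
      proof (rule oscillatory_integral_bound[OF t _ _ dQ _ contQ' _ Qbd _ _ V])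
        fix \<theta> assume \<theta>: "\<theta> \<in> {e..pi - e}"
        show "(L c has_real_derivative - (2 * sin \<theta>) / poly (pderiv Disc) (L c \<theta>)) (at \<theta> within {e..pi - e})"
          using deriv_L[OF c] \<theta> sub by (blast intro: has_field_derivative_at_within)
        show "((\<lambda>\<theta>. trig \<alpha> j \<theta> * trig \<beta> k \<theta>) has_real_derivative
            trig' \<alpha> j \<theta> * trig \<beta> k \<theta> + trig' \<beta> k \<theta> * trig \<alpha> j \<theta>) (at \<theta> within {e..pi - e})"
          by (rule DERIV_mult[OF trig(1) trig(1)])
        show "\<bar>trig \<alpha> j \<theta> * trig \<beta> k \<theta>\<bar> \<le> 1"
          using mult_mono[OF trig(4)[of \<alpha> j \<theta>] trig(4)[of \<beta> k \<theta>]] by (simp add: abs_mult)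
        have "\<bar>trig' \<alpha> j \<theta>\<bar> * \<bar>trig \<beta> k \<theta>\<bar> \<le> real j * 1" "\<bar>trig' \<beta> k \<theta>\<bar> * \<bar>trig \<alpha> j \<theta>\<bar> \<le> real k * 1"
          by (intro mult_mono trig; simp)+
        thus "\<bar>trig' \<alpha> j \<theta> * trig \<beta> k \<theta> + trig' \<beta> k \<theta> * trig \<alpha> j \<theta>\<bar> \<le> real j + real k"
          by (simp flip: abs_mult)
      next
        show "continuous_on {e..pi - e} (\<lambda>\<theta>. trig' \<alpha> j \<theta> * trig \<beta> k \<theta> + trig' \<beta> k \<theta> * trig \<alpha> j \<theta>)"
          by (intro continuous_intros trig)
      qed (use epi in auto)
      also have "integral {e..pi - e} (\<lambda>\<theta>. exp (- \<i> * of_real (t * L c \<theta>)) *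
           of_real (- (2 * sin \<theta>) / poly (pderiv Disc) (L c \<theta>) * Q \<theta> * (trig \<alpha> j \<theta> * trig \<beta> k \<theta>)))
         = integral {e..pi - e} F"
        using sub Q(1) by (intro integral_cong) (auto simp: F_def f_def subset_iff)
      also have "(2 * M + 2 * (real N + 1) * M + M * (real j + real k) * (pi - e - e)) / t
          = 2 * D * (4 + 2 * real N + (real j + real k) * (pi - e - e)) * (1 / (t * e))"
        using t e0 by (simp add: M_def field_simps)
      also have "\<dots> = 2 * D * (4 + 2 * real N + (real j + real k) * (pi - e - e)) * e" by (simp only: te)
      also have "\<dots> \<le> 2 * D * ((4 + 2 * real N) * (1 + real j + real k) + (1 + real j + real k) * pi) * e"
        using D(1) e0 epi by (intro mult_right_mono mult_left_mono add_mono mult_mono) (auto simp: algebra_simps)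
      finally have mid: "norm (integral {e..pi - e} F) \<le> 2 * D * (4 + 2 * real N + pi) * (1 + real j + real k) * e"
        by (simp add: algebra_simps)
      have "integral {0..pi} F = integral {0..e} F + integral {e..pi - e} F + integral {pi - e..pi} F"
        using epi e0 Henstock_Kurzweil_Integration.integral_combine[of 0 e pi F]
          Henstock_Kurzweil_Integration.integral_combine[of e "pi - e" pi F]
          integrable_on_subinterval[OF FI, of e pi] FI by (simp add: add.assoc)
      hence "norm (integral\<^sup>L qmeas f) \<le> norm (integral {0..e} F) + norm (integral {e..pi - e} F) + norm (integral {pi - e..pi} F)"
        using integral_unique[OF Fint] by (simp add: norm_triangle_le norm_triangle_ineq)
      also have "\<dots> \<le> 2 / pi * (e - 0) + 2 * D * (4 + 2 * real N + pi) * (1 + real j + real k) * e + 2 / pi * (pi - (pi - e))"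
        using epi e0 by (intro add_mono short mid) auto
      also have "\<dots> = (4 / pi * 1 + 2 * D * (4 + 2 * real N + pi) * (1 + real j + real k)) * e"
        by (simp add: algebra_simps)
      also have "\<dots> \<le> (4 / pi * (1 + real j + real k) + 2 * D * (4 + 2 * real N + pi) * (1 + real j + real k)) * e"
        using e0 by (intro mult_right_mono add_mono mult_left_mono) auto
      also have "\<dots> \<le> C * (1 + real j + real k) * e"
        using e0 by (intro mult_right_mono) (auto simp: C_def algebra_simps)
      finally show ?thesis by (simp add: f_def[abs_def] e_def)
    qed
  qed
  moreover have "C \<ge> 0" using D(1) by (simp add: C_def)
  ultimately show ?thesis by blast
qed

section \<open>From single bands to the kernel and to the weighted norms\<close>

lemma finite_uniform_bound:
  fixes A :: "'i \<Rightarrow> 'p \<Rightarrow> real"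
  assumes "finite I" "\<And>i. i \<in> I \<Longrightarrow> \<exists>C\<ge>0. \<forall>p. A i p \<le> C * G p" "\<And>p. G p \<ge> 0"
  shows "\<exists>C\<ge>0. \<forall>i\<in>I. \<forall>p. A i p \<le> C * G p"
proof -
  obtain Cf where Cf: "\<And>i. i \<in> I \<Longrightarrow> Cf i \<ge> 0 \<and> (\<forall>p. A i p \<le> Cf i * G p)" using assms(2) by metis
  have "A i p \<le> (\<Sum>i\<in>I. Cf i) * G p" if "i \<in> I" for i p
  proof -
    have "Cf i \<le> (\<Sum>i\<in>I. Cf i)" using that Cf assms(1) by (intro member_le_sum) auto
    hence "Cf i * G p \<le> (\<Sum>i\<in>I. Cf i) * G p" using assms(3) by (intro mult_right_mono)
    thus ?thesis using Cf[OF that] order.trans by blast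
  qed
  moreover have "(\<Sum>i\<in>I. Cf i) \<ge> 0" using Cf by (intro sum_nonneg) auto
  ultimately show ?thesis by blast
qed

text \<open>Only finitely many bands, residues and trigonometric choices occur, so their constants
  combine; \<open>n\<close> and \<open>m\<close> enter through the period counts \<open>j\<close>
  and \<open>k\<close>.\<close>

lemma kernel_estimate:
  "\<exists>C>0. \<forall>t>0. \<forall>n\<ge>1. \<forall>m\<ge>1. norm (Kf (\<lambda>x. exp (- \<i> * of_real (t * x))) n m)
     \<le> C * t powr (- 1 / 2) * (real n * real m)"
proof -
  define A where "A = (\<lambda>(c, r, s, \<alpha>, \<beta>) (t, j, k). if t > 0 then norm (integral\<^sup>L qmeas (\<lambda>\<theta>. exp (- \<i> * of_real (t * L c \<theta>)) *
     complex_of_real (amplitude \<alpha> \<beta> r s c \<theta> * (trig \<alpha> j \<theta> * trig \<beta> k \<theta>)))) else 0)"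
  define G where "G = (\<lambda>(t, j, k). (1 + real j + real k) * t powr (- 1 / 2))"
  define I where "I = centers \<times> {1..q} \<times> {1..q} \<times> (UNIV :: bool set) \<times> (UNIV :: bool set)"
  have "\<exists>C\<ge>0. \<forall>i\<in>I. \<forall>p. A i p \<le> C * G p"
  proof (rule finite_uniform_bound)
    show "finite I" by (simp add: I_def)
    show "G p \<ge> 0" for p by (cases p) (simp add: G_def)
    fix i assume "i \<in> I"
    then obtain c r s \<alpha> \<beta> where i: "i = (c, r, s, \<alpha>, \<beta>)" "c \<in> centers" "r \<in> {1..q}" "s \<in> {1..q}"
      by (auto simp: I_def)
    obtain C where "C \<ge> 0" "\<And>t j k. t > 0 \<Longrightarrow> norm (integral\<^sup>L qmeas (\<lambda>\<theta>. exp (- \<i> * of_real (t * L c \<theta>)) *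
       complex_of_real (amplitude \<alpha> \<beta> r s c \<theta> * (trig \<alpha> j \<theta> * trig \<beta> k \<theta>))))
       \<le> C * (1 + real j + real k) * t powr (- 1 / 2)"
      using band_estimate[OF i(2-4), of \<alpha> \<beta>] by blast
    thus "\<exists>C\<ge>0. \<forall>p. A i p \<le> C * G p"
      by (intro exI[of _ C]) (auto simp: A_def G_def i(1) mult.assoc)
  qed
  then obtain C where C: "C \<ge> 0" "\<And>i p. i \<in> I \<Longrightarrow> A i p \<le> C * G p" by blast
  have est: "norm (integral\<^sup>L qmeas (\<lambda>\<theta>. exp (- \<i> * of_real (t * L c \<theta>)) *
       complex_of_real (amplitude \<alpha> \<beta> r s c \<theta> * (trig \<alpha> j \<theta> * trig \<beta> k \<theta>))))
       \<le> C * ((1 + real j + real k) * t powr (- 1 / 2))"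
    if "c \<in> centers" "r \<in> {1..q}" "s \<in> {1..q}" "t > 0" for c r s \<alpha> \<beta> t j k
    using C(2)[of "(c, r, s, \<alpha>, \<beta>)" "(t, j, k)"] that by (simp add: I_def A_def G_def)
  \<comment> \<open>The factor 8 consists of 4 trigonometric products and the 2 in
    \<open>n + m \<le> 2 * n * m\<close>; the sum over bands gives \<open>q\<close>, and the added 1
    makes the constant positive.\<close>
  have "norm (Kf (\<lambda>x. exp (- \<i> * of_real (t * x))) n m)
     \<le> (8 * real q * C + 1) * t powr (- 1 / 2) * (real n * real m)"
    if tp: "t > 0" and n1: "n \<ge> 1" and m1: "m \<ge> 1" for t n m
  proof -
    obtain r j where r: "r \<in> {1..q}" "n = r + j * q" "j < n" by (rule index_decompose[OF n1])
    obtain s k where s: "s \<in> {1..q}" "m = s + k * q" "k < m" by (rule index_decompose[OF m1])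
    define E where "E = C * ((1 + real j + real k) * t powr (- 1 / 2))"
    define f where "f c \<alpha> \<beta> \<theta> = exp (- \<i> * of_real (t * L c \<theta>)) *
       complex_of_real (amplitude \<alpha> \<beta> r s c \<theta> * (trig \<alpha> j \<theta> * trig \<beta> k \<theta>))" for c \<alpha> \<beta> \<theta>
    have f: "integrable qmeas (f c \<alpha> \<beta>)" if "c \<in> centers" for c \<alpha> \<beta>
      unfolding f_def[abs_def] by (rule integrable_amplitude_integrand[OF that r(1) s(1)])
    have "Kf (\<lambda>x. exp (- \<i> * of_real (t * x))) n m =
      (\<Sum>c\<in>centers. integral\<^sup>L qmeas (\<lambda>\<theta>. \<Sum>\<alpha>\<in>UNIV. \<Sum>\<beta>\<in>UNIV. f c \<alpha> \<beta> \<theta>))"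
      unfolding Kf_def r(2) s(2)
      by (intro sum.cong refl Bochner_Integration.integral_cong)
         (simp add: kern_eq_amplitudes f_def sum_distrib_left)
    also have "\<dots> = (\<Sum>c\<in>centers. \<Sum>\<alpha>\<in>UNIV. \<Sum>\<beta>\<in>UNIV. integral\<^sup>L qmeas (f c \<alpha> \<beta>))"
      by (intro sum.cong refl) (simp add: Bochner_Integration.integral_sum f)
    also have "norm \<dots> \<le> (\<Sum>c\<in>centers. \<Sum>\<alpha>\<in>(UNIV :: bool set). \<Sum>\<beta>\<in>(UNIV :: bool set). E)"
      unfolding f_def[abs_def] E_def by (intro sum_norm_le est r(1) s(1) tp)
    also have "\<dots> = 4 * real q * E" by (simp add: UNIV_bool card_centers)
    also have "\<dots> \<le> 4 * real q * (C * (2 * (real n * real m) * t powr (- 1 / 2)))"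
    proof -
      have "1 + real j + real k \<le> real n + real m" using r(3) s(3) by linarith
      also have "real n + real m \<le> 2 * (real n * real m)"
      proof -
        have "real n * 1 \<le> real n * real m" "1 * real m \<le> real n * real m"
          using n1 m1 by (intro mult_left_mono mult_right_mono; simp)+
        thus ?thesis by linarith
      qed
      finally show ?thesis unfolding E_def using C(1) by (intro mult_left_mono mult_right_mono) auto
    qed
    also have "\<dots> \<le> (8 * real q * C + 1) * t powr (- 1 / 2) * (real n * real m)"
      by (simp add: algebra_simps)
    finally show ?thesis .
  qed
  moreover have "8 * real q * C + 1 > 0" using C(1) by (simp add: add_nonneg_pos)
  ultimately show ?thesis by blast
qed

end

context jacobi_operator
begin

text \<open>The kernel bound grows like \<open>n * m\<close>: the output weight \<open>1 / n\<close>
  absorbs \<open>n\<close>, and \<open>m\<close> is the weight of the input norm.\<close>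

lemma dispersive_estimate:
  "\<exists>C>0. \<forall>t>0. \<forall>u\<in>ellp_space 1 1.
     ent (propagator J t (P_c J (Ell2 u))) \<in> ellinf_space (-1) \<and>
     ellinf_norm (-1) (ent (propagator J t (P_c J (Ell2 u)))) \<le> C * t powr (-1/2) * ellp_norm 1 1 u"
proof -
  obtain C where C: "C > 0" "\<And>t n m. t > 0 \<Longrightarrow> n \<ge> 1 \<Longrightarrow> m \<ge> 1 \<Longrightarrow>
      norm (Kf (\<lambda>x. exp (- \<i> * of_real (t * x))) n m) \<le> C * t powr (- 1 / 2) * (real n * real m)"
    using kernel_estimate by blast
  have "ent (propagator J t (P_c J (Ell2 u))) \<in> ellinf_space (-1) \<and>
     ellinf_norm (-1) (ent (propagator J t (P_c J (Ell2 u)))) \<le> C * t powr (-1/2) * ellp_norm 1 1 u"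
    if t: "t > 0" and u: "u \<in> ellp_space 1 1" for t u
  proof -
    define v where "v = ent (propagator J t (P_c J (Ell2 u)))"
    have u0: "u 0 = 0" using u by (simp add: ellp_space_def)
    have bd: "cmod (of_real (real n powr - 1) * v n) \<le> C * t powr (- 1 / 2) * ellp_norm 1 1 u" if n: "n \<ge> 1" for n
    proof -
      have w: "(\<lambda>m. C * t powr (- 1 / 2) * real n * (real m * cmod (u m))) sums
          (C * t powr (- 1 / 2) * real n * ellp_norm 1 1 u)"
        by (rule sums_mult[OF ell1_1_weights[OF u]])
      have "norm (u m * Kf (\<lambda>x. exp (- \<i> * of_real (t * x))) n m) \<le>
          C * t powr (- 1 / 2) * real n * (real m * cmod (u m))" for m
      proof (cases "m \<ge> 1")
        case True
        have "cmod (u m) * norm (Kf (\<lambda>x. exp (- \<i> * of_real (t * x))) n m) \<le>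
            cmod (u m) * (C * t powr (- 1 / 2) * (real n * real m))"
          using C(2)[OF t n True] by (intro mult_left_mono) auto
        thus ?thesis by (simp only: norm_mult mult_ac)
      next
        case False
        hence "m = 0" by simp
        thus ?thesis using u0 by simp
      qed
      hence "norm (v n) \<le> C * t powr (- 1 / 2) * real n * ellp_norm 1 1 u"
        unfolding v_def sums_unique[OF propagator_P_c_sums[OF u]] sums_unique[OF w]
        by (rule norm_suminf_le[OF _ sums_summable[OF w]])
      hence "norm (v n) / real n \<le> C * t powr (- 1 / 2) * ellp_norm 1 1 u"
        using n by (simp add: field_simps)
      moreover have "real n powr - 1 = 1 / real n" using n by (simp add: powr_minus_divide)
      hence "cmod (of_real (real n powr - 1) * v n) = norm (v n) / real n"
        by (simp only: norm_mult norm_of_real) simp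
      ultimately show ?thesis by (simp only:)
    qed
    have "v 0 = 0" by (simp add: v_def)
    hence "v \<in> ellinf_space (-1)"
      unfolding ellinf_space_def using bd by (auto intro!: bdd_aboveI2)
    moreover have "ellinf_norm (-1) v \<le> C * t powr (- 1 / 2) * ellp_norm 1 1 u"
      unfolding ellinf_norm_def using bd by (intro cSUP_least) auto
    ultimately show ?thesis unfolding v_def by blast
  qed
  thus ?thesis using C(1) by blast
qed

end

theorem theorem3p1:
  fixes J :: "ell2 \<Rightarrow>\<^sub>L ell2" and q :: nat
  assumes "periodic_jacobi_op q J"
  shows "\<exists>C>0. \<forall>t>0. \<forall>u\<in>ellp_space 1 1.
           ent (propagator J t (P_c J (Ell2 u))) \<in> ellinf_space (-1) \<and>
           ellinf_norm (-1) (ent (propagator J t (P_c J (Ell2 u))))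
             \<le> C * t powr (-1/2) * ellp_norm 1 1 u"
proof -
  obtain a b where ab: "\<And>n. n \<ge> 1 \<Longrightarrow> a n > 0" "jacobi_op a b J" "q \<ge> 1" "periodic_coeffs q a b"
    using assms unfolding periodic_jacobi_op_def by blast
  \<comment> \<open>Redefining the coefficients at index 0 extends periodicity to that index and
    leaves the operator unchanged.\<close>
  define a' b' where "a' n = (if n = 0 then a q else a n)" and "b' n = (if n = 0 then b q else b n)" for n
  have "jacobi_operator a' b' q J"
  proof
    show "a' n > 0" for n using ab(1)[of n] ab(1)[of q] ab(3) by (simp add: a'_def)
    show "a' (n + q) = a' n" "b' (n + q) = b' n" for n
      using ab(3,4) by (auto simp: a'_def b'_def periodic_coeffs_def)
    show "jacobi_op a' b' J" using ab(2) by (auto simp: jacobi_op_def a'_def b'_def)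
  qed (rule ab(3))
  thus ?thesis by (rule jacobi_operator.dispersive_estimate)
qed

end
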